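(* For any $\gamma\in S$ there is an $\varepsilon>0$ such that for all $\beta\in(1,2)$ with $1/\beta\in[1/\gamma,1/\gamma+\varepsilon)$ and Lebesgue almost every $\lambda\in(1/\beta,1/\gamma+\varepsilon)$, the SRB-measure of $T_{\beta,\lambda}$ is absolutely continuous with respect to two-dimensional Lebesgue measure.
   Context: For $0<\lambda<1$ and $1<\beta<2$, let $Q=[0,1)\times[0,1)$ and define $T_{\beta,\lambda}\colon Q\to Q$ by $T_{\beta,\lambda}(x,y)=(\lambda x,\beta y)$ if $y<1/\beta$ and $T_{\beta,\lambda}(x,y)=(\lambda x+1-\lambda,\beta y-1)$ if $y\ge 1/\beta$. Let $\nu$ be two-dimensional Lebesgue measure on $Q$ and $\nu_n=\frac1n\sum_{k=0}^{n-1}\nu\circ T_{\beta,\lambda}^{-k}$; the SRB-measure of $T_{\beta,\lambda}$ is the (unique) weak limit of $\nu_n$ as $n\to\infty$. $\beta$-shifts: for $\beta>1$ let $f_\beta(x)=\beta x\bmod 1$ on $[0,1]$, $d(x,\beta)=(\lfloor\beta f_\beta^{k-1}(x)\rfloor)_{k\ge1}$, and $S_\beta^+$ the closure in the product topology of $\{d(x,\beta):x\in[0,1)\}$. Let $S_\beta$ be the set of bi-infinite sequences $(\ldots,a_{-1},a_0,a_1,\ldots)$ with $(a_n,a_{n+1},\ldots)\in S_\beta^+$ for all $n\in\mathbb Z$, and $S_\beta^-$ the set of $(b_1,b_2,\ldots)$ such that $(\ldots,b_2,b_1,0,0,\ldots)\in S_\beta$ (with $b_1$ at position $0$ and zeros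 at positive positions). Define $S=\{\beta>1: S_\beta^+=S_\beta^-\}$. *)

theory Defs
  imports "HOL-Analysis.Analysis"
begin

definition Qsq :: "(real \<times> real) set" where
  "Qsq = {0..<1} \<times> {0..<1}"

definition Tmap :: "real \<Rightarrow> real \<Rightarrow> real \<times> real \<Rightarrow> real \<times> real" where
  "Tmap \<beta> lam = (\<lambda>(x, y). if y < 1 / \<beta> then (lam * x, \<beta> * y)
                           else (lam * x + 1 - lam, \<beta> * y - 1))"

text \<open>Integral of f against nu_n = (1/n) sum_{k<n} nu o T^{-k},
  where nu is Lebesgue measure restricted to Q.\<close>
definition avg_push :: "real \<Rightarrow> real \<Rightarrow> nat \<Rightarrow> (real \<times> real \<Rightarrow> real) \<Rightarrow> real" where
  "avg_push \<beta> lam n f =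
     (1 / real n) * (\<Sum>k<n. (LINT p:Qsq|lborel. f ((Tmap \<beta> lam ^^ k) p)))"

definition is_SRB :: "real \<Rightarrow> real \<Rightarrow> (real \<times> real) measure \<Rightarrow> bool" where
  "is_SRB \<beta> lam \<mu> \<longleftrightarrow>
     finite_measure \<mu> \<and> sets \<mu> = sets borel \<and>
     (\<forall>f :: real \<times> real \<Rightarrow> real. continuous_on UNIV f \<and> bounded (range f) \<longrightarrow>
        (\<lambda>n. avg_push \<beta> lam n f) \<longlonglongrightarrow> integral\<^sup>L \<mu> f)"

definition fbeta :: "real \<Rightarrow> real \<Rightarrow> real" where
  "fbeta \<beta> x = \<beta> * x - of_int \<lfloor>\<beta> * x\<rfloor>"

text \<open>beta-expansion d(x,beta); index k-1 (0-based) holds the k-th digit.\<close>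
definition dexp :: "real \<Rightarrow> real \<Rightarrow> nat \<Rightarrow> int" where
  "dexp x \<beta> k = \<lfloor>\<beta> * (fbeta \<beta> ^^ k) x\<rfloor>"

text \<open>S_beta^+: closure in the product topology on nat => int.\<close>
definition Splus :: "real \<Rightarrow> (nat \<Rightarrow> int) set" where
  "Splus \<beta> = closure {dexp x \<beta> | x. 0 \<le> x \<and> x < 1}"

definition Sbi :: "real \<Rightarrow> (int \<Rightarrow> int) set" where
  "Sbi \<beta> = {a. \<forall>n::int. (\<lambda>k::nat. a (n + int k)) \<in> Splus \<beta>}"

text \<open>S_beta^-: (b_1,b_2,...) (stored 0-based as b 0, b 1, ...) such that
  (..., b_2, b_1, 0, 0, ...) with b_1 at position 0 lies in S_beta.\<close>
definition Sminus :: "real \<Rightarrow> (nat \<Rightarrow> int) set" where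
  "Sminus \<beta> = {b. (\<lambda>m::int. if m > 0 then 0 else b (nat (- m))) \<in> Sbi \<beta>}"

definition Sset :: "real set" where
  "Sset = {\<beta>. \<beta> > 1 \<and> Splus \<beta> = Sminus \<beta>}"

end

theory Submission
  imports Defs
begin

text \<open>
  In the expanding direction \<open>T\<close> is the \<open>\<beta>\<close>-map, whose transfer operator sends step functions on
  \<open>[0, t)\<close>, \<open>t\<close> in the orbit of \<open>1\<close>, to step functions of the same kind; a renewal argument gives
  the Cesaro limit density \<open>h\<close>. The contracting coordinate forgets its initial value, so
  the averages of \<open>\<nu>\<close> converge weakly, and their limit is also the limit of the laws of
  \<open>(x + U, y)\<close>, where \<open>y\<close> is the \<open>n\<close>-th iterate of a point distributed by \<open>h\<close>, \<open>x\<close> is the sum of the \<open>n\<close> past digits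
  weighted by powers of \<open>\<lambda>\<close>, and \<open>U\<close> is uniform on an interval of length \<open>\<beta>^-n\<close>.

  Two pasts over the same \<open>y\<close> that first differ at time \<open>m\<close> have \<open>x\<close>-coordinates differing by
  \<open>\<lambda>^m\<close> times a power series \<open>F(\<lambda>)\<close>. Reversed admissible words lie in \<open>S\<^sub>\<gamma>\<^sup>-\<close>, which equals \<open>S\<^sub>\<gamma>\<^sup>+\<close>, so
  \<open>F(1/\<gamma>) \<ge> 0\<close>, with near-equality only if \<open>F\<close> is close to a series of the form \<open>1 - \<Sum> b\<^sub>k \<lambda>^k\<close> with
  \<open>b\<^sub>k \<ge> 0\<close>, which is strictly decreasing. Hence \<open>F\<close> is transversal to \<open>0\<close> near \<open>1/\<gamma>\<close>, and the squared
  \<open>L\<^sup>2\<close>-norms of the densities, integrated over \<open>\<lambda> \<ge> \<lambda>\<^sub>0 > 1/\<beta>\<close>, are bounded by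
  \<open>\<Sum> (\<beta> \<lambda>\<^sub>0)^-m\<close>. By Fatou's lemma, for almost every \<open>\<lambda>\<close> infinitely many of the densities are bounded
  in \<open>L\<^sup>2\<close>, so that the weak limit has a density.
\<close>

section \<open>Admissible words and transversality\<close>

text \<open>Smoothing at scale \<beta>^-n turns the squared norm into \<beta>^n times the mass of
  pairs of pasts whose x-coordinates are within \<beta>^-n of each other. Pairs agreeing on m digits
  have mass of order at most \<beta>^-m, and by transversality they are that close only for
  parameters in a set of measure O(\<beta>^-n / \<lambda>0^m), \<lambda>0 being the lower end of the
  parameter interval. The condition \<lambda>0 > 1/\<beta> is convergence of the resulting geometric
  series. The condition \<beta> \<le> \<gamma> enters because words admissible for \<beta> stay
  admissible for \<gamma>, so one \<epsilon>, depending on \<gamma> alone, serves all \<beta>.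
  Fatou's lemma yields a subsequence that depends on \<lambda>. This is harmless: weak convergence
  of the full sequence holds for every \<lambda>, and the subsequence only shows that the limit
  already at hand has a density.\<close>

text \<open>A word lists the past digits, most recent first: \<open>branch_point b w y\<close> is the preimage of \<open>y\<close> along the inverse
  branch of the iterated \<open>\<beta>\<close>-map selected by \<open>w\<close>, and \<open>branch_weight b w y\<close> is \<open>b^-n\<close> if all intermediate points are below 1,
  and 0 otherwise.\<close>

fun branch_weight :: "real \<Rightarrow> nat list \<Rightarrow> real \<Rightarrow> real" where
  "branch_weight b [] y = 1"
| "branch_weight b (d # w) y = (if (y + real d) / b < 1 then branch_weight b w ((y + real d) / b) / b else 0)"

fun branch_point :: "real \<Rightarrow> nat list \<Rightarrow> real \<Rightarrow> real" where
  "branch_point b [] y = y"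
| "branch_point b (d # w) y = branch_point b w ((y + real d) / b)"

text \<open>One step sends x to \<open>l * x + (1 - l) * d\<close>, so the head of the list, the
  latest digit, is left unscaled. The normalising factor \<open>1 - l\<close> is kept outside, which
  leaves a polynomial with coefficients 0 and 1.\<close>

fun digit_sum :: "real \<Rightarrow> nat list \<Rightarrow> real" where
  "digit_sum l [] = 0"
| "digit_sum l (d # w) = real d + l * digit_sum l w"

text \<open>All binary words are kept, since admissibility depends on the endpoint y; inadmissible
  ones drop out of sums through \<open>branch_weight\<close> being 0.\<close>

definition words :: "nat \<Rightarrow> nat list set" where
  "words n = {w. set w \<subseteq> {0, 1} \<and> length w = n}"

lemma finite_words [simp]: "finite (words n)"
  unfolding words_def by (rule finite_lists_length_eq) simp

lemma words_0 [simp]: "words 0 = {[]}"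
  by (auto simp: words_def)

lemma words_Suc: "words (Suc n) = (#) 0 ` words n \<union> (#) 1 ` words n"
  by (auto simp: words_def length_Suc_conv image_iff)

lemma sum_words_Suc:
  "(\<Sum>w\<in>words (Suc n). F w) = (\<Sum>w\<in>words n. F (0 # w)) + (\<Sum>w\<in>words n. F (1 # w))"
  unfolding words_Suc
  by (subst sum.union_disjoint) (auto simp: sum.reindex inj_on_def)

lemma branch_weight_nonneg: "b > 0 \<Longrightarrow> 0 \<le> branch_weight b w y"
  by (induction w arbitrary: y) auto

lemma branch_weight_le: "b > 0 \<Longrightarrow> branch_weight b w y \<le> (1 / b) ^ length w"
proof (induction w arbitrary: y)
  case (Cons d w)
  then have "branch_weight b w ((y + real d) / b) / b \<le> (1 / b) ^ length w / b"
    by (intro divide_right_mono) auto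
  with Cons.prems show ?case by simp
qed simp

lemma branch_weight_measurable [measurable]: "branch_weight b w \<in> borel_measurable borel"
proof (induction w)
  case (Cons d w)
  note [measurable] = Cons
  show ?case by simp
qed simp

lemma branch_point_measurable [measurable]: "branch_point b w \<in> borel_measurable borel"
proof (induction w)
  case (Cons d w)
  note [measurable] = Cons
  show ?case by simp
qed simp

lemma digit_sum_nonneg: "l \<ge> 0 \<Longrightarrow> 0 \<le> digit_sum l w"
  by (induction w) auto

lemma digit_sum_mono: "0 \<le> l \<Longrightarrow> l \<le> l' \<Longrightarrow> digit_sum l w \<le> digit_sum l' w"
  by (induction w) (auto intro!: mult_mono digit_sum_nonneg)

lemma digit_sum_le:
  assumes "0 \<le> l" "l < 1" "set w \<subseteq> {0, 1}"
  shows "digit_sum l w \<le> 1 / (1 - l)"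
  using assms(3)
proof (induction w)
  case (Cons d w)
  then have "l * digit_sum l w \<le> l * (1 / (1 - l))"
    using assms by (intro mult_left_mono) auto
  then have "digit_sum l (d # w) \<le> 1 + l * (1 / (1 - l))"
    using Cons.prems by auto
  also have "\<dots> = 1 / (1 - l)" using assms by (simp add: field_simps)
  finally show ?case .
qed (use assms in simp)

lemma digit_sum_eq_sum: "l * digit_sum l w = (\<Sum>i<length w. real (w ! i) * l ^ Suc i)"
proof (induction w)
  case (Cons d w)
  show ?case
    unfolding length_Cons sum.lessThan_Suc_shift
    using arg_cong[OF Cons, of "\<lambda>x. l * x"] by (simp add: sum_distrib_left algebra_simps)
qed simp

text \<open>The bound on \<open>digit_sum q u\<close> forces the first \<open>K\<close> digits to
  vanish, as a 1 at index i < K would contribute q^i \<ge> q^(K-1). The right-hand sides are then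
  tails of the geometric series and of its derivative: the sums of r^(i+1) and of (i+1) r^i over i
  \<ge> K. The value bound is carried along because it feeds the increment bound in the
  induction.\<close>

lemma digit_sum_zero_prefix:
  assumes q: "0 < q" "q \<le> 1" and r: "0 \<le> r" "r < 1"
    and "set u \<subseteq> {0, 1}" "K > 0 \<Longrightarrow> digit_sum q u < q ^ (K - 1)"
    and "0 \<le> l" "l \<le> l'" "l' \<le> r"
  shows "l' * digit_sum l' u \<le> r / (1 - r) * r ^ K \<and>
         l' * digit_sum l' u - l * digit_sum l u \<le> (1 / (1 - r)\<^sup>2 + real K / (1 - r)) * r ^ K * (l' - l)"
  using assms(5-)
proof (induction K arbitrary: u)
  case 0
  have A: "l' * digit_sum l' u \<le> r * (1 / (1 - r))" if "set u \<subseteq> {0,1}" for u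
  proof (rule mult_mono)
    show "digit_sum l' u \<le> 1 / (1 - r)"
      using digit_sum_le[of l' u] that 0 r frac_le[of 1 1 "1 - r" "1 - l'"] by auto
  qed (use r 0 digit_sum_nonneg[of l' u] in auto)
  have B: "l' * digit_sum l' u - l * digit_sum l u \<le> (1 / (1 - r)\<^sup>2) * (l' - l)" if "set u \<subseteq> {0,1}" for u
    using that
  proof (induction u)
    case (Cons d u)
    have e: "l' * digit_sum l' (d # u) - l * digit_sum l (d # u)
      = real d * (l' - l) + l' * (l' * digit_sum l' u - l * digit_sum l u) + (l' - l) * (l * digit_sum l u)"
      by (simp add: algebra_simps)
    have "l * digit_sum l u \<le> l' * digit_sum l' u"
      using 0 digit_sum_mono[of l l' u] digit_sum_nonneg[of l u] by (intro mult_mono) auto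
    with A[of u] Cons have v: "l * digit_sum l u \<le> r / (1 - r)" by auto
    have nn: "0 \<le> (1 / (1 - r)\<^sup>2) * (l' - l)" using 0 by auto
    have "l' * (l' * digit_sum l' u - l * digit_sum l u) \<le> l' * ((1 / (1 - r)\<^sup>2) * (l' - l))"
      using Cons 0 by (intro mult_left_mono) auto
    also have "\<dots> \<le> r * ((1 / (1 - r)\<^sup>2) * (l' - l))"
      using 0 nn by (intro mult_right_mono) auto
    finally have m: "l' * (l' * digit_sum l' u - l * digit_sum l u) \<le> r * ((1 / (1 - r)\<^sup>2) * (l' - l))" .
    have "l' * digit_sum l' (d # u) - l * digit_sum l (d # u)
      \<le> 1 * (l' - l) + r * ((1 / (1 - r)\<^sup>2) * (l' - l)) + (l' - l) * (r / (1 - r))"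
      unfolding e using m v Cons.prems 0 by (intro add_mono mult_left_mono mult_right_mono) auto
    also have "\<dots> = (1 + r * (1 / (1 - r)\<^sup>2) + r / (1 - r)) * (l' - l)"
      by (simp add: algebra_simps)
    \<comment> \<open>The Lipschitz constant is the fixed point of the recursion that peels off one
      digit.\<close>
    also have "1 + r * (1 / (1 - r)\<^sup>2) + r / (1 - r) = 1 / (1 - r)\<^sup>2"
      using r by (simp add: divide_simps power2_eq_square) (simp add: algebra_simps)
    finally show ?case .
  qed (use 0 in simp)
  show ?case using A[of u] B[of u] 0 by simp
next
  case (Suc K)
  show ?case
  proof (cases u)
    case Nil
    have "0 \<le> (1 / (1 - r)\<^sup>2 + real (Suc K) / (1 - r)) * r ^ Suc K * (l' - l)"
      using Suc.prems r by (intro mult_nonneg_nonneg add_nonneg_nonneg) auto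
    then show ?thesis using Nil r by simp
  next
    case (Cons d v)
    have "digit_sum q u < 1" using Suc.prems(2) power_le_one[of q K] q by auto
    moreover have "digit_sum q v \<ge> 0" using digit_sum_nonneg[of q v] q by simp
    ultimately have d0: "d = 0" using Cons q
      by (smt (verit, ccfv_SIG) mult_nonneg_nonneg of_nat_0_le_iff of_nat_less_1_iff less_one digit_sum.simps(2) gr_zeroI)
    have "K > 0 \<Longrightarrow> digit_sum q v < q ^ (K - 1)"
      using Suc.prems(2) Cons d0 q by (cases K) auto
    with Suc.IH[of v] Suc.prems Cons have IH:
      "l' * digit_sum l' v \<le> r / (1 - r) * r ^ K"
      "l' * digit_sum l' v - l * digit_sum l v \<le> (1 / (1 - r)\<^sup>2 + real K / (1 - r)) * r ^ K * (l' - l)"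
      by auto
    define c where "c = (1 / (1 - r)\<^sup>2 + real K / (1 - r)) * r ^ K"
    have c0: "c \<ge> 0" unfolding c_def using r by auto
    have 1: "l' * (l' * digit_sum l' v) \<le> r * (r / (1 - r) * r ^ K)"
      using IH(1) Suc.prems r digit_sum_nonneg[of l' v] by (intro mult_mono[of l' r]) auto
    have e: "l' * digit_sum l' u - l * digit_sum l u = l' * (l' * digit_sum l' v - l * digit_sum l v) + (l' - l) * (l * digit_sum l v)"
      using Cons d0 by (simp add: algebra_simps)
    have "l * digit_sum l v \<le> l' * digit_sum l' v"
      using Suc.prems digit_sum_mono[of l l' v] digit_sum_nonneg[of l v] by (intro mult_mono) auto
    with IH(1) have v: "l * digit_sum l v \<le> r / (1 - r) * r ^ K" by linarith
    have "l' * (l' * digit_sum l' v - l * digit_sum l v) \<le> l' * (c * (l' - l))"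
      using IH(2) Suc.prems unfolding c_def by (intro mult_left_mono) auto
    also have "\<dots> \<le> r * (c * (l' - l))"
      using Suc.prems c0 by (intro mult_right_mono) auto
    finally have "l' * digit_sum l' u - l * digit_sum l u \<le> r * (c * (l' - l)) + (l' - l) * (r / (1 - r) * r ^ K)"
      unfolding e using v Suc.prems by (intro add_mono mult_left_mono) auto
    also have "\<dots> = (1 / (1 - r)\<^sup>2 + real (Suc K) / (1 - r)) * r ^ Suc K * (l' - l)"
      by (simp add: c_def divide_inverse algebra_simps)
    finally show ?thesis using 1 Cons d0 by (simp add: mult_ac)
  qed
qed

text \<open>At \<open>q = 1/\<gamma>\<close> the bound on \<open>digit_sum q u'\<close> makes the function nonnegative. If it is nearly 0 there, then \<open>u\<close> starts
  with many zeros and \<open>q * digit_sum q u'\<close> is nearly 1, so on the whole interval the function decreases with slope at least 1/4.\<close>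

lemma transversality:
  assumes q: "0 < q" "q < 1"
  obtains e C :: real where "e > 0" "C > 0" "q + e < 1"
    "\<And>u u' l l' s. set u \<subseteq> {0, 1} \<Longrightarrow> set u' \<subseteq> {0, 1} \<Longrightarrow> q * digit_sum q u' \<le> 1 \<Longrightarrow>
        q \<le> l \<Longrightarrow> l \<le> l' \<Longrightarrow> l' \<le> q + e \<Longrightarrow>
        \<bar>1 + l * digit_sum l u - l * digit_sum l u'\<bar> \<le> s \<Longrightarrow> \<bar>1 + l' * digit_sum l' u - l' * digit_sum l' u'\<bar> \<le> s \<Longrightarrow>
        l' - l \<le> C * s"
proof -
  \<comment> \<open>Room between \<open>q\<close> and 1: every parameter below is at most
    \<open>r\<close>, so all series are dominated by geometric ones with ratio
    \<open>r\<close>.\<close>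
  define r where "r = (1 + q) / 2"
  have r: "0 < r" "r < 1" "q < r" using q by (auto simp: r_def)
  \<comment> \<open>The Lipschitz constant for words starting with \<open>K\<close> zeros. It tends
    to 0, so enough zeros make the slope of the \<open>u\<close>-part less than 1/4.\<close>
  define c where "c K = (1 / (1 - r)\<^sup>2 + real K / (1 - r)) * r ^ K" for K
  have "(\<lambda>K. 1 / (1 - r)\<^sup>2 * r ^ K + (1 / (1 - r)) * (real K * r ^ K)) \<longlonglongrightarrow>
      1 / (1 - r)\<^sup>2 * 0 + (1 / (1 - r)) * 0"
    using r by (intro tendsto_intros LIMSEQ_power_zero lim_n_over_pown powser_times_n_limit_0) auto
  then have "c \<longlonglongrightarrow> 0" unfolding c_def by (simp add: algebra_simps)
  then have "eventually (\<lambda>K. c K < 1 / 4) sequentially" by (rule order_tendstoD) simp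
  then obtain K where K: "c (Suc K) < 1 / 4" by (meson eventually_sequentially le_SucI order_refl)
  \<comment> \<open>Small enough that a value of at most \<open>2 * d\<close> at \<open>q\<close>
    gives \<open>q * digit_sum q u < q ^ Suc K\<close>, hence \<open>Suc K\<close> leading
    zeros.\<close>
  define d where "d = q ^ Suc K / 4"
  have d: "0 < d" "d \<le> 1 / 4" using q power_le_one[of q "Suc K"] by (auto simp: d_def)
  have c0: "c 0 > 0" using r by (simp add: c_def)
  \<comment> \<open>The first term keeps \<open>q + e\<close> below \<open>r\<close>; the second
    limits the change of the \<open>u'\<close>-part between \<open>q\<close> and \<open>l\<close> to
    \<open>d\<close>.\<close>
  define e where "e = min ((1 - q) / 4) (d / c 0)"
  have e: "e > 0" "q + e < r" "c 0 * e \<le> d"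
    using q d c0 by (auto simp: e_def r_def field_simps min_def)
  \<comment> \<open>8 serves small values, where the slope is at least 1/4 and the two values differ
    by at most \<open>2 * s\<close>; \<open>e / d\<close> serves \<open>s > d\<close>, where the
    length \<open>e\<close> of the parameter interval is bound enough.\<close>
  define C where "C = max 8 (e / d)"
  show ?thesis
  proof
    show "e > 0" by fact
    show "C > 0" by (auto simp: C_def)
    show "q + e < 1" using e r by linarith
    fix u u' l l' s
    assume u: "set u \<subseteq> {0, 1}" "set u' \<subseteq> {0, 1}" and v1: "q * digit_sum q u' \<le> 1"
      and l: "q \<le> l" "l \<le> l'" "l' \<le> q + e"
      and F: "\<bar>1 + l * digit_sum l u - l * digit_sum l u'\<bar> \<le> s" "\<bar>1 + l' * digit_sum l' u - l' * digit_sum l' u'\<bar> \<le> s"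
    show "l' - l \<le> C * s"
    proof (cases "s \<le> d")
      case False
      have "l' - l \<le> e" using l by linarith
      also have "e = e / d * d" using d by simp
      also have "\<dots> \<le> C * s" using False d e by (intro mult_mono) (auto simp: C_def)
      finally show ?thesis .
    next
      case True
      have "l * digit_sum l u' - q * digit_sum q u' \<le> c 0 * (l - q)"
        unfolding c_def by (rule conjunct2[OF digit_sum_zero_prefix[of q]]) (use u q r l e in auto)
      also have "\<dots> \<le> c 0 * e" using c0 l by (intro mult_left_mono) auto
      finally have "l * digit_sum l u' - q * digit_sum q u' \<le> d" using e by linarith
      moreover have mon: "q * digit_sum q u \<le> l * digit_sum l u"
        using q l digit_sum_mono[of q l u] digit_sum_nonneg[of q u] by (intro mult_mono) auto
      ultimately have *: "1 + q * digit_sum q u - q * digit_sum q u' \<le> 2 * d" using F True by linarith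
      have "q * digit_sum q u < q * q ^ K" using * v1 d by (auto simp: d_def)
      then have vK: "digit_sum q u < q ^ K" using q by simp
      \<comment> \<open>The subtracted series is nearly 1 at \<open>q\<close>. With nonnegative
        coefficients, the increment of l V(l) is at least V(l) (l' - l), so its slope is at least
        1/2.\<close>
      have v': "digit_sum q u' \<ge> 1 / 2"
      proof -
        have "1 / 2 \<le> q * digit_sum q u'" using * d mult_nonneg_nonneg[of q "digit_sum q u"] digit_sum_nonneg[of q u] q by linarith
        also have "\<dots> \<le> 1 * digit_sum q u'" using q digit_sum_nonneg[of q u'] by (intro mult_right_mono) auto
        finally show ?thesis by simp
      qed
      have 1: "l' * digit_sum l' u - l * digit_sum l u \<le> 1 / 4 * (l' - l)"
      proof -
        have "l' * digit_sum l' u - l * digit_sum l u \<le> c (Suc K) * (l' - l)"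
          unfolding c_def
          by (rule conjunct2[OF digit_sum_zero_prefix[of q]]) (use u q r l e vK in auto)
        also have "\<dots> \<le> 1 / 4 * (l' - l)" using K l by (intro mult_right_mono) auto
        finally show ?thesis .
      qed
      have "1 / 2 * (l' - l) \<le> digit_sum l u' * (l' - l)"
        using v' digit_sum_mono[of q l u'] l q by (intro mult_right_mono) auto
      also have "\<dots> \<le> l' * digit_sum l' u' - l * digit_sum l u'"
        using mult_left_mono[OF digit_sum_mono[of l l' u'], of l'] l q by (simp add: algebra_simps)
      finally have 2: "1 / 2 * (l' - l) \<le> l' * digit_sum l' u' - l * digit_sum l u'" .
      have "l' - l \<le> 8 * s"
      proof -
        have "(a - b) - (c - d) \<le> 2 * s" if "\<bar>1 + d - b\<bar> \<le> s" "\<bar>1 + c - a\<bar> \<le> s" for a b c d :: real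
          using that by linarith
        from this[OF F] 1 2 show ?thesis by argo
      qed
      also have "\<dots> \<le> C * s" using F by (intro mult_right_mono) (auto simp: C_def)
      finally show ?thesis .
    qed
  qed
qed

section \<open>Beta-expansions and reversed words\<close>

lemma dexp_orbit:
  assumes x: "\<And>k. 0 \<le> x k \<and> x k < 1" and e: "\<And>k. g * x k = of_int (a k) + x (Suc k)"
  shows "dexp (x 0) g = a"
proof -
  \<comment> \<open>As the next point lies in [0, 1), the digit is forced to be the integer part, so
    the given sequence is the greedy expansion.\<close>
  have f: "\<lfloor>g * x k\<rfloor> = a k" for k
    using x[of "Suc k"] by (simp add: e floor_eq_iff)
  have "(fbeta g ^^ k) (x 0) = x k" for k
    by (induction k) (auto simp: fbeta_def f, simp add: e)
  then show ?thesis by (auto simp: dexp_def f)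
qed

lemma dexp_partial_sum:
  assumes "g > 1"
  shows "x = (\<Sum>i<n. of_int (dexp x g i) * (1 / g) ^ Suc i) + (1 / g) ^ n * (fbeta g ^^ n) x"
proof (induction n)
  case (Suc n)
  let ?y = "(fbeta g ^^ n) x"
  have "(1 / g) ^ n * ?y = of_int (dexp x g n) * (1 / g) ^ Suc n + (1 / g) ^ Suc n * fbeta g ?y"
    using assms by (simp add: dexp_def fbeta_def field_simps)
  with Suc show ?case by simp
qed simp

text \<open>For an actual expansion the remainder is nonnegative, so partial sums are at most x < 1.
  The condition involves finitely many coordinates, hence is closed in the product topology and
  survives the closure in \<open>Splus\<close>.\<close>

lemma Splus_partial_sum_le:
  assumes "g > 1" "a \<in> Splus g"
  shows "(\<Sum>i<n. of_int (a i) * (1 / g) ^ Suc i) \<le> (1::real)"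
proof -
  let ?S = "{a :: nat \<Rightarrow> int. (\<Sum>i<n. of_int (a i) * (1 / g) ^ Suc i) \<le> (1::real)}"
  have "continuous_on UNIV (\<lambda>a :: nat \<Rightarrow> int. real_of_int (a i))" for i
  proof -
    have "continuous_on UNIV (real_of_int \<circ> (\<lambda>a :: nat \<Rightarrow> int. a i))"
      by (rule continuous_on_compose) (auto intro: continuous_on_product_coordinates Topological_Spaces.continuous_on_discrete)
    then show ?thesis by (simp add: o_def)
  qed
  then have "closed ?S"
    by (intro closed_Collect_le continuous_on_sum continuous_on_mult continuous_on_const)
  moreover have "dexp x g \<in> ?S" if "0 \<le> x" "x < 1" for x
  proof -
    have "(fbeta g ^^ n) x \<ge> 0"
      using that by (cases n) (auto simp: fbeta_def of_int_floor_le)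
    then have "(1 / g) ^ n * (fbeta g ^^ n) x \<ge> 0" using assms by simp
    with dexp_partial_sum[OF assms(1), of x n] that show ?thesis by simp
  qed
  ultimately have "Splus g \<subseteq> ?S"
    unfolding Splus_def by (intro closure_minimal) auto
  then show ?thesis using assms by auto
qed

text \<open>The number with base-\<open>g\<close> expansion w_(i-1), ..., w_0, 0, 0, .... It
  imitates \<open>branch_point\<close> started at 0 but continues past the end of the word with
  digits 0, as a bi-infinite sequence requires.\<close>

primrec back_orbit :: "real \<Rightarrow> nat list \<Rightarrow> nat \<Rightarrow> real" where
  "back_orbit g w 0 = 0"
| "back_orbit g w (Suc i) = ((if i < length w then real (w ! i) else 0) + back_orbit g w i) / g"

lemma branch_point_take_bounds:
  assumes "b > 0" "branch_weight b w y \<noteq> 0" "0 \<le> y" "y < 1"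
  shows "0 \<le> branch_point b (take i w) y \<and> branch_point b (take i w) y < 1"
  using assms
proof (induction w arbitrary: y i)
  case (Cons d w)
  then have "(y + real d) / b < 1" "branch_weight b w ((y + real d) / b) \<noteq> 0" "0 \<le> (y + real d) / b"
    by (auto split: if_splits)
  with Cons show ?case by (cases i) auto
qed simp

lemma branch_point_take_Suc: "i < length w \<Longrightarrow> branch_point b (take (Suc i) w) y = (real (w ! i) + branch_point b (take i w) y) / b"
proof (induction w arbitrary: i y)
  case (Cons d w)
  show ?case
  proof (cases i)
    case (Suc j)
    then show ?thesis using Cons.IH[of j "(y + real d) / b"] Cons.prems by simp
  qed (simp add: add.commute)
qed simp

lemma back_orbit_bounds:
  assumes g: "1 < b" "b \<le> g" and w: "branch_weight b w y \<noteq> 0" and y: "0 \<le> y" "y < 1"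
  shows "0 \<le> back_orbit g w i \<and> back_orbit g w i \<le> branch_point b (take i w) y"
proof (induction i)
  case (Suc i)
  have "branch_point b (take i w) y \<ge> 0" using branch_point_take_bounds[of b w y i] assms by auto
  then show ?case
  proof (cases "i < length w")
    case True
    then have "(real (w ! i) + back_orbit g w i) / g \<le> (real (w ! i) + branch_point b (take i w) y) / b"
      using Suc g by (intro frac_le) auto
    with True Suc g show ?thesis by (auto simp: branch_point_take_Suc)
  next
    case False
    have "back_orbit g w i / g \<le> back_orbit g w i / 1" using Suc g by (intro frac_le) auto
    then show ?thesis using False Suc g by auto
  qed
qed (use y in simp)

text \<open>The reversed word preceded and followed by zeros is in \<open>S\<^sub>\<gamma>\<close>: its tails are expansions of the orbit obtained by
  replacing \<open>y\<close> by 0 and \<open>\<beta>\<close> by \<open>\<gamma> \<ge> \<beta>\<close>, which only decreases the points, so they stay in \<open>[0, 1)\<close>.\<close>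

lemma digit_sum_le_of_Sset:
  assumes S: "g \<in> Sset" and g: "1 < b" "b \<le> g" and w: "branch_weight b w y \<noteq> 0" and y: "0 \<le> y" "y < 1"
  shows "1 / g * digit_sum (1 / g) w \<le> 1"
proof -
  let ?d = "\<lambda>i. if i < length w then int (w ! i) else 0"
  have "?d \<in> Sminus g"
    unfolding Sminus_def Sbi_def
  proof (intro CollectI allI)
    fix N :: int
    let ?a = "\<lambda>m::int. if 0 < m then 0 else ?d (nat (- m))"
    \<comment> \<open>Position m \<le> 0 carries digit number -m of the word, or 0 beyond its end,
      so the point whose expansion starts at m is \<open>back_orbit g w\<close> at index 1 - m. For
      m > 0 only zeros follow, and \<open>nat\<close> truncates the index to 0, whose point is
      0.\<close>
    let ?x = "\<lambda>k. back_orbit g w (nat (1 - (N + int k)))"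
    have x: "0 \<le> ?x k \<and> ?x k < 1" for k
      using back_orbit_bounds[OF g w y, of "nat (1 - (N + int k))"]
        branch_point_take_bounds[of b w y "nat (1 - (N + int k))"] g w y
      by linarith
    have D: "dexp (?x 0) g = (\<lambda>k. ?a (N + int k))"
    proof (rule dexp_orbit)
      fix k
      show "0 \<le> ?x k \<and> ?x k < 1" by (rule x)
      show "g * ?x k = of_int (?a (N + int k)) + ?x (Suc k)"
      proof (cases "N + int k > 0")
        case False
        then have "nat (1 - (N + int k)) = Suc (nat (- (N + int k)))"
          "nat (1 - (N + int (Suc k))) = nat (- (N + int k))" by auto
        then show ?thesis using False g by (simp del: of_nat_Suc)
      qed simp
    qed
    have "dexp (?x 0) g \<in> {dexp x g |x. 0 \<le> x \<and> x < 1}"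
      using x[of 0] by (intro CollectI exI[of _ "?x 0"] conjI refl) auto
    then show "(\<lambda>k. ?a (N + int k)) \<in> Splus g"
      unfolding Splus_def D by (rule subsetD[OF closure_subset])
  qed
  \<comment> \<open>Reversal of time: by the equality of the two shifts, the past digits become a
    forward sequence, whose value in base \<open>g\<close> is at most 1.\<close>
  then have "?d \<in> Splus g" using S by (simp add: Sset_def)
  then have "(\<Sum>i<length w. of_int (?d i) * (1 / g) ^ Suc i) \<le> (1::real)"
    using g by (intro Splus_partial_sum_le) auto
  also have "(\<Sum>i<length w. of_int (?d i) * (1 / g) ^ Suc i) = 1 / g * digit_sum (1 / g) w"
    unfolding digit_sum_eq_sum by (intro sum.cong) auto
  finally show ?thesis .
qed

section \<open>Weak limits of densities\<close>

text \<open>Dyadic convex combinations of the tail. Midpoints are all that the parallelogram law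
  uses, and properties stable under averaging two functions pass to the hull by rule
  induction.\<close>

inductive_set midpoint_hull :: "(nat \<Rightarrow> 'a \<Rightarrow> real) \<Rightarrow> nat \<Rightarrow> ('a \<Rightarrow> real) set"
  for h n where
  tail: "n \<le> m \<Longrightarrow> h m \<in> midpoint_hull h n"
| midpoint: "u \<in> midpoint_hull h n \<Longrightarrow> v \<in> midpoint_hull h n \<Longrightarrow>
    (\<lambda>x. (u x + v x) / 2) \<in> midpoint_hull h n"

lemma midpoint_hull_antimono: "m \<le> n \<Longrightarrow> u \<in> midpoint_hull h n \<Longrightarrow> u \<in> midpoint_hull h m"
  by (rotate_tac 1, induction rule: midpoint_hull.induct) (auto intro: midpoint_hull.intros)

lemma (in finite_measure) integrable_of_square:
  fixes u :: "'a \<Rightarrow> real"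
  assumes [measurable]: "u \<in> borel_measurable M" and "integrable M (\<lambda>x. (u x)\<^sup>2)"
  shows "integrable M u"
proof (rule Bochner_Integration.integrable_bound)
  show "integrable M (\<lambda>x. 1 + (u x)\<^sup>2)" using assms by simp
  have "\<bar>t\<bar> \<le> 1 + t\<^sup>2" for t :: real
    using zero_le_power2[of "\<bar>t\<bar> - 1"] by (simp add: power2_eq_square algebra_simps)
  then show "AE x in M. norm (u x) \<le> norm (1 + (u x)\<^sup>2)" by auto
qed simp

lemma integrable_bounded_mult:
  fixes f u :: "'a \<Rightarrow> real"
  assumes [measurable]: "f \<in> borel_measurable M" and B: "\<And>x. \<bar>f x\<bar> \<le> B" and u: "integrable M u"
  shows "integrable M (\<lambda>x. f x * u x)"
proof (rule Bochner_Integration.integrable_bound)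
  show "integrable M (\<lambda>x. B * u x)" using u by simp
  show "(\<lambda>x. f x * u x) \<in> borel_measurable M" using u by measurable
  show "AE x in M. norm (f x * u x) \<le> norm (B * u x)"
    using order_trans[OF B abs_ge_self] by (auto simp: abs_mult intro!: AE_I2 mult_right_mono)
qed

lemma midpoint_hull_square:
  assumes "u \<in> midpoint_hull h n"
    and "\<And>n. h n \<in> borel_measurable M" "\<And>n x. 0 \<le> h n x"
    and "\<And>n. integrable M (\<lambda>x. (h n x)\<^sup>2)" "\<And>n. (\<integral>x. (h n x)\<^sup>2 \<partial>M) \<le> K"
  shows "u \<in> borel_measurable M \<and> (\<forall>x. 0 \<le> u x) \<and> integrable M (\<lambda>x. (u x)\<^sup>2) \<and> (\<integral>x. (u x)\<^sup>2 \<partial>M) \<le> K"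
  using assms(1)
proof induction
  case (midpoint u v)
  have le: "((a + b) / 2)\<^sup>2 \<le> (a\<^sup>2 + b\<^sup>2) / 2" for a b :: real
    using zero_le_power2[of "a - b"] by (simp add: power2_eq_square field_simps)
  have i: "integrable M (\<lambda>x. ((u x + v x) / 2)\<^sup>2)"
  proof (rule Bochner_Integration.integrable_bound)
    show "integrable M (\<lambda>x. ((u x)\<^sup>2 + (v x)\<^sup>2) / 2)" using midpoint by simp
    have [measurable]: "u \<in> borel_measurable M" "v \<in> borel_measurable M" using midpoint by auto
    show "(\<lambda>x. ((u x + v x) / 2)\<^sup>2) \<in> borel_measurable M" by measurable
    show "AE x in M. norm (((u x + v x) / 2)\<^sup>2) \<le> norm (((u x)\<^sup>2 + (v x)\<^sup>2) / 2)"
      using le by auto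
  qed
  have "(\<integral>x. ((u x + v x) / 2)\<^sup>2 \<partial>M) \<le> (\<integral>x. ((u x)\<^sup>2 + (v x)\<^sup>2) / 2 \<partial>M)"
    using i midpoint le by (intro integral_mono) auto
  also have "\<dots> = ((\<integral>x. (u x)\<^sup>2 \<partial>M) + (\<integral>x. (v x)\<^sup>2 \<partial>M)) / 2"
    using midpoint by simp
  finally have "(\<integral>x. ((u x + v x) / 2)\<^sup>2 \<partial>M) \<le> K" using midpoint by simp
  with i midpoint show ?case by auto
qed (use assms in auto)

text \<open>By the parallelogram law, elements of almost minimal norm in the midpoint hulls of the tails form a Cauchy sequence,
  which avoids weak compactness of balls in \<open>L\<^sup>2\<close>.\<close>

lemma (in finite_measure) L2_bounded_weak_limit:
  fixes h :: "nat \<Rightarrow> 'a \<Rightarrow> real"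
  assumes meas: "\<And>n. h n \<in> borel_measurable M" and nonneg: "\<And>n x. 0 \<le> h n x"
    and sq: "\<And>n. integrable M (\<lambda>x. (h n x)\<^sup>2)" and K: "\<And>n. (\<integral>x. (h n x)\<^sup>2 \<partial>M) \<le> K"
    and F_meas: "\<And>f. f \<in> F \<Longrightarrow> f \<in> borel_measurable M"
    and F_bdd: "\<And>f. f \<in> F \<Longrightarrow> \<exists>B. \<forall>x. \<bar>f x\<bar> \<le> B"
    and lim: "\<And>f. f \<in> F \<Longrightarrow> (\<lambda>n. \<integral>x. f x * h n x \<partial>M) \<longlonglongrightarrow> L f"
  obtains g where "g \<in> borel_measurable M" "\<And>x. 0 \<le> g x" "integrable M g"
    "\<And>f. f \<in> F \<Longrightarrow> (\<integral>x. f x * g x \<partial>M) = L f"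
proof -
  note hull = midpoint_hull_square[OF _ meas nonneg sq K]
  define E where "E u = (\<integral>x. (u x)\<^sup>2 \<partial>M)" for u :: "'a \<Rightarrow> real"
  \<comment> \<open>The hulls shrink as \<open>n\<close> grows, so these infima increase; they are
    bounded by \<open>K\<close>.\<close>
  define d where "d n = Inf (E ` midpoint_hull h n)" for n
  have E0: "0 \<le> E u" for u by (simp add: E_def)
  have bb: "bdd_below (E ` A)" for A by (rule bdd_belowI[of _ 0]) (use E0 in auto)
  have d_le: "d n \<le> E u" if "u \<in> midpoint_hull h n" for n u
    unfolding d_def using that bb by (intro cInf_lower) auto
  have dK: "d n \<le> K" for n
    using d_le[OF midpoint_hull.tail[of n n]] K[of n] by (simp add: E_def)
  have d_mono: "d m \<le> d n" if "m \<le> n" for m n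
    unfolding d_def
  proof (rule cInf_superset_mono)
    show "E ` midpoint_hull h n \<noteq> {}" using midpoint_hull.tail[of n n h] by blast
    show "E ` midpoint_hull h n \<subseteq> E ` midpoint_hull h m"
      by (intro image_mono subsetI midpoint_hull_antimono[OF that])
  qed (rule bb)
  define D where "D = (SUP n. d n)"
  have bddd: "bdd_above (range d)" using dK by (intro bdd_aboveI[of _ K]) auto
  have dD: "d n \<le> D" for n unfolding D_def by (rule cSUP_upper) (use bddd in auto)
  have "\<exists>n\<ge>j. D - (1/4)^j < d n" for j :: nat
  proof -
    have "D - (1/4)^j < D" by simp
    then obtain n where "D - (1/4)^j < d n" unfolding D_def
      by (subst (asm) less_cSUP_iff) (use bddd D_def in auto)
    then show ?thesis using d_mono[of n "max n j"] by (intro exI[of _ "max n j"]) auto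
  qed
  then obtain N where N: "\<And>j::nat. j \<le> N j" "\<And>j. D - (1/4)^j < d (N j)" by metis
  have "\<exists>u\<in>midpoint_hull h (N j). E u < d (N j) + (1/4)^j" for j :: nat
  proof -
    have "Inf (E ` midpoint_hull h (N j)) < d (N j) + (1/4)^j" by (simp add: d_def)
    then show ?thesis
      by (subst (asm) cInf_less_iff) (use bb midpoint_hull.tail[of "N j" "N j" h] in auto)
  qed
  then obtain u where u: "\<And>j. u j \<in> midpoint_hull h (N j)" "\<And>j. E (u j) < d (N j) + (1/4)^j" by metis
  note uh = hull[OF u(1)]
  have um [measurable]: "u j \<in> borel_measurable M" for j using uh by auto
  have u_nonneg: "0 \<le> u j x" for j x using uh by blast
  have usq: "integrable M (\<lambda>x. (u j x)\<^sup>2)" for j using uh by auto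
  have ui: "integrable M (u j)" for j by (rule integrable_of_square[OF um usq])
  define w where "w j x = u (Suc j) x - u j x" for j x
  have wm [measurable]: "w j \<in> borel_measurable M" for j unfolding w_def by measurable
  have wi: "integrable M (w j)" for j unfolding w_def using ui by auto
  have upar: "((u (Suc j) x + u j x) / 2)\<^sup>2 = ((u (Suc j) x)\<^sup>2 + (u j x)\<^sup>2) / 2 - (w j x)\<^sup>2 / 4" for j x
    by (simp add: w_def power2_eq_square field_simps)
  have wsq: "integrable M (\<lambda>x. (w j x)\<^sup>2)" for j
  proof (rule Bochner_Integration.integrable_bound)
    show "integrable M (\<lambda>x. 2 * ((u (Suc j) x)\<^sup>2 + (u j x)\<^sup>2))" using usq by auto
    have "(a - b)\<^sup>2 \<le> 2 * (a\<^sup>2 + b\<^sup>2)" for a b :: real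
      using zero_le_power2[of "a + b"] by (simp add: power2_eq_square field_simps)
    then show "AE x in M. norm ((w j x)\<^sup>2) \<le> norm (2 * ((u (Suc j) x)\<^sup>2 + (u j x)\<^sup>2))"
      by (auto simp: w_def)
  qed simp
  \<comment> \<open>By the parallelogram law, a quarter of the energy of the difference is the mean
    of the two energies minus the energy of the midpoint, hence at most 2 (1/4)^j. \<open>N\<close>
    need not be monotone, so the midpoint is placed in the hull of the smaller index.\<close>
  have Ew: "E (w j) \<le> 8 * (1/4)^j" for j
  proof -
    let ?n = "min (N (Suc j)) (N j)"
    have "(\<lambda>x. (u (Suc j) x + u j x) / 2) \<in> midpoint_hull h ?n"
      using u(1)[of j] u(1)[of "Suc j"]
      by (intro midpoint_hull.midpoint) (auto intro: midpoint_hull_antimono[rotated])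
    then have "d ?n \<le> E (\<lambda>x. (u (Suc j) x + u j x) / 2)" by (rule d_le)
    also have "\<dots> = (E (u (Suc j)) + E (u j)) / 2 - E (w j) / 4"
      unfolding E_def upar using usq wsq by simp
    finally have 1: "d ?n \<le> (E (u (Suc j)) + E (u j)) / 2 - E (w j) / 4" .
    have "(1/4::real) ^ Suc j \<le> (1/4)^j" by simp
    then have 2: "D - (1/4)^j < d ?n" "E (u (Suc j)) \<le> D + (1/4)^j" "E (u j) \<le> D + (1/4)^j"
      using N(2)[of j] N(2)[of "Suc j"] u(2)[of j] u(2)[of "Suc j"] dD[of "N j"] dD[of "N (Suc j)"]
      by (auto simp: min_def)
    then show ?thesis using 1 by argo
  qed
  \<comment> \<open>The arithmetic-geometric inequality with weight 2^j converts the L2 bound of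
    order 4^-j for the square into a summable L1 bound of order 2^-j, the measure being
    finite.\<close>
  have w1: "(\<integral>x. norm (w j x) \<partial>M) \<le> (4 + measure M (space M)) * (1/2)^j" for j
  proof -
    have p: "2 ^ j * (1/2::real)^j = 1" by (simp flip: power_mult_distrib)
    have le: "\<bar>t\<bar> \<le> (2^j * t\<^sup>2 + (1/2)^j) / 2" for t :: real
    proof -
      have "0 \<le> 2^j * (\<bar>t\<bar> - (1/2)^j)\<^sup>2" by simp
      also have "\<dots> = 2^j * t\<^sup>2 - 2 * \<bar>t\<bar> * (2^j * (1/2)^j) + (2^j * (1/2)^j) * (1/2)^j"
        by (simp add: power2_diff algebra_simps power2_eq_square)
      finally show ?thesis unfolding p by simp
    qed
    have "(\<integral>x. norm (w j x) \<partial>M) \<le> (\<integral>x. (2^j * (w j x)\<^sup>2 + (1/2)^j) / 2 \<partial>M)"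
      using wi wsq le by (intro integral_mono) auto
    also have "\<dots> = (2^j * E (w j) + measure M (space M) * (1/2)^j) / 2"
      using wsq by (simp add: E_def)
    also have "\<dots> \<le> (2^j * (8 * (1/4)^j) + measure M (space M) * (1/2)^j) / 2"
      using Ew[of j] by (intro divide_right_mono add_mono mult_left_mono) auto
    also have "2^j * (8 * (1/4)^j) = 8 * (1/2::real)^j"
      by (simp flip: power_mult_distrib)
    also have "(8 * (1/2)^j + measure M (space M) * (1/2)^j) / 2 \<le> (4 + measure M (space M)) * (1/2)^j"
      by (simp add: algebra_simps)
    finally show ?thesis .
  qed
  have sw: "summable (\<lambda>j. \<integral>x. norm (w j x) \<partial>M)"
    by (rule summable_comparison_test'[where N = 0 and g = "\<lambda>j. (4 + measure M (space M)) * (1/2)^j"])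
      (use w1 in \<open>auto intro!: summable_mult summable_geometric\<close>)
  have AEs: "AE x in M. summable (\<lambda>j. norm (w j x))"
  proof -
    have "(\<integral>\<^sup>+x. (\<Sum>j. ennreal (norm (w j x))) \<partial>M) = (\<Sum>j. \<integral>\<^sup>+x. ennreal (norm (w j x)) \<partial>M)"
      by (intro nn_integral_suminf) auto
    also have "\<dots> = (\<Sum>j. ennreal (\<integral>x. norm (w j x) \<partial>M))"
      using wi by (intro suminf_cong nn_integral_eq_integral) auto
    also have "\<dots> \<noteq> \<infinity>" by (subst suminf_ennreal2) (use sw in auto)
    finally have "AE x in M. (\<Sum>j. ennreal (norm (w j x))) \<noteq> \<infinity>"
      by (intro nn_integral_PInf_AE) auto
    then show ?thesis
      by eventually_elim (auto intro!: summable_suminf_not_top)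
  qed
  define g0 where "g0 x = u 0 x + (\<Sum>j. w j x)" for x
  have g0m [measurable]: "g0 \<in> borel_measurable M" unfolding g0_def by measurable
  have usum: "u n x = u 0 x + (\<Sum>j<n. w j x)" for n x
    by (induction n) (auto simp: w_def)
  have g0i: "integrable M g0"
    unfolding g0_def by (intro Bochner_Integration.integrable_add integrable_suminf ui wi AEs sw)
  have AEg: "AE x in M. 0 \<le> g0 x"
    using AEs
  proof eventually_elim
    case (elim x)
    then have "summable (\<lambda>j. w j x)" by (rule summable_norm_cancel)
    then have "(\<lambda>n. u 0 x + (\<Sum>j<n. w j x)) \<longlonglongrightarrow> g0 x"
      unfolding g0_def by (intro tendsto_intros summable_LIMSEQ)
    then show ?case
      unfolding usum[symmetric] by (rule LIMSEQ_le_const) (simp add: u_nonneg)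
  qed
  \<comment> \<open>Hulls of late tails inherit the limit: being within e/2 of \<open>L f\<close>
    when integrated against \<open>f\<close> is stable under midpoints.\<close>
  have lim_u: "(\<lambda>n. \<integral>x. f x * u n x \<partial>M) \<longlonglongrightarrow> L f" if f: "f \<in> F" for f
  proof (rule LIMSEQ_I)
    fix e :: real assume e: "e > 0"
    from F_bdd[OF f] obtain B where B: "\<And>x. \<bar>f x\<bar> \<le> B" by auto
    note [measurable] = F_meas[OF f]
    from e have "0 < e/2" by simp
    from LIMSEQ_D[OF lim[OF f] this] obtain n0 where n0:
      "\<And>n. n \<ge> n0 \<Longrightarrow> \<bar>(\<integral>x. f x * h n x \<partial>M) - L f\<bar> < e/2" unfolding real_norm_def by blast
    have *: "\<bar>(\<integral>x. f x * v x \<partial>M) - L f\<bar> \<le> e/2" if "v \<in> midpoint_hull h n0" for v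
      using that
    proof induction
      case (midpoint v v')
      have "integrable M (\<lambda>x. f x * v x)" if "v \<in> midpoint_hull h n0" for v
        by (rule integrable_bounded_mult[OF F_meas[OF f] B])
          (rule integrable_of_square; use hull[OF that] in blast)
      with midpoint have eq: "(\<integral>x. f x * ((v x + v' x) / 2) \<partial>M)
          = ((\<integral>x. f x * v x \<partial>M) + (\<integral>x. f x * v' x \<partial>M)) / 2"
        by (simp add: distrib_left add_divide_distrib)
      have "\<bar>(a + b) / 2 - c\<bar> \<le> r" if "\<bar>a - c\<bar> \<le> r" "\<bar>b - c\<bar> \<le> r" for a b c r :: real
        using that unfolding abs_le_iff by argo
      from this[OF midpoint.IH] show ?case unfolding eq .
    next
      case (tail m)
      from n0[OF this] show ?case by (rule less_imp_le)
    qed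
    show "\<exists>no. \<forall>n\<ge>no. norm ((\<integral>x. f x * u n x \<partial>M) - L f) < e"
    proof (intro exI[of _ n0] allI impI)
      fix n assume "n \<ge> n0"
      then have "u n \<in> midpoint_hull h n0" using u(1)[of n] N(1)[of n] midpoint_hull_antimono[of n0 "N n"] by auto
      from *[OF this] e show "norm ((\<integral>x. f x * u n x \<partial>M) - L f) < e" by auto
    qed
  qed
  show ?thesis
  \<comment> \<open>The truncation changes \<open>g0\<close> only on a null set and makes the
    density nonnegative everywhere.\<close>
  proof (rule that[of "\<lambda>x. max 0 (g0 x)"])
    show "integrable M (\<lambda>x. max 0 (g0 x))"
      by (rule Bochner_Integration.integrable_bound[OF g0i]) auto
    fix f assume f: "f \<in> F"
    from F_bdd[OF f] obtain B where B: "\<And>x. \<bar>f x\<bar> \<le> B" by auto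
    note [measurable] = F_meas[OF f]
    have im: "integrable M (\<lambda>x. f x * v x)" if "integrable M v" for v
      by (rule integrable_bounded_mult[OF F_meas[OF f] B that])
    have B0: "0 \<le> B" using B[of undefined] by (meson abs_ge_zero order_trans)
    have le: "(\<integral>x. norm (f x * w j x) \<partial>M) \<le> B * (\<integral>x. norm (w j x) \<partial>M)" for j
    proof -
      have "(\<integral>x. norm (f x * w j x) \<partial>M) \<le> (\<integral>x. B * norm (w j x) \<partial>M)"
        using wi integrable_norm[OF im[OF wi]] B by (intro integral_mono) (auto simp: abs_mult intro!: mult_right_mono)
      then show ?thesis using wi by simp
    qed
    have s1: "summable (\<lambda>j. \<integral>x. norm (f x * w j x) \<partial>M)"
      using le by (intro summable_comparison_test'[where N = 0, OF summable_mult[OF sw, of B]]) simp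
    have s2: "AE x in M. summable (\<lambda>j. norm (f x * w j x))"
      using AEs by eventually_elim (auto simp: abs_mult intro!: summable_mult)
    have "(\<integral>x. f x * max 0 (g0 x) \<partial>M) = (\<integral>x. f x * g0 x \<partial>M)"
      using AEg by (intro integral_cong_AE) auto
    also have "\<dots> = (\<integral>x. f x * u 0 x + (\<Sum>j. f x * w j x) \<partial>M)"
    proof (intro integral_cong_AE)
      show "AE x in M. f x * g0 x = f x * u 0 x + (\<Sum>j. f x * w j x)"
        using AEs
      proof eventually_elim
        case (elim x)
        then have "summable (\<lambda>j. w j x)" by (rule summable_norm_cancel)
        then show ?case by (simp add: g0_def distrib_left suminf_mult)
      qed
    qed auto
    also have "\<dots> = (\<integral>x. f x * u 0 x \<partial>M) + (\<integral>x. (\<Sum>j. f x * w j x) \<partial>M)"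
      by (intro Bochner_Integration.integral_add integrable_suminf im[OF ui] im[OF wi] s1 s2)
    also have "(\<integral>x. (\<Sum>j. f x * w j x) \<partial>M) = (\<Sum>j. \<integral>x. f x * w j x \<partial>M)"
      by (intro integral_suminf im[OF wi] s1 s2)
    finally have eq: "(\<integral>x. f x * max 0 (g0 x) \<partial>M) = (\<integral>x. f x * u 0 x \<partial>M) + (\<Sum>j. \<integral>x. f x * w j x \<partial>M)" .
    have "summable (\<lambda>j. \<integral>x. f x * w j x \<partial>M)"
      by (rule summable_comparison_test'[where N = 0, OF s1]) (rule integral_norm_bound)
    then have A: "(\<lambda>n. (\<integral>x. f x * u 0 x \<partial>M) + (\<Sum>j<n. \<integral>x. f x * w j x \<partial>M)) \<longlonglongrightarrow> (\<integral>x. f x * max 0 (g0 x) \<partial>M)"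
      unfolding eq by (intro tendsto_add tendsto_const summable_LIMSEQ)
    have B: "(\<integral>x. f x * u n x \<partial>M) = (\<integral>x. f x * u 0 x \<partial>M) + (\<Sum>j<n. \<integral>x. f x * w j x \<partial>M)" for n
    proof -
      have "(\<integral>x. f x * u n x \<partial>M) = (\<integral>x. f x * u 0 x + (\<Sum>j<n. f x * w j x) \<partial>M)"
        by (subst usum[of n]) (simp add: distrib_left sum_distrib_left)
      then show ?thesis using im[OF wi] im[OF ui] by simp
    qed
    show "(\<integral>x. f x * max 0 (g0 x) \<partial>M) = L f"
      by (rule LIMSEQ_unique[OF A lim_u[OF f, THEN tendsto_cong[THEN iffD1, rotated], OF always_eventually, OF allI, OF B]])
  qed auto
qed

section \<open>Measures determined by bounded continuous functions\<close>

lemma closed_indicator_approx: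
  fixes C :: "'a :: metric_space set"
  assumes C: "closed C" "C \<noteq> {}"
  shows "(\<lambda>n. max 0 (1 - real n * infdist x C)) \<longlonglongrightarrow> indicator C x"
proof (cases "x \<in> C")
  case x: False
  then have pos: "infdist x C > 0"
    using C by (simp add: infdist_nonneg less_le in_closed_iff_infdist_zero)
  have "eventually (\<lambda>n. max 0 (1 - real n * infdist x C) = 0) sequentially"
    using eventually_ge_at_top[of "nat \<lceil>1 / infdist x C\<rceil>"]
  proof eventually_elim
    case (elim n)
    then have "1 / infdist x C \<le> real n" by linarith
    then show ?case using pos by (simp add: field_simps)
  qed
  then show ?thesis using x by (simp add: tendsto_eventually)
qed simp

lemma measure_closed_LIMSEQ:
  fixes M :: "'a :: metric_space measure"
  assumes M: "finite_measure M" and C: "closed C" "C \<noteq> {}" and sets: "sets M = sets borel"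
  shows "(\<lambda>n. \<integral>x. max 0 (1 - real n * infdist x C) \<partial>M) \<longlonglongrightarrow> measure M C"
proof -
  interpret finite_measure M by (rule M)
  have meas: "(\<lambda>x. max 0 (1 - real n * infdist x C)) \<in> borel_measurable M" for n
    unfolding measurable_cong_sets[OF sets refl]
    by (intro borel_measurable_continuous_onI continuous_intros)
  have C': "C \<in> sets M" using C sets by simp
  have "(\<lambda>n. \<integral>x. max 0 (1 - real n * infdist x C) \<partial>M) \<longlonglongrightarrow> (\<integral>x. indicator C x \<partial>M)"
    using meas C' closed_indicator_approx[OF C]
    by (intro integral_dominated_convergence[where w = "\<lambda>_. 1"]) (auto simp: infdist_nonneg)
  also have "(\<integral>x. indicator C x \<partial>M) = measure M C"
    using sets.sets_into_space[OF C'] by (simp add: inf.absorb1)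
  finally show ?thesis .
qed

text \<open>Indicators of closed sets are bounded limits of continuous functions, and closed sets
  form an intersection-stable generator. This supplies uniqueness, as absolute continuity is claimed
  for every measure satisfying \<open>is_SRB\<close>.\<close>

lemma finite_borel_measure_eqI:
  fixes M N :: "'a :: metric_space measure"
  assumes M: "finite_measure M" and N: "finite_measure N"
    and sets: "sets M = sets borel" "sets N = sets borel"
    and eq: "\<And>f :: 'a \<Rightarrow> real. continuous_on UNIV f \<Longrightarrow> bounded (range f) \<Longrightarrow> integral\<^sup>L M f = integral\<^sup>L N f"
  shows "M = N"
proof -
  have cl: "measure M C = measure N C" if C: "closed C" for C
  proof (cases "C = {}")
    case True
    show ?thesis unfolding True by simp
  next
    case False
    have "(\<integral>x. max 0 (1 - real n * infdist x C) \<partial>M) = (\<integral>x. max 0 (1 - real n * infdist x C) \<partial>N)" for n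
      by (rule eq) (auto intro!: continuous_intros boundedI[where B = 1] simp: infdist_nonneg)
    with measure_closed_LIMSEQ[OF M C False sets(1)] show ?thesis
      by (intro LIMSEQ_unique[OF _ measure_closed_LIMSEQ[OF N C False sets(2)]]) simp
  qed
  show ?thesis
  proof (rule measure_eqI_generator_eq[where E = "Collect closed" and \<Omega> = UNIV and A = "\<lambda>_. UNIV"])
    show "Int_stable (Collect closed)" by (auto simp: Int_stable_def)
    show "sets M = sigma_sets UNIV (Collect closed)" "sets N = sigma_sets UNIV (Collect closed)"
      unfolding sets by (simp_all add: borel_eq_closed)
    show "emeasure M X = emeasure N X" if "X \<in> Collect closed" for X
      using cl[of X] that by (simp add: finite_measure.emeasure_eq_measure[OF M] finite_measure.emeasure_eq_measure[OF N])
    show "range (\<lambda>_. UNIV) \<subseteq> Collect closed" by blast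
    show "emeasure M UNIV \<noteq> \<infinity>" for i :: nat using finite_measure.emeasure_finite[OF M] by simp
  qed auto
qed

section \<open>The transfer operator of the beta-map\<close>

text \<open>Kept as a density on the whole line so that test functions are total on the reals; the
  restriction to [0, 1) re-enters through \<open>AE_U01\<close> and
  \<open>integral_U01_cong\<close>.\<close>

definition U01 :: "real measure" where
  "U01 = density lborel (\<lambda>x. ennreal (indicator {0..<1} x))"

lemma sets_U01 [simp, measurable_cong]: "sets U01 = sets borel"
  by (simp add: U01_def)

lemma space_U01 [simp]: "space U01 = UNIV"
  by (simp add: U01_def)

lemma emeasure_U01: "emeasure U01 UNIV = 1"
  by (simp add: U01_def emeasure_density ennreal_indicator)

lemma finite_measure_U01: "finite_measure U01"
  by (rule finite_measureI) (simp add: emeasure_U01)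

lemma measure_U01 [simp]: "measure U01 UNIV = 1"
  by (simp add: measure_def emeasure_U01)

lemma integral_U01:
  fixes f :: "real \<Rightarrow> real"
  assumes [measurable]: "f \<in> borel_measurable borel"
  shows "integral\<^sup>L U01 f = (\<integral>x. indicator {0..<1} x * f x \<partial>lborel)"
  unfolding U01_def by (subst integral_density) auto

lemma AE_U01: "AE x in U01. 0 \<le> x \<and> x < 1"
  unfolding U01_def by (subst AE_density) (auto simp: indicator_def)

lemma integral_U01_cong:
  fixes f g :: "real \<Rightarrow> real"
  assumes [measurable]: "f \<in> borel_measurable borel" "g \<in> borel_measurable borel"
    and "\<And>x. 0 \<le> x \<Longrightarrow> x < 1 \<Longrightarrow> f x = g x"
  shows "integral\<^sup>L U01 f = integral\<^sup>L U01 g"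
proof (rule integral_cong_AE)
  show "AE x in U01. f x = g x"
    using AE_U01 by (rule eventually_mono) (use assms(3) in blast)
qed simp_all

lemma integrable_U01:
  fixes f :: "real \<Rightarrow> real"
  assumes "f \<in> borel_measurable borel" "\<And>x. \<bar>f x\<bar> \<le> B"
  shows "integrable U01 f"
proof -
  interpret finite_measure U01 by (rule finite_measure_U01)
  show ?thesis by (rule integrable_const_bound[of _ B]) (use assms in auto)
qed

lemma integral_U01_bound:
  fixes f :: "real \<Rightarrow> real"
  assumes "f \<in> borel_measurable borel" "\<And>x. \<bar>f x\<bar> \<le> B"
  shows "\<bar>integral\<^sup>L U01 f\<bar> \<le> B"
proof -
  interpret finite_measure U01 by (rule finite_measure_U01)
  have "\<bar>integral\<^sup>L U01 f\<bar> \<le> (\<integral>x. \<bar>f x\<bar> \<partial>U01)"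
    using integral_norm_bound[of U01 f] by simp
  also have "\<dots> \<le> (\<integral>x. B \<partial>U01)"
    using integrable_U01[OF assms] assms(2) by (intro integral_mono integrable_abs) auto
  finally show ?thesis by simp
qed

text \<open>Substitution of u = b x on [0, 1/b) and u = b x - 1 on [1/b, 1); the right-hand
  integrand is the transfer operator applied to \<open>g\<close>. The test
  \<open>(u + 1) / b < 1\<close> appears because the second branch is not onto [0, 1) when b <
  2.\<close>

lemma integral_U01_branches:
  fixes g :: "real \<Rightarrow> real"
  assumes b: "1 < b" "b < 2" and [measurable]: "g \<in> borel_measurable borel" and B: "\<And>x. \<bar>g x\<bar> \<le> B"
  shows "integral\<^sup>L U01 g
    = (\<integral>u. (g (u / b) + (if (u + 1) / b < 1 then g ((u + 1) / b) else 0)) / b \<partial>U01)"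
proof -
  have int: "integrable lborel (\<lambda>x. indicator {l..<r} x * g x)" if "0 \<le> l" "r \<le> 1" for l r
  proof (rule Bochner_Integration.integrable_bound)
    show "integrable lborel (\<lambda>x. B * indicator {0..<1::real} x)" by simp
    have "0 \<le> B" using B[of 0] by linarith
    then show "AE x in lborel. norm (indicator {l..<r} x * g x) \<le> norm (B * indicator {0..<1} x)"
      using that B by (auto simp: indicator_def abs_mult)
  qed simp
  have b': "0 < 1 / b" "1 / b < 1" using b by auto
  have split: "indicator {0..<1} x = indicator {0..<c} x + (indicator {c..<1} x :: real)"
    if "0 < c" "c < 1" for c x :: real
    using that by (auto simp: indicator_def)
  have "integral\<^sup>L U01 g = (\<integral>x. indicator {0..<1/b} x * g x + indicator {1/b..<1} x * g x \<partial>lborel)"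
    unfolding integral_U01[OF assms(3)] split[OF b'] distrib_right ..
  also have "\<dots> = (\<integral>x. indicator {0..<1/b} x * g x \<partial>lborel) + (\<integral>x. indicator {1/b..<1} x * g x \<partial>lborel)"
    using b by (intro Bochner_Integration.integral_add int) auto
  also have "(\<integral>x. indicator {0..<1/b} x * g x \<partial>lborel)
      = (1 / b) * (\<integral>u. indicator {0..<1/b} (0 + 1 / b * u) * g (0 + 1 / b * u) \<partial>lborel)"
    using b by (subst lborel_integral_real_affine[where c = "1 / b" and t = 0]) auto
  also have "(\<integral>u. indicator {0..<1/b} (0 + 1 / b * u) * g (0 + 1 / b * u) \<partial>lborel)
      = integral\<^sup>L U01 (\<lambda>u. g (u / b))"
    using b by (subst integral_U01) (auto intro!: Bochner_Integration.integral_cong simp: indicator_def field_simps)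
  also have "(\<integral>x. indicator {1/b..<1} x * g x \<partial>lborel)
      = (1 / b) * (\<integral>u. indicator {1/b..<1} (1 / b + 1 / b * u) * g (1 / b + 1 / b * u) \<partial>lborel)"
    using b by (subst lborel_integral_real_affine[where c = "1 / b" and t = "1 / b"]) auto
  also have "(\<integral>u. indicator {1/b..<1} (1 / b + 1 / b * u) * g (1 / b + 1 / b * u) \<partial>lborel)
      = integral\<^sup>L U01 (\<lambda>u. if (u + 1) / b < 1 then g ((u + 1) / b) else 0)"
    using b by (subst integral_U01)
      (auto intro!: Bochner_Integration.integral_cong simp: indicator_def field_simps)
  also have "(1 / b) * integral\<^sup>L U01 (\<lambda>u. g (u / b))
      + (1 / b) * integral\<^sup>L U01 (\<lambda>u. if (u + 1) / b < 1 then g ((u + 1) / b) else 0)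
    = (\<integral>u. (g (u / b) + (if (u + 1) / b < 1 then g ((u + 1) / b) else 0)) / b \<partial>U01)"
  proof -
    have B0: "0 \<le> B" using B[of 0] by linarith
    have "integrable U01 (\<lambda>u. g (u / b))" "integrable U01 (\<lambda>u. if (u + 1) / b < 1 then g ((u + 1) / b) else 0)"
      using B B0 by (intro integrable_U01[of _ B]; simp)+
    then show ?thesis by (simp add: add_divide_distrib)
  qed
  finally show ?thesis .
qed

lemma Tmap_measurable [measurable]: "Tmap b l \<in> borel \<rightarrow>\<^sub>M borel"
  unfolding Tmap_def borel_prod[symmetric] by measurable

lemma Tmap_funpow_measurable [measurable]: "Tmap b l ^^ n \<in> borel \<rightarrow>\<^sub>M borel"
proof (induction n)
  case (Suc n)
  note [measurable] = Suc
  show ?case unfolding funpow.simps comp_def by measurable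
qed (simp add: id_def)

lemma section_measurable [measurable]:
  fixes F :: "real \<times> real \<Rightarrow> real"
  assumes [measurable]: "F \<in> borel_measurable borel"
  shows "(\<lambda>y. F (c, y)) \<in> borel_measurable borel"
  by measurable

lemma card_words: "card (words n) = 2 ^ n"
  unfolding words_def by (subst card_lists_length_eq) (auto simp: numeral_2_eq_2)

lemma branch_weight_le_1: "1 < b \<Longrightarrow> branch_weight b w y \<le> 1"
  using branch_weight_le[of b w y] power_le_one[of "1 / b" "length w"] by simp

lemma sum_branch_weight_bound:
  assumes b: "1 < b" and G: "\<And>w. \<bar>G w\<bar> \<le> B"
  shows "\<bar>\<Sum>w\<in>words n. branch_weight b w y * G w\<bar> \<le> 2 ^ n * B"
proof -
  have "\<bar>\<Sum>w\<in>words n. branch_weight b w y * G w\<bar> \<le> (\<Sum>w\<in>words n. \<bar>branch_weight b w y * G w\<bar>)" by (rule sum_abs)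
  also have "\<dots> \<le> (\<Sum>w\<in>words n. B)"
  proof (intro sum_mono)
    fix w
    have "\<bar>branch_weight b w y * G w\<bar> = branch_weight b w y * \<bar>G w\<bar>" using b branch_weight_nonneg[of b w y] by (simp add: abs_mult)
    also have "\<dots> \<le> 1 * B" using b branch_weight_nonneg[of b w y] branch_weight_le_1[of b w y] G by (intro mult_mono) auto
    finally show "\<bar>branch_weight b w y * G w\<bar> \<le> B" by simp
  qed
  finally show ?thesis by (simp add: card_words)
qed

lemma sum_words_branch_weight_Suc:
  assumes "b > 0"
  shows "(\<Sum>w\<in>words (Suc n). branch_weight b w y * G w (branch_point b w y))
    = ((if y / b < 1 then \<Sum>w\<in>words n. branch_weight b w (y / b) * G (0 # w) (branch_point b w (y / b)) else 0)
       + (if (y + 1) / b < 1 then \<Sum>w\<in>words n. branch_weight b w ((y + 1) / b) * G (1 # w) (branch_point b w ((y + 1) / b)) else 0)) / b"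
  unfolding sum_words_Suc by (auto simp: sum_divide_distrib add_divide_distrib)

text \<open>Iterated substitution exchanges the initial height z for the final height y and the word
  of past digits, which also determines the contracting coordinate. The last step of the orbit
  matches the head of the word. The factor \<open>h\<close> is free, so both Lebesgue measure and
  the invariant density can serve as initial law.\<close>

lemma integral_Tmap_funpow:
  fixes F :: "real \<times> real \<Rightarrow> real"
  assumes b: "1 < b" "b < 2"
    and F: "F \<in> borel_measurable borel" "\<And>p. \<bar>F p\<bar> \<le> B"
    and [measurable]: "h \<in> borel_measurable borel" and h: "\<And>y. \<bar>h y\<bar> \<le> H"
  shows "(\<integral>z. h z * F ((Tmap b l ^^ n) (x, z)) \<partial>U01)
    = (\<integral>y. (\<Sum>w\<in>words n. branch_weight b w y * (h (branch_point b w y) * F (l ^ n * x + (1 - l) * digit_sum l w, y))) \<partial>U01)"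
  using F
proof (induction n arbitrary: F)
  case (Suc n)
  note [measurable] = Suc.prems(1)
  have B: "\<bar>F (Tmap b l p)\<bar> \<le> B" for p using Suc.prems(2) .
  have [measurable]: "(\<lambda>p. F (Tmap b l p)) \<in> borel_measurable borel" by measurable
  have [measurable]: "(\<lambda>p. F (Tmap b l (c, p))) \<in> borel_measurable borel" for c
    by (rule section_measurable) measurable
  let ?g = "\<lambda>y. \<Sum>w\<in>words n. branch_weight b w y * (h (branch_point b w y) * F (Tmap b l (l ^ n * x + (1 - l) * digit_sum l w, y)))"
  have HB: "\<bar>h y * F p\<bar> \<le> H * B" for y p
    using h[of y] Suc.prems(2)[of p] by (auto simp: abs_mult intro!: mult_mono order_trans[OF abs_ge_zero h])
  have "(\<integral>z. h z * F ((Tmap b l ^^ Suc n) (x, z)) \<partial>U01) = integral\<^sup>L U01 ?g"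
    using Suc.IH[of "\<lambda>p. F (Tmap b l p)"] B by simp
  also have "\<dots> = (\<integral>u. (?g (u / b) + (if (u + 1) / b < 1 then ?g ((u + 1) / b) else 0)) / b \<partial>U01)"
    using b HB by (intro integral_U01_branches[of _ _ "2 ^ n * (H * B)"] sum_branch_weight_bound) auto
  also have "\<dots> = (\<integral>y. (\<Sum>w\<in>words (Suc n). branch_weight b w y * (h (branch_point b w y) * F (l ^ Suc n * x + (1 - l) * digit_sum l w, y))) \<partial>U01)"
  proof (rule integral_U01_cong)
    fix y :: real assume y: "0 \<le> y" "y < 1"
    have "y / b < 1 / b" using y b by (intro divide_strict_right_mono) auto
    moreover have "y / b < 1" using y b by auto
    moreover have "\<not> (y + 1) / b < 1 / b" using y b by (auto simp: divide_less_cancel)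
    moreover have "(b + b * y) / b = 1 + y" using b by (simp add: field_simps)
    ultimately show "(?g (y / b) + (if (y + 1) / b < 1 then ?g ((y + 1) / b) else 0)) / b
      = (\<Sum>w\<in>words (Suc n). branch_weight b w y * (h (branch_point b w y) * F (l ^ Suc n * x + (1 - l) * digit_sum l w, y)))"
      using b
      by (subst sum_words_branch_weight_Suc[where b = b and n = n and y = y and G = "\<lambda>w z. h z * F (l ^ Suc n * x + (1 - l) * digit_sum l w, y)"])
        (auto simp: Tmap_def algebra_simps)
  qed measurable
  finally show ?case .
qed simp

section \<open>Step functions along the orbit of 1 and the renewal equation\<close>

definition beta_map :: "real \<Rightarrow> real \<Rightarrow> real" where
  "beta_map b y = (if y < 1 / b then b * y else b * y - 1)"

lemma beta_map_measurable [measurable]: "beta_map b \<in> borel_measurable borel"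
  unfolding beta_map_def by measurable

lemma beta_map_funpow_measurable [measurable]: "beta_map b ^^ n \<in> borel_measurable borel"
proof (induction n)
  case (Suc n)
  note [measurable] = Suc
  show ?case unfolding funpow.simps comp_def by measurable
qed (simp add: id_def)

lemma snd_Tmap_funpow: "snd ((Tmap b l ^^ n) p) = (beta_map b ^^ n) (snd p)"
  by (induction n) (auto simp: Tmap_def beta_map_def split: prod.splits)

lemma beta_map_bounds: "1 < b \<Longrightarrow> b < 2 \<Longrightarrow> 0 \<le> y \<Longrightarrow> y \<le> 1 \<Longrightarrow> 0 \<le> beta_map b y \<and> beta_map b y \<le> 1"
proof -
  assume b: "1 < b" "b < 2" and y: "0 \<le> y" "y \<le> 1"
  have "b * y \<le> b * 1" using b y by (intro mult_left_mono) auto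
  then have "b * y < 2" using b by linarith
  moreover have "y < 1 / b \<longleftrightarrow> b * y < 1" using b by (simp add: field_simps)
  moreover have "0 \<le> b * y" using b y by simp
  ultimately show ?thesis using b y unfolding beta_map_def by (cases "b * y < 1") auto
qed

lemma beta_map_bounds_less: "1 < b \<Longrightarrow> b < 2 \<Longrightarrow> 0 \<le> y \<Longrightarrow> y < 1 \<Longrightarrow> 0 \<le> beta_map b y \<and> beta_map b y < 1"
proof -
  assume b: "1 < b" "b < 2" and y: "0 \<le> y" "y < 1"
  have "b * y \<le> b * 1" using b y by (intro mult_left_mono) auto
  then have "b * y < 2" using b by linarith
  moreover have "y < 1 / b \<longleftrightarrow> b * y < 1" using b by (simp add: field_simps)
  moreover have "0 \<le> b * y" using b y by simp
  ultimately show ?thesis using b y unfolding beta_map_def by (cases "b * y < 1") auto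
qed

definition orbit_one :: "real \<Rightarrow> nat \<Rightarrow> real" where "orbit_one b k = (beta_map b ^^ k) 1"

lemma orbit_one_bounds: "1 < b \<Longrightarrow> b < 2 \<Longrightarrow> 0 \<le> orbit_one b k \<and> orbit_one b k \<le> 1"
  by (induction k) (auto simp: orbit_one_def beta_map_bounds)

lemma orbit_one_Suc: "orbit_one b (Suc k) = beta_map b (orbit_one b k)"
  by (simp add: orbit_one_def)

lemma orbit_one_0 [simp]: "orbit_one b 0 = 1"
  by (simp add: orbit_one_def)

text \<open>The coefficient of the constant function 1 in the \<open>n\<close>-th iterate of the transfer operator applied to 1.\<close>

fun renewal :: "real \<Rightarrow> nat \<Rightarrow> real" where
  "renewal b 0 = 1"
| "renewal b (Suc n) = (\<Sum>k\<le>n. (1 / b) ^ Suc k * (if orbit_one b k < 1 / b then 0 else 1) * renewal b (n - k))"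

lemma renewal_nonneg: "b > 0 \<Longrightarrow> 0 \<le> renewal b n"
  by (induction n rule: less_induct) (case_tac x, auto intro!: sum_nonneg)

text \<open>The transfer operator sends the indicator of [0, t) to 1/b times the indicator of [0,
  \<open>beta_map b t\<close>), plus the constant 1/b when t \<ge> 1/b, because then the first
  branch is covered completely. In the sum, \<open>k\<close> is the age of a copy of the constant 1
  created at time n - k.\<close>

lemma sum_branch_weight_eq:
  assumes b: "1 < b" "b < 2" and "0 \<le> y" "y < 1"
  shows "(\<Sum>w\<in>words n. branch_weight b w y) = (\<Sum>k\<le>n. (1 / b) ^ k * renewal b (n - k) * (if y < orbit_one b k then 1 else 0))"
  using assms(3-)
proof (induction n arbitrary: y)
  case (Suc n)
  let ?N = "\<lambda>y. \<Sum>w\<in>words n. branch_weight b w y"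
  let ?I = "\<lambda>y t. (if y < t then 1 else 0 :: real)"
  have N: "(if (y + d) / b < 1 then ?N ((y + d) / b) else 0)
     = (\<Sum>k\<le>n. (1 / b) ^ k * renewal b (n - k) * ?I ((y + d) / b) (orbit_one b k))" if "d \<ge> 0" for d
  proof (cases "(y + d) / b < 1")
    case True
    then show ?thesis using Suc.IH[of "(y + d) / b"] Suc.prems that b by simp
  next
    case False
    then have "\<not> (y + d) / b < orbit_one b k" for k using orbit_one_bounds[OF b, of k] by linarith
    with False show ?thesis by simp
  qed
  have I: "?I ((y + 0) / b) t + ?I ((y + 1) / b) t = (if t < 1 / b then 0 else 1) + ?I y (beta_map b t)"
    if "0 \<le> t" "t \<le> 1" for t
    using b Suc.prems that by (auto simp: beta_map_def field_simps)
  have "(\<Sum>w\<in>words (Suc n). branch_weight b w y) = ((if (y + 0) / b < 1 then ?N ((y + 0) / b) else 0)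
      + (if (y + 1) / b < 1 then ?N ((y + 1) / b) else 0)) / b"
    using sum_words_branch_weight_Suc[where b = b and n = n and y = y and G = "\<lambda>_ _. 1"] b by simp
  also have "\<dots> = (\<Sum>k\<le>n. (1 / b) ^ k * renewal b (n - k) * (?I ((y + 0) / b) (orbit_one b k) + ?I ((y + 1) / b) (orbit_one b k))) / b"
    by (subst N, simp, subst N, simp) (simp add: distrib_left sum.distrib)
  also have "\<dots> = (\<Sum>k\<le>n. (1 / b) ^ k * renewal b (n - k) * ((if orbit_one b k < 1 / b then 0 else 1) + ?I y (orbit_one b (Suc k)))) / b"
    using I orbit_one_bounds[OF b] by (simp add: orbit_one_Suc)
  also have "\<dots> = (\<Sum>k\<le>n. (1 / b) ^ Suc k * (if orbit_one b k < 1 / b then 0 else 1) * renewal b (n - k))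
      + (\<Sum>k\<le>n. (1 / b) ^ Suc k * renewal b (n - k) * ?I y (orbit_one b (Suc k)))"
    by (simp add: distrib_left sum.distrib add_divide_distrib sum_divide_distrib mult_ac)
  \<comment> \<open>The newly created constant is the term k = 0, because y lies below
    \<open>orbit_one b 0\<close>, which is 1.\<close>
  also have "\<dots> = (\<Sum>k\<le>Suc n. (1 / b) ^ k * renewal b (Suc n - k) * ?I y (orbit_one b k))"
    unfolding sum.atMost_Suc_shift using Suc.prems by simp
  finally show ?case .
qed simp

lemma integral_beta_map_funpow:
  assumes b: "1 < b" "b < 2" and [measurable]: "g \<in> borel_measurable borel" and B: "\<And>y. \<bar>g y\<bar> \<le> B"
  shows "(\<integral>z. g ((beta_map b ^^ n) z) \<partial>U01)
    = (\<Sum>k\<le>n. (1 / b) ^ k * renewal b (n - k) * (\<integral>y. g y * (if y < orbit_one b k then 1 else 0) \<partial>U01))"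
proof -
  have [measurable]: "(\<lambda>p :: real \<times> real. g (snd p)) \<in> borel_measurable borel"
    unfolding borel_prod[symmetric] by measurable
  have "(\<integral>z. g ((beta_map b ^^ n) z) \<partial>U01) = (\<integral>z. 1 * g (snd ((Tmap b 0 ^^ n) (0, z))) \<partial>U01)"
    by (simp add: snd_Tmap_funpow)
  also have "\<dots> = (\<integral>y. (\<Sum>w\<in>words n. branch_weight b w y * (1 * g (snd (0 ^ n * 0 + (1 - 0) * digit_sum 0 w, y)))) \<partial>U01)"
    by (rule integral_Tmap_funpow[OF b, of "\<lambda>p. g (snd p)" B "\<lambda>_. 1" 1]) (use B in auto)
  also have "\<dots> = (\<integral>y. (\<Sum>k\<le>n. (1 / b) ^ k * renewal b (n - k) * (g y * (if y < orbit_one b k then 1 else 0))) \<partial>U01)"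
  proof (rule integral_U01_cong)
    fix y :: real assume "0 \<le> y" "y < 1"
    then show "(\<Sum>w\<in>words n. branch_weight b w y * (1 * g (snd (0 ^ n * 0 + (1 - 0) * digit_sum 0 w, y))))
      = (\<Sum>k\<le>n. (1 / b) ^ k * renewal b (n - k) * (g y * (if y < orbit_one b k then 1 else 0)))"
      by (simp add: sum_distrib_right[symmetric] sum_branch_weight_eq[OF b])
        (simp add: sum_distrib_left mult_ac)
  qed measurable
  also have "\<dots> = (\<Sum>k\<le>n. (1 / b) ^ k * renewal b (n - k) * (\<integral>y. g y * (if y < orbit_one b k then 1 else 0) \<partial>U01))"
  proof (subst Bochner_Integration.integral_sum)
    fix k
    have "integrable U01 (\<lambda>y. g y * (if y < orbit_one b k then 1 else 0))"
      using B order_trans[OF abs_ge_zero B] by (intro integrable_U01[of _ B]) auto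
    then show "integrable U01 (\<lambda>y. (1 / b) ^ k * renewal b (n - k) * (g y * (if y < orbit_one b k then 1 else 0)))"
      by (rule integrable_mult_right)
  qed simp
  finally show ?thesis .
qed

lemma integral_indicator_orbit_one:
  assumes "1 < b" "b < 2"
  shows "(\<integral>y. (if y < orbit_one b k then 1 else 0) \<partial>U01) = (orbit_one b k :: real)"
proof -
  have "(\<integral>y. (if y < orbit_one b k then 1 else 0) \<partial>U01)
      = (\<integral>x. indicator {0..<1} x * (if x < orbit_one b k then 1 else 0) \<partial>lborel :: real)"
    by (rule integral_U01) simp
  also have "\<dots> = (\<integral>x. indicator {0..<orbit_one b k} x \<partial>lborel)"
    by (rule Bochner_Integration.integral_cong)
      (use orbit_one_bounds[OF assms, of k] in \<open>auto simp: indicator_def\<close>)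
  finally have "(\<integral>y. (if y < orbit_one b k then 1 else 0) \<partial>U01) = (\<integral>x. indicator {0..<orbit_one b k} x \<partial>lborel :: real)" .
  then show ?thesis using orbit_one_bounds[OF assms, of k] by simp
qed

text \<open>Mass conservation: the left side is the integral of the \<open>n\<close>-th push-forward
  of a probability density. This is the renewal equation that determines the averages of
  \<open>renewal\<close>.\<close>

lemma renewal_eq:
  assumes "1 < b" "b < 2"
  shows "(\<Sum>k\<le>n. (1 / b) ^ k * orbit_one b k * renewal b (n - k)) = 1"
proof -
  have "1 = (\<Sum>k\<le>n. (1 / b) ^ k * renewal b (n - k) * (\<integral>y. 1 * (if y < orbit_one b k then 1 else 0) \<partial>U01))"
    using integral_beta_map_funpow[OF assms, of "\<lambda>_. 1" 1 n] by simp
  then show ?thesis by (simp add: integral_indicator_orbit_one[OF assms] mult_ac)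
qed

lemma renewal_le_1:
  assumes "1 < b" "b < 2"
  shows "renewal b n \<le> 1"
proof -
  have "(\<Sum>k\<in>{0}. (1 / b) ^ k * orbit_one b k * renewal b (n - k)) \<le> (\<Sum>k\<le>n. (1 / b) ^ k * orbit_one b k * renewal b (n - k))"
    using assms orbit_one_bounds[OF assms] renewal_nonneg[of b] by (intro sum_mono2) auto
  then show ?thesis using renewal_eq[OF assms, of n] by simp
qed

text \<open>Although 2^n words are summed, the iterates of the transfer operator on 1 stay below a
  geometric series. This is a source of constants independent of \<open>n\<close> in the energy
  estimates.\<close>

lemma sum_branch_weight_le:
  assumes b: "1 < b" "b < 2" and "0 \<le> y" "y < 1"
  shows "(\<Sum>w\<in>words n. branch_weight b w y) \<le> b / (b - 1)"
proof -
  have "(\<Sum>w\<in>words n. branch_weight b w y) \<le> (\<Sum>k\<le>n. (1 / b) ^ k)"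
    unfolding sum_branch_weight_eq[OF assms]
  proof (intro sum_mono)
    fix k
    have "(1 / b) ^ k * (renewal b (n - k) * (if y < orbit_one b k then 1 else 0)) \<le> (1 / b) ^ k * 1"
      using b renewal_le_1[OF b, of "n - k"] by (intro mult_left_mono) auto
    then show "(1 / b) ^ k * renewal b (n - k) * (if y < orbit_one b k then 1 else 0) \<le> (1 / b) ^ k"
      by (simp add: mult.assoc)
  qed
  also have "\<dots> \<le> (\<Sum>k. (1 / b) ^ k)"
    using b by (intro sum_le_suminf summable_geometric) auto
  also have "\<dots> = b / (b - 1)"
    using b by (subst suminf_geometric) (auto simp: field_simps)
  finally show ?thesis .
qed

section \<open>Cesaro averages\<close>

lemma sum_convolution_shift:
  fixes r c :: "nat \<Rightarrow> real"
  shows "(\<Sum>j<n. \<Sum>k\<le>j. r k * c (j - k)) = (\<Sum>k<n. r k * (\<Sum>j<n - k. c j))"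
proof (induction n)
  case (Suc n)
  have "(\<Sum>k<Suc n. r k * (\<Sum>j<Suc n - k. c j)) = (\<Sum>k<Suc n. r k * (\<Sum>j<n - k. c j) + r k * c (n - k))"
    by (intro sum.cong) (auto simp: Suc_diff_le less_Suc_eq_le distrib_left)
  also have "\<dots> = (\<Sum>k<n. r k * (\<Sum>j<n - k. c j)) + (\<Sum>k\<le>n. r k * c (n - k))"
    by (simp add: sum.distrib lessThan_Suc_atMost[symmetric])
  finally show ?case using Suc by simp
qed simp

text \<open>Replacing the sum of \<open>c\<close> up to n - k by the sum up to n changes it by at
  most k, as \<open>c\<close> lies in [0, 1]. Weighted with q^k, the total error is bounded
  uniformly in n, by \<open>B\<close> times the sum of (k + 1) q^k.\<close>

lemma convolution_sum_approx:
  fixes r c :: "nat \<Rightarrow> real"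
  assumes q: "0 \<le> q" "q < 1" and c: "\<And>k. 0 \<le> c k" "\<And>k. c k \<le> 1"
    and r: "\<And>k. \<bar>r k\<bar> \<le> B * q ^ k"
  shows "\<bar>(\<Sum>j<n. \<Sum>k\<le>j. r k * c (j - k)) - (\<Sum>k<n. r k) * (\<Sum>j<n. c j)\<bar> \<le> B / (1 - q)\<^sup>2"
proof -
  have B: "0 \<le> B" using r[of 0] by auto
  define S where "S n = (\<Sum>j<n. c j)" for n
  have S: "0 \<le> S (m + k) - S m \<and> S (m + k) - S m \<le> real k" for m k
  proof (induction k)
    case (Suc k)
    then show ?case using c(1)[of "m + k"] c(2)[of "m + k"] by (auto simp: S_def)
  qed simp
  have "(\<Sum>j<n. \<Sum>k\<le>j. r k * c (j - k)) - (\<Sum>k<n. r k) * (\<Sum>j<n. c j) = (\<Sum>k<n. r k * (S (n - k) - S n))"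
    unfolding sum_convolution_shift by (simp add: S_def sum_subtractf right_diff_distrib sum_distrib_right)
  also have "\<bar>\<dots>\<bar> \<le> (\<Sum>k<n. \<bar>r k * (S (n - k) - S n)\<bar>)" by (rule sum_abs)
  also have "\<dots> \<le> (\<Sum>k<n. B * (real (Suc k) * q ^ k))"
  proof (intro sum_mono)
    fix k assume "k \<in> {..<n}"
    then have "\<bar>S (n - k) - S n\<bar> \<le> real (Suc k)" using S[of "n - k" k] by auto
    then have "\<bar>r k\<bar> * \<bar>S (n - k) - S n\<bar> \<le> (B * q ^ k) * real (Suc k)"
      using r[of k] B q by (intro mult_mono) auto
    then show "\<bar>r k * (S (n - k) - S n)\<bar> \<le> B * (real (Suc k) * q ^ k)" by (simp add: abs_mult mult_ac)
  qed
  also have "\<dots> = B * (\<Sum>k<n. real (Suc k) * q ^ k)" by (simp add: sum_distrib_left)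
  also have "\<dots> \<le> B * (1 / (1 - q)\<^sup>2)"
  proof (intro mult_left_mono B)
    have s: "(\<lambda>k. real (Suc k) * q ^ k) sums (1 / (1 - q)\<^sup>2)"
      using q by (intro geometric_deriv_sums) auto
    have "(\<Sum>k<n. real (Suc k) * q ^ k) \<le> (\<Sum>k. real (Suc k) * q ^ k)"
      using s q by (intro sum_le_suminf) (auto simp: sums_iff)
    then show "(\<Sum>k<n. real (Suc k) * q ^ k) \<le> 1 / (1 - q)\<^sup>2" using s by (simp add: sums_iff)
  qed
  finally show ?thesis by simp
qed

text \<open>An averaged renewal theorem: with \<open>p\<close> in place of \<open>r\<close> the
  approximation says that n is (sum of p) times (sum of c) up to O(1), so averages of
  \<open>c\<close> tend to 1 / \<open>suminf p\<close>; a general \<open>r\<close> contributes its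
  own sum as a factor. Passing to averages avoids a discussion of zeros of the generating function
  of \<open>p\<close> on the unit circle.\<close>

lemma renewal_cesaro_limit:
  fixes r p c :: "nat \<Rightarrow> real"
  assumes q: "0 \<le> q" "q < 1" and c: "\<And>k. 0 \<le> c k" "\<And>k. c k \<le> 1"
    and p: "\<And>k. 0 \<le> p k" "\<And>k. p k \<le> q ^ k" "p 0 = 1" "\<And>n. (\<Sum>k\<le>n. p k * c (n - k)) = 1"
    and r: "\<And>k. \<bar>r k\<bar> \<le> B * q ^ k"
  shows "(\<lambda>n. 1 / real n * (\<Sum>j<n. \<Sum>k\<le>j. r k * c (j - k))) \<longlonglongrightarrow> suminf r / suminf p"
proof -
  have avg0: "(\<lambda>n. 1 / real n * u n) \<longlonglongrightarrow> 0" if "\<And>n. \<bar>u n\<bar> \<le> K" for u :: "nat \<Rightarrow> real" and K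
  proof (rule tendsto_rabs_zero_cancel, rule tendsto_sandwich[where f = "\<lambda>_. 0" and h = "\<lambda>n. K / real n"])
    show "(\<lambda>n. K / real n) \<longlonglongrightarrow> 0" by (rule lim_const_over_n)
    show "\<forall>\<^sub>F n in sequentially. \<bar>1 / real n * u n\<bar> \<le> K / real n"
      using that by (intro always_eventually) (auto simp: abs_mult divide_right_mono)
  qed auto
  have sp: "summable p"
    by (rule summable_comparison_test'[of "\<lambda>k. q ^ k" 0]) (use q p in \<open>auto intro: summable_geometric\<close>)
  have sr: "summable r"
    by (rule summable_comparison_test'[of "\<lambda>k. B * q ^ k" 0]) (use q r in \<open>auto intro: summable_mult summable_geometric\<close>)
  define S where "S n = (\<Sum>j<n. c j)" for n
  define P where "P n = (\<Sum>k<n. p k)" for n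
  define R where "R n = (\<Sum>k<n. r k)" for n
  have Plim: "P \<longlonglongrightarrow> suminf p" and Rlim: "R \<longlonglongrightarrow> suminf r"
    unfolding P_def R_def using sp sr by (auto intro: summable_LIMSEQ)
  have P1: "1 \<le> P n" if "n > 0" for n
  proof -
    have "(\<Sum>k\<in>{0}. p k) \<le> P n" unfolding P_def using that p by (intro sum_mono2) auto
    then show ?thesis using p by simp
  qed
  have ev: "eventually (\<lambda>n::nat. n > 0) sequentially" by (rule eventually_gt_at_top)
  have "1 \<le> suminf p"
    by (rule tendsto_lowerbound[OF Plim eventually_mono[OF ev P1]]) simp_all
  then have p0: "suminf p \<noteq> 0" by linarith
  have "\<bar>real n - P n * S n\<bar> \<le> 1 / (1 - q)\<^sup>2" for n
    using convolution_sum_approx[of q c p 1 n, OF q c] p by (simp add: P_def S_def abs_of_nonneg)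
  from avg0[of "\<lambda>n. real n - P n * S n", OF this]
  have "(\<lambda>n. 1 - 1 / real n * (real n - P n * S n)) \<longlonglongrightarrow> 1 - 0" by (intro tendsto_intros)
  then have "(\<lambda>n. (1 - 1 / real n * (real n - P n * S n)) / P n) \<longlonglongrightarrow> (1 - 0) / suminf p"
    using Plim p0 by (intro tendsto_divide)
  moreover have "\<forall>\<^sub>F n in sequentially. (1 - 1 / real n * (real n - P n * S n)) / P n = S n / real n"
    using ev
  proof eventually_elim
    case (elim n)
    have "P n \<noteq> 0" using P1[OF elim] by linarith
    with elim show ?case by (simp add: field_simps)
  qed
  ultimately have Slim: "(\<lambda>n. S n / real n) \<longlonglongrightarrow> 1 / suminf p" by (simp add: tendsto_cong)
  have "\<bar>(\<Sum>j<n. \<Sum>k\<le>j. r k * c (j - k)) - R n * S n\<bar> \<le> B / (1 - q)\<^sup>2" for n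
    using convolution_sum_approx[OF q c r, where n = n] by (simp add: R_def S_def)
  from avg0[of "\<lambda>n. (\<Sum>j<n. \<Sum>k\<le>j. r k * c (j - k)) - R n * S n", OF this]
  have "(\<lambda>n. 1 / real n * ((\<Sum>j<n. \<Sum>k\<le>j. r k * c (j - k)) - R n * S n) + R n * (S n / real n))
      \<longlonglongrightarrow> 0 + suminf r * (1 / suminf p)"
    by (intro tendsto_add tendsto_mult Rlim Slim)
  then show ?thesis by (simp add: right_diff_distrib)
qed

text \<open>\<open>h\<close> is the Parry density: the sum of b^-k times the indicator of [0,
  \<open>orbit_one b k\<close>), divided by its integral. The limit is stated for bounded measurable
  \<open>g\<close>, because it is applied to continuous functions composed with iterates of
  \<open>Tmap\<close>, which are discontinuous.\<close>

lemma beta_map_cesaro: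
  assumes b: "1 < b" "b < 2"
  obtains h H where "h \<in> borel_measurable borel" "\<And>y. 0 \<le> h y" "\<And>y. h y \<le> (H :: real)"
    "\<And>g B. g \<in> borel_measurable borel \<Longrightarrow> (\<And>y. \<bar>g y\<bar> \<le> B) \<Longrightarrow>
      (\<lambda>n. 1 / real n * (\<Sum>k<n. \<integral>z. g ((beta_map b ^^ k) z) \<partial>U01)) \<longlonglongrightarrow> (\<integral>y. h y * g y \<partial>U01)"
proof -
  define q where "q = 1 / b"
  have q: "0 \<le> q" "q < 1" using b by (auto simp: q_def)
  define p where "p k = q ^ k * orbit_one b k" for k
  have p: "0 \<le> p k" "p k \<le> q ^ k" for k
    using q orbit_one_bounds[OF b, of k] by (auto simp: p_def mult_left_le)
  have sp: "summable p"
    by (rule summable_comparison_test'[of "\<lambda>k. q ^ k" 0]) (use q p in \<open>auto intro: summable_geometric\<close>)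
  have sp0: "0 \<le> suminf p" using p sp by (intro suminf_nonneg) auto
  let ?I = "\<lambda>y k. if y < orbit_one b k then 1 else (0::real)"
  define h where "h y = (\<Sum>k. q ^ k * ?I y k) / suminf p" for y
  have sI: "summable (\<lambda>k. q ^ k * ?I y k)" for y
    by (rule summable_comparison_test'[of "\<lambda>k. q ^ k" 0]) (use q in \<open>auto intro: summable_geometric\<close>)
  show ?thesis
  proof (rule that[of h "(1 / (1 - q)) / suminf p"])
    show [measurable]: "h \<in> borel_measurable borel" unfolding h_def by measurable
    show "0 \<le> h y" for y unfolding h_def using q by (intro divide_nonneg_nonneg suminf_nonneg sI sp0) auto
    show "h y \<le> (1 / (1 - q)) / suminf p" for y
    proof -
      have "(\<Sum>k. q ^ k * ?I y k) \<le> (\<Sum>k. q ^ k)"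
        using q by (intro suminf_le sI summable_geometric) auto
      also have "\<dots> = 1 / (1 - q)" using q by (intro suminf_geometric) auto
      finally show ?thesis unfolding h_def using sp0 by (intro divide_right_mono)
    qed
    fix g :: "real \<Rightarrow> real" and B assume [measurable]: "g \<in> borel_measurable borel" and B: "\<And>y. \<bar>g y\<bar> \<le> B"
    have B0: "0 \<le> B" using B[of 0] by linarith
    define r where "r k = q ^ k * (\<integral>y. g y * ?I y k \<partial>U01)" for k
    have int: "integrable U01 (\<lambda>y. g y * ?I y k)" for k
      using B B0 by (intro integrable_U01[of _ B]) auto
    have r: "\<bar>r k\<bar> \<le> B * q ^ k" for k
    proof -
      have "\<bar>\<integral>y. g y * ?I y k \<partial>U01\<bar> \<le> B" using B B0 by (intro integral_U01_bound) auto
      then have "q ^ k * \<bar>\<integral>y. g y * ?I y k \<partial>U01\<bar> \<le> q ^ k * B" using q by (intro mult_left_mono) auto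
      then show ?thesis using q by (simp add: r_def abs_mult mult.commute)
    qed
    have "(\<lambda>n. 1 / real n * (\<Sum>j<n. \<Sum>k\<le>j. r k * renewal b (j - k))) \<longlonglongrightarrow> suminf r / suminf p"
    proof (rule renewal_cesaro_limit[OF q _ _ p])
      show "p 0 = 1" by (simp add: p_def)
      show "(\<Sum>k\<le>n. p k * renewal b (n - k)) = 1" for n
        using renewal_eq[OF b, of n] by (simp add: p_def q_def)
    qed (use r renewal_nonneg renewal_le_1 b in auto)
    also have "(\<lambda>n. 1 / real n * (\<Sum>j<n. \<Sum>k\<le>j. r k * renewal b (j - k)))
        = (\<lambda>n. 1 / real n * (\<Sum>k<n. \<integral>z. g ((beta_map b ^^ k) z) \<partial>U01))"
      using integral_beta_map_funpow[OF b, where g = g and B = B] B by (simp add: r_def q_def mult_ac)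
    also have "suminf r / suminf p = (\<integral>y. h y * g y \<partial>U01)"
    proof -
      have norm_le: "norm (q ^ k * (g y * ?I y k)) \<le> B * q ^ k" for k y
        using B[of y] B0 q by (auto simp: abs_mult mult.commute intro!: mult_left_mono mult_right_mono)
      have sg: "summable (\<lambda>k. B * q ^ k)" using q by (intro summable_mult summable_geometric) auto
      have "suminf r = (\<Sum>k. \<integral>y. q ^ k * (g y * ?I y k) \<partial>U01)"
        unfolding r_def by simp
      also have "\<dots> = (\<integral>y. (\<Sum>k. q ^ k * (g y * ?I y k)) \<partial>U01)"
      proof (rule integral_suminf[symmetric])
        show "integrable U01 (\<lambda>y. q ^ k * (g y * ?I y k))" for k using int by (rule integrable_mult_right)
        show "AE y in U01. summable (\<lambda>k. norm (q ^ k * (g y * ?I y k)))"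
          using norm_le by (intro AE_I2 summable_comparison_test'[OF sg, of 0]) simp
        show "summable (\<lambda>k. \<integral>y. norm (q ^ k * (g y * ?I y k)) \<partial>U01)"
        proof (rule summable_comparison_test'[OF sg, of 0])
          fix k :: nat
          have "\<bar>\<integral>y. norm (q ^ k * (g y * ?I y k)) \<partial>U01\<bar> \<le> B * q ^ k"
            by (rule integral_U01_bound) (use norm_le in auto)
          then show "norm (\<integral>y. norm (q ^ k * (g y * ?I y k)) \<partial>U01) \<le> B * q ^ k" by simp
        qed
      qed
      also have "\<dots> = (\<integral>y. g y * (\<Sum>k. q ^ k * ?I y k) \<partial>U01)"
        by (subst suminf_mult[OF sI, symmetric]) (simp add: mult_ac)
      finally show ?thesis by (simp add: h_def mult_ac)
    qed
    finally show "(\<lambda>n. 1 / real n * (\<Sum>k<n. \<integral>z. g ((beta_map b ^^ k) z) \<partial>U01)) \<longlonglongrightarrow> (\<integral>y. h y * g y \<partial>U01)" .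
  qed
qed

section \<open>Weak convergence of the averages\<close>

lemma integral_U01_dist_le:
  assumes "f \<in> borel_measurable borel" "\<And>x. \<bar>f x\<bar> \<le> B" "g \<in> borel_measurable borel" "\<And>x. \<bar>g x\<bar> \<le> B'"
    and e: "\<And>x. 0 \<le> x \<Longrightarrow> x < 1 \<Longrightarrow> \<bar>f x - g x\<bar> \<le> e"
  shows "\<bar>integral\<^sup>L U01 f - integral\<^sup>L U01 g\<bar> \<le> (e :: real)"
proof -
  note i = integrable_U01[OF assms(1,2)] integrable_U01[OF assms(3,4)]
  have "integral\<^sup>L U01 f - integral\<^sup>L U01 g = (\<integral>x. f x - g x \<partial>U01)" using i by simp
  also have "\<bar>\<dots>\<bar> \<le> (\<integral>x. \<bar>f x - g x\<bar> \<partial>U01)" using integral_norm_bound[of U01 "\<lambda>x. f x - g x"] by simp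
  also have "\<dots> \<le> (\<integral>x. e \<partial>U01)"
  proof (rule integral_mono_AE)
    show "AE x in U01. \<bar>f x - g x\<bar> \<le> e" using AE_U01 by (rule eventually_mono) (use e in auto)
    show "integrable U01 (\<lambda>x. e)" by (rule integrable_U01[of _ "\<bar>e\<bar>"]) auto
  qed (use i in auto)
  finally show ?thesis by simp
qed

lemma integral_U01_measurable [measurable]:
  fixes F :: "real \<times> real \<Rightarrow> real"
  assumes [measurable]: "F \<in> borel_measurable borel"
  shows "(\<lambda>x. \<integral>y. F (x, y) \<partial>U01) \<in> borel_measurable borel"
proof -
  interpret finite_measure U01 by (rule finite_measure_U01)
  have [measurable]: "F \<in> borel_measurable (borel \<Otimes>\<^sub>M borel)" unfolding borel_prod by fact
  have "(\<lambda>(x, y). F (x, y)) \<in> borel_measurable (borel \<Otimes>\<^sub>M U01)"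
    by (simp add: measurable_cong_sets[OF sets_pair_measure_cong[OF refl sets_U01] refl])
  then show ?thesis by (rule borel_measurable_lebesgue_integral)
qed

lemma integral_Qsq:
  fixes F :: "real \<times> real \<Rightarrow> real"
  assumes [measurable]: "F \<in> borel_measurable borel" and B: "\<And>p. \<bar>F p\<bar> \<le> B"
  shows "(LINT p:Qsq|lborel. F p) = (\<integral>x. (\<integral>y. F (x, y) \<partial>U01) \<partial>U01)"
proof -
  have B0: "0 \<le> B" using B[of undefined] by (rule order_trans[OF abs_ge_zero])
  have [measurable]: "F \<in> borel_measurable (borel \<Otimes>\<^sub>M borel)" unfolding borel_prod by fact
  have Q: "Qsq \<in> sets borel" unfolding Qsq_def borel_prod[symmetric] by measurable
  have ind: "indicator Qsq (x, y) = indicator {0..<1} x * (indicator {0..<1} y :: real)" for x y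
    by (auto simp: Qsq_def indicator_def)
  have Qfin: "emeasure lborel Qsq < \<infinity>"
  proof -
    have "emeasure lborel Qsq \<le> emeasure lborel (cbox (0::real, 0::real) (1, 1))"
      by (intro emeasure_mono) (auto simp: Qsq_def cbox_Pair_eq[symmetric])
    then show ?thesis using emeasure_lborel_cbox_finite[of "(0::real,0::real)" "(1,1)"] by (simp add: less_top le_less_trans)
  qed
  have i: "integrable lborel (\<lambda>p. indicator Qsq p * F p)"
  proof (rule Bochner_Integration.integrable_bound)
    show "integrable lborel (\<lambda>p. B * indicator Qsq p)" using Q Qfin by simp
    show "(\<lambda>p. indicator Qsq p * F p) \<in> borel_measurable lborel" using Q by measurable
    show "AE p in lborel. norm (indicator Qsq p * F p) \<le> norm (B * indicator Qsq p)"
      using B B0 by (auto simp: indicator_def)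
  qed
  have "(LINT p:Qsq|lborel. F p) = (\<integral>p. indicator Qsq p * F p \<partial>(lborel \<Otimes>\<^sub>M lborel))"
    by (simp add: set_lebesgue_integral_def lborel_prod)
  also have "\<dots> = (\<integral>x. (\<integral>y. indicator Qsq (x, y) * F (x, y) \<partial>lborel) \<partial>lborel)"
    using i by (intro lborel_pair.integral_fst'[symmetric]) (simp add: lborel_prod)
  also have "\<dots> = (\<integral>x. indicator {0..<1} x * (\<integral>y. F (x, y) \<partial>U01) \<partial>lborel)"
    by (simp add: ind integral_U01 mult.assoc)
  also have "\<dots> = (\<integral>x. (\<integral>y. F (x, y) \<partial>U01) \<partial>U01)"
    by (rule integral_U01[symmetric]) measurable
  finally show ?thesis .
qed

lemma integral_Qsq_dist_le:
  fixes F :: "real \<times> real \<Rightarrow> real"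
  assumes F: "F \<in> borel_measurable borel" "\<And>p. \<bar>F p\<bar> \<le> B"
    and g: "g \<in> borel_measurable borel" "\<And>y. \<bar>g y\<bar> \<le> B'"
    and e: "\<And>x y. 0 \<le> x \<Longrightarrow> x < 1 \<Longrightarrow> 0 \<le> y \<Longrightarrow> y < 1 \<Longrightarrow> \<bar>F (x, y) - g y\<bar> \<le> e"
  shows "\<bar>(LINT p:Qsq|lborel. F p) - integral\<^sup>L U01 g\<bar> \<le> e"
proof -
  note [measurable] = F(1) g(1)
  have "\<bar>(\<integral>x. (\<integral>y. F (x, y) \<partial>U01) \<partial>U01) - (\<integral>x. integral\<^sup>L U01 g \<partial>U01)\<bar> \<le> e"
  proof (rule integral_U01_dist_le)
    show "\<bar>\<integral>y. F (x, y) \<partial>U01\<bar> \<le> B" for x using F by (intro integral_U01_bound) auto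
    fix x :: real assume "0 \<le> x" "x < 1"
    then show "\<bar>(\<integral>y. F (x, y) \<partial>U01) - integral\<^sup>L U01 g\<bar> \<le> e"
      using F g e by (intro integral_U01_dist_le[of _ B _ B']) auto
  qed auto
  then show ?thesis by (simp add: integral_Qsq[OF F])
qed

lemma Tmap_funpow_bounds:
  assumes "0 < l" "l < 1" "1 < b" "b < 2" "0 \<le> x" "x < 1" "0 \<le> y" "y < 1"
  shows "0 \<le> fst ((Tmap b l ^^ n) (x, y)) \<and> fst ((Tmap b l ^^ n) (x, y)) < 1 \<and>
    0 \<le> snd ((Tmap b l ^^ n) (x, y)) \<and> snd ((Tmap b l ^^ n) (x, y)) < 1"
proof (induction n)
  case (Suc n)
  obtain u v where uv: "(Tmap b l ^^ n) (x, y) = (u, v)" by fastforce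
  have u: "0 \<le> u" "u < 1" using Suc uv by auto
  then have "l * u < l * 1" using assms by (intro mult_strict_left_mono) auto
  then have 1: "l * u < 1" "l * u + 1 - l < 1" using \<open>l < 1\<close> by linarith+
  have "0 \<le> l * u" using u assms by simp
  then have 2: "0 \<le> l * u" "0 \<le> l * u + 1 - l" using \<open>l < 1\<close> by linarith+
  have 3: "0 \<le> beta_map b v" "beta_map b v < 1" using beta_map_bounds_less[of b v] Suc uv assms by auto
  have 4: "fst ((Tmap b l ^^ Suc n) (x, y)) = (if v < 1 / b then l * u else l * u + 1 - l)"
    "snd ((Tmap b l ^^ Suc n) (x, y)) = beta_map b v"
    using uv by (auto simp: Tmap_def beta_map_def)
  show ?case unfolding 4 using 1 2 3 by presburger
qed (use assms in auto)

lemma Tmap_funpow_contract: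
  "fst ((Tmap b l ^^ n) (x, y)) - fst ((Tmap b l ^^ n) (x', y)) = l ^ n * (x - x')"
proof (induction n)
  case (Suc n)
  obtain u v u' v' where uv: "(Tmap b l ^^ n) (x, y) = (u, v)" "(Tmap b l ^^ n) (x', y) = (u', v')" by fastforce
  moreover have "v = v'" using snd_Tmap_funpow[where n = n and b = b and l = l] uv by (metis snd_conv)
  moreover have "l * (u - u') = l * (l ^ n * (x - x'))" using Suc uv by simp
  ultimately show ?case by (auto simp: Tmap_def algebra_simps)
qed simp

text \<open>Neither sequence is known to converge beforehand. A single \<open>B M\<close> close to
  almost all \<open>a n\<close> makes \<open>a\<close> Cauchy, and then \<open>B\<close> is forced
  to its limit.\<close>

lemma common_limit:
  fixes a B :: "nat \<Rightarrow> real"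
  assumes ap: "\<And>e. 0 < e \<Longrightarrow> \<exists>M. \<forall>m\<ge>M. \<forall>\<^sub>F n in sequentially. \<bar>a n - B m\<bar> \<le> e"
  shows "\<exists>L. a \<longlonglongrightarrow> L \<and> B \<longlonglongrightarrow> L"
proof -
  have "Cauchy a"
  proof (rule metric_CauchyI)
    fix e :: real assume e: "0 < e"
    then obtain M where "\<forall>\<^sub>F n in sequentially. \<bar>a n - B M\<bar> \<le> e / 3" using ap[of "e / 3"] by auto
    then obtain N where N: "\<And>n. n \<ge> N \<Longrightarrow> \<bar>a n - B M\<bar> \<le> e / 3" by (auto simp: eventually_sequentially)
    show "\<exists>N. \<forall>m\<ge>N. \<forall>n\<ge>N. dist (a m) (a n) < e"
    proof (intro exI[of _ N] allI impI)
      fix m n assume "N \<le> m" "N \<le> n"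
      from N[OF this(1)] N[OF this(2)] e show "dist (a m) (a n) < e" unfolding dist_real_def by argo
    qed
  qed
  then obtain L where L: "a \<longlonglongrightarrow> L" by (auto simp: Cauchy_convergent_iff convergent_def)
  have "B \<longlonglongrightarrow> L"
  proof (rule LIMSEQ_I)
    fix e :: real assume e: "0 < e"
    then obtain M where M: "\<And>m. m \<ge> M \<Longrightarrow> \<forall>\<^sub>F n in sequentially. \<bar>a n - B m\<bar> \<le> e / 2" using ap[of "e / 2"] by auto
    have "\<bar>L - B m\<bar> \<le> e / 2" if "m \<ge> M" for m
      by (rule tendsto_upperbound[OF _ M[OF that]]) (auto intro!: tendsto_intros L)
    then have "\<bar>B m - L\<bar> < e" if "m \<ge> M" for m using that e by (smt (verit) field_sum_of_halves)
    then show "\<exists>no. \<forall>n\<ge>no. norm (B n - L) < e" by auto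
  qed
  with L show ?thesis by blast
qed

text \<open>Test functions are merely continuous and bounded on the plane, so uniformity comes from
  compactness. The x-range reaches 2 to include the smoothed points x + U.\<close>

lemma continuous_strip_modulus:
  fixes f :: "real \<times> real \<Rightarrow> real"
  assumes "continuous_on UNIV f" "0 < e"
  obtains d where "d > 0"
    "\<And>x x' y. 0 \<le> x \<Longrightarrow> x \<le> 2 \<Longrightarrow> 0 \<le> x' \<Longrightarrow> x' \<le> 2 \<Longrightarrow> 0 \<le> y \<Longrightarrow> y \<le> 1 \<Longrightarrow> \<bar>x - x'\<bar> < d \<Longrightarrow> \<bar>f (x, y) - f (x', y)\<bar> \<le> e"
proof -
  have "uniformly_continuous_on ({0..2} \<times> {0..1}) f"
    by (intro compact_uniformly_continuous continuous_on_subset[OF assms(1)] compact_Times compact_Icc) auto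
  then obtain d where d: "d > 0" "\<And>p p'. p \<in> {0..2} \<times> {0..1} \<Longrightarrow> p' \<in> {0..2} \<times> {0..1} \<Longrightarrow> dist p' p < d \<Longrightarrow> dist (f p') (f p) < e"
    using assms(2) unfolding uniformly_continuous_on_def by metis
  show ?thesis
  proof (rule that[OF d(1)])
    fix x x' y :: real
    assume "0 \<le> x" "x \<le> 2" "0 \<le> x'" "x' \<le> 2" "0 \<le> y" "y \<le> 1" "\<bar>x - x'\<bar> < d"
    then have "dist (f (x, y)) (f (x', y)) < e"
      by (intro d(2)) (auto simp: dist_Pair_Pair dist_real_def)
    then show "\<bar>f (x, y) - f (x', y)\<bar> \<le> e" by (simp add: dist_real_def)
  qed
qed

lemma shifted_sum_approx:
  fixes a d :: "nat \<Rightarrow> real"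
  assumes "\<And>k. \<bar>a (k + m) - d k\<bar> \<le> e" "\<And>k. \<bar>a k\<bar> \<le> F"
  shows "\<bar>(\<Sum>k<n + m. a k) - (\<Sum>k<n. d k)\<bar> \<le> real n * e + real m * F"
proof (induction n)
  case 0
  have "\<bar>\<Sum>k<m. a k\<bar> \<le> (\<Sum>k<m. \<bar>a k\<bar>)" by (rule sum_abs)
  also have "\<dots> \<le> (\<Sum>k<m. F)" by (intro sum_mono assms(2))
  finally show ?case by simp
next
  case (Suc n)
  have "(\<Sum>k<Suc n + m. a k) - (\<Sum>k<Suc n. d k) = ((\<Sum>k<n + m. a k) - (\<Sum>k<n. d k)) + (a (n + m) - d n)"
    by simp
  then have "\<bar>(\<Sum>k<Suc n + m. a k) - (\<Sum>k<Suc n. d k)\<bar> \<le> \<bar>(\<Sum>k<n + m. a k) - (\<Sum>k<n. d k)\<bar> + \<bar>a (n + m) - d n\<bar>"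
    using abs_triangle_ineq by metis
  also have "\<dots> \<le> (real n * e + real m * F) + e" using Suc assms(1)[of n] by (intro add_mono) auto
  finally show ?case by (simp add: algebra_simps)
qed

text \<open>After \<open>m\<close> more steps the x-coordinate at time k matters only up to l^m, so
  it may be reset to 0. What remains is an observable of the expanding coordinate alone, to which
  the one-dimensional averages apply; the first \<open>m\<close> terms vanish in the
  average.\<close>

lemma avg_push_limit:
  fixes f :: "real \<times> real \<Rightarrow> real"
  assumes b: "1 < b" "b < 2" and l: "0 < l" "l < 1"
    and f: "continuous_on UNIV f" "\<And>p. \<bar>f p\<bar> \<le> F"
    and cesaro: "\<And>g B. g \<in> borel_measurable borel \<Longrightarrow> (\<And>y. \<bar>g y\<bar> \<le> B) \<Longrightarrow>
      (\<lambda>n. 1 / real n * (\<Sum>k<n. \<integral>z. g ((beta_map b ^^ k) z) \<partial>U01)) \<longlonglongrightarrow> (\<integral>y. h y * g y \<partial>U01)"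
  shows "\<exists>L. (\<lambda>n. avg_push b l n f) \<longlonglongrightarrow> L \<and>
    (\<lambda>m. \<integral>z. h z * f ((Tmap b l ^^ m) (0, z)) \<partial>U01) \<longlonglongrightarrow> L"
proof -
  have [measurable]: "f \<in> borel_measurable borel" by (rule borel_measurable_continuous_onI[OF f(1)])
  define a where "a k = (LINT p:Qsq|lborel. f ((Tmap b l ^^ k) p))" for k
  have Fm: "(\<lambda>p. f ((Tmap b l ^^ k) p)) \<in> borel_measurable borel" for k by measurable
  define g where "g m y = f ((Tmap b l ^^ m) (0, y))" for m y
  have gm [measurable]: "g m \<in> borel_measurable borel" for m
    unfolding g_def by (rule section_measurable) (rule Fm)
  have gB: "\<bar>g m y\<bar> \<le> F" for m y by (simp add: g_def f)
  have F0: "0 \<le> F" using f(2)[of undefined] by (rule order_trans[OF abs_ge_zero])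
  have aF: "\<bar>a k\<bar> \<le> F" for k
  proof -
    have "\<bar>a k - (\<integral>y. 0 \<partial>U01)\<bar> \<le> F"
      unfolding a_def by (rule integral_Qsq_dist_le[OF Fm f(2), of _ 0]) (use f(2) in auto)
    then show ?thesis by simp
  qed
  have "\<exists>M. \<forall>m\<ge>M. \<forall>\<^sub>F n in sequentially. \<bar>avg_push b l n f - (\<integral>z. h z * g m z \<partial>U01)\<bar> \<le> e"
    if e: "0 < e" for e
  proof -
    from e have "0 < e / 2" by simp
    from continuous_strip_modulus[OF f(1) this] obtain d where d: "d > 0"
      "\<And>x x' y. 0 \<le> x \<Longrightarrow> x \<le> 2 \<Longrightarrow> 0 \<le> x' \<Longrightarrow> x' \<le> 2 \<Longrightarrow> 0 \<le> y \<Longrightarrow> y \<le> 1 \<Longrightarrow> \<bar>x - x'\<bar> < d \<Longrightarrow>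
        \<bar>f (x, y) - f (x', y)\<bar> \<le> e / 2" by metis
    have "(\<lambda>m. l ^ m) \<longlonglongrightarrow> 0" using l by (intro LIMSEQ_power_zero) auto
    then have "\<forall>\<^sub>F m in sequentially. l ^ m < d" using d(1) by (intro order_tendstoD)
    then obtain M where M: "\<And>m. m \<ge> M \<Longrightarrow> l ^ m < d" by (auto simp: eventually_sequentially)
    show ?thesis
    proof (intro exI[of _ M] allI impI)
      fix m assume "m \<ge> M"
      then have m: "l ^ m < d" by (rule M)
      define D where "D k = (\<integral>z. g m ((beta_map b ^^ k) z) \<partial>U01)" for k
      have "\<bar>a (k + m) - D k\<bar> \<le> e / 2" for k
        unfolding a_def D_def
      proof (rule integral_Qsq_dist_le[OF Fm])
        show "\<bar>f ((Tmap b l ^^ (k + m)) p)\<bar> \<le> F" "\<bar>g m ((beta_map b ^^ k) y)\<bar> \<le> F" for p y by (simp_all add: f gB)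
        show "(\<lambda>y. g m ((beta_map b ^^ k) y)) \<in> borel_measurable borel" by measurable
        fix x y :: real assume xy: "0 \<le> x" "x < 1" "0 \<le> y" "y < 1"
        define u where "u = fst ((Tmap b l ^^ k) (x, y))"
        define v where "v = (beta_map b ^^ k) y"
        have uv: "(Tmap b l ^^ k) (x, y) = (u, v)"
          using snd_Tmap_funpow[of k b l "(x, y)"] by (auto simp: u_def v_def prod_eq_iff)
        have T: "(Tmap b l ^^ (k + m)) (x, y) = (Tmap b l ^^ m) (u, v)"
          by (simp add: add.commute[of k] funpow_add uv)
        have u: "0 \<le> u" "u < 1" "0 \<le> v" "v < 1" using Tmap_funpow_bounds[OF l b xy, of k] uv by auto
        define s where "s = (beta_map b ^^ m) v"
        obtain p p' where p: "(Tmap b l ^^ m) (u, v) = (p, s)" "(Tmap b l ^^ m) (0, v) = (p', s)"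
          using snd_Tmap_funpow[of m b l "(u, v)"] snd_Tmap_funpow[of m b l "(0, v)"]
          by (metis s_def snd_conv surj_pair)
        have pb: "0 \<le> p" "p < 1" "0 \<le> p'" "p' < 1" "0 \<le> s" "s < 1"
          using Tmap_funpow_bounds[OF l b u, of m] Tmap_funpow_bounds[OF l b _ _ u(3,4), of 0 m] p by auto
        have "\<bar>p - p'\<bar> = l ^ m * u" using Tmap_funpow_contract[of m b l u v 0] p u l by (simp add: abs_mult)
        also have "\<dots> \<le> l ^ m * 1" using u l by (intro mult_left_mono) auto
        finally have "\<bar>p - p'\<bar> < d" using m by simp
        then have "\<bar>f (p, s) - f (p', s)\<bar> \<le> e / 2" using pb by (intro d(2)) auto
        then show "\<bar>f ((Tmap b l ^^ (k + m)) (x, y)) - g m ((beta_map b ^^ k) y)\<bar> \<le> e / 2"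
          unfolding T p g_def v_def[symmetric] .
      qed
      from shifted_sum_approx[of a m D, OF this aF]
      have S: "\<bar>(\<Sum>k<n + m. a k) - (\<Sum>k<n. D k)\<bar> \<le> real n * (e / 2) + real m * F" for n .
      define B where "B = (\<integral>z. h z * g m z \<partial>U01)"
      have DB: "(\<lambda>n. 1 / real n * (\<Sum>k<n. D k)) \<longlonglongrightarrow> B"
        unfolding D_def B_def by (rule cesaro[OF gm gB])
      have "(\<lambda>n. real n / real (n + m)) \<longlonglongrightarrow> 1"
      proof -
        have "(\<lambda>n. 1 - real m * (1 / real (n + m))) \<longlonglongrightarrow> 1 - real m * 0"
          by (intro tendsto_intros LIMSEQ_ignore_initial_segment[OF lim_1_over_n])
        then have "(\<lambda>n. 1 - real m * (1 / real (n + m))) \<longlonglongrightarrow> 1" by simp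
        moreover have "\<forall>\<^sub>F n in sequentially. 1 - real m * (1 / real (n + m)) = real n / real (n + m)"
          using eventually_gt_at_top[of 0] by eventually_elim (simp add: field_simps)
        ultimately show ?thesis by (simp only: tendsto_cong)
      qed
      from tendsto_mult[OF this DB]
      have L1: "(\<lambda>n. real n / real (n + m) * (1 / real n * (\<Sum>k<n. D k))) \<longlonglongrightarrow> B" by simp
      have L2: "(\<lambda>n. real m * F * (1 / real (n + m))) \<longlonglongrightarrow> real m * F * 0"
        by (intro tendsto_mult tendsto_const LIMSEQ_ignore_initial_segment[OF lim_1_over_n])
      have "\<forall>\<^sub>F n in sequentially. \<bar>real n / real (n + m) * (1 / real n * (\<Sum>k<n. D k)) - B\<bar> < e / 4"
        using tendstoD[OF L1, of "e / 4"] e by (simp add: dist_real_def)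
      moreover have "\<forall>\<^sub>F n in sequentially. real m * F * (1 / real (n + m)) < e / 4"
        using order_tendstoD(2)[OF L2, of "e / 4"] e by simp
      \<comment> \<open>Error budget: e/2 from resetting the x-coordinate, e/4 from the first
        \<open>m\<close> terms, e/4 from the Cesaro limit.\<close>
      ultimately have "\<forall>\<^sub>F n in sequentially. \<bar>avg_push b l (n + m) f - B\<bar> \<le> e"
        using eventually_gt_at_top[of 0]
      proof eventually_elim
        case (elim n)
        have N: "0 < real (n + m)" using elim by simp
        have "real n / real (n + m) * (1 / real n * (\<Sum>k<n. D k)) = 1 / real (n + m) * (\<Sum>k<n. D k)"
          using elim by simp
        then have 1: "\<bar>1 / real (n + m) * (\<Sum>k<n. D k) - B\<bar> < e / 4" using elim by simp
        have "avg_push b l (n + m) f - 1 / real (n + m) * (\<Sum>k<n. D k)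
            = ((\<Sum>k<n + m. a k) - (\<Sum>k<n. D k)) / real (n + m)"
          by (simp add: avg_push_def a_def diff_divide_distrib)
        also have "\<bar>\<dots>\<bar> \<le> (real n * (e / 2) + real m * F) / real (n + m)"
          using S[of n] N by (simp add: divide_right_mono)
        also have "\<dots> = real n / real (n + m) * (e / 2) + real m * F * (1 / real (n + m))"
          by (simp add: add_divide_distrib)
        also have "\<dots> \<le> 1 * (e / 2) + e / 4"
          using elim e by (intro add_mono mult_right_mono) auto
        finally show ?case using 1 by argo
      qed
      then show "\<forall>\<^sub>F n in sequentially. \<bar>avg_push b l n f - (\<integral>z. h z * g m z \<partial>U01)\<bar> \<le> e"
        unfolding B_def[symmetric] by (subst (asm) eventually_sequentially_seg)
    qed
  qed
  from common_limit[of "\<lambda>n. avg_push b l n f" "\<lambda>m. \<integral>z. h z * g m z \<partial>U01", OF this]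
  show ?thesis by (simp add: g_def)
qed

section \<open>Approximating densities\<close>

text \<open>Since \<open>contracted_pos\<close> lies in [0, 1] and the smoothing interval has length
  at most 1, the points x + U stay in [0, 2).\<close>

definition strip :: "(real \<times> real) set" where "strip = {0..<2} \<times> {0..<1}"

definition strip_measure :: "(real \<times> real) measure" where
  "strip_measure = density lborel (\<lambda>p. ennreal (indicator strip p))"

lemma strip_measurable [measurable]: "strip \<in> sets borel"
  unfolding strip_def borel_prod[symmetric] by measurable

lemma indicator_strip: "indicator strip (x, y) = indicator {0..<2} x * (indicator {0..<1} y :: real)"
  by (auto simp: strip_def indicator_def)

lemma emeasure_strip: "emeasure lborel strip < \<infinity>"
proof -
  have "emeasure lborel strip \<le> emeasure lborel (cbox (0::real, 0::real) (2, 1))"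
    by (intro emeasure_mono) (auto simp: strip_def cbox_Pair_eq[symmetric])
  then show ?thesis using emeasure_lborel_cbox_finite[of "(0::real,0::real)" "(2,1)"] by (simp add: less_top le_less_trans)
qed

lemma sets_strip_measure [simp, measurable_cong]: "sets strip_measure = sets borel"
  by (simp add: strip_measure_def)

lemma space_strip_measure [simp]: "space strip_measure = UNIV"
  by (simp add: strip_measure_def)

lemma finite_measure_strip: "finite_measure strip_measure"
  by (rule finite_measureI) (use emeasure_strip in \<open>simp add: strip_measure_def emeasure_density ennreal_indicator\<close>)

lemma integrable_strip_measure:
  fixes G :: "real \<times> real \<Rightarrow> real"
  assumes "G \<in> borel_measurable borel" "\<And>p. \<bar>G p\<bar> \<le> B"
  shows "integrable strip_measure G"
proof -
  interpret finite_measure strip_measure by (rule finite_measure_strip)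
  show ?thesis by (rule integrable_const_bound[of _ B]) (use assms in auto)
qed

lemma integral_strip_measure:
  fixes G :: "real \<times> real \<Rightarrow> real"
  assumes [measurable]: "G \<in> borel_measurable borel" and B: "\<And>p. \<bar>G p\<bar> \<le> B"
  shows "integral\<^sup>L strip_measure G = (\<integral>y. (\<integral>x. indicator {0..<2} x * G (x, y) \<partial>lborel) \<partial>U01)"
proof -
  have [measurable]: "G \<in> borel_measurable (borel \<Otimes>\<^sub>M borel)" unfolding borel_prod by fact
  have e: "integral\<^sup>L strip_measure G = (\<integral>p. indicator strip p * G p \<partial>lborel)"
    unfolding strip_measure_def by (subst integral_density) auto
  have i: "integrable lborel (\<lambda>p. indicator strip p * G p)"
    using integrable_strip_measure[OF assms] unfolding strip_measure_def by (subst (asm) integrable_density) auto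
  have "(\<integral>p. indicator strip p * G p \<partial>lborel) = (\<integral>y. (\<integral>x. indicator strip (x, y) * G (x, y) \<partial>lborel) \<partial>lborel)"
    using lborel_pair.integral_snd[of "\<lambda>x y. indicator strip (x, y) * G (x, y)"] i
    by (simp add: lborel_prod case_prod_unfold)
  also have "\<dots> = (\<integral>y. indicator {0..<1} y * (\<integral>x. indicator {0..<2} x * G (x, y) \<partial>lborel) \<partial>lborel)"
  proof -
    have "indicator strip (x, y) * G (x, y) = indicator {0..<1} y * (indicator {0..<2} x * G (x, y))" for x y
      by (simp add: indicator_strip)
    then show ?thesis by (simp only: integral_mult_right_zero)
  qed
  also have "\<dots> = (\<integral>y. (\<integral>x. indicator {0..<2} x * G (x, y) \<partial>lborel) \<partial>U01)"
  proof (rule integral_U01[symmetric])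
    have "(\<lambda>(y, x). indicator {0..<2} x * G (x, y)) \<in> borel_measurable (borel \<Otimes>\<^sub>M lborel)"
      by measurable
    then show "(\<lambda>y. \<integral>x. indicator {0..<2} x * G (x, y) \<partial>lborel) \<in> borel_measurable borel"
      by (rule lborel.borel_measurable_lebesgue_integral)
  qed
  finally show ?thesis unfolding e .
qed

lemma integral_U01_affine_measurable:
  fixes F :: "real \<times> real \<Rightarrow> real"
  assumes F: "F \<in> borel_measurable borel"
  shows "(\<lambda>y. \<integral>u. F (c + r * u, y) \<partial>U01) \<in> borel_measurable borel"
proof -
  have "(\<lambda>p. F (c + r * snd p, fst p)) \<in> borel_measurable borel"
  proof (rule measurable_compose[OF _ F])
    show "(\<lambda>p. (c + r * snd p, fst p)) \<in> borel \<rightarrow>\<^sub>M (borel :: (real \<times> real) measure)"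
      unfolding borel_prod[symmetric] by measurable
  qed
  from integral_U01_measurable[OF this] show ?thesis unfolding fst_conv snd_conv .
qed

abbreviation contracted_pos :: "real \<Rightarrow> nat list \<Rightarrow> real" where
  "contracted_pos l w \<equiv> (1 - l) * digit_sum l w"

text \<open>A past w over y has mass \<open>branch_weight b w y * h (branch_point b w y)\<close>,
  spread uniformly over an interval whose reciprocal length is b^n. The length b^-n is an upper
  bound for branch weights, which keeps the diagonal terms of the squared norm bounded.\<close>

definition strip_density :: "real \<Rightarrow> real \<Rightarrow> (real \<Rightarrow> real) \<Rightarrow> nat \<Rightarrow> real \<times> real \<Rightarrow> real" where
  "strip_density b l h n = (\<lambda>(x, y). b ^ n * (\<Sum>w\<in>words n. branch_weight b w y *
     (h (branch_point b w y) * indicator {contracted_pos l w..<contracted_pos l w + (1 / b) ^ n} x)))"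

lemma contracted_pos_bounds:
  assumes "0 < l" "l < 1" "w \<in> words n"
  shows "0 \<le> contracted_pos l w \<and> contracted_pos l w \<le> 1"
proof
  show "0 \<le> contracted_pos l w" using assms digit_sum_nonneg[of l w] by simp
  have "digit_sum l w \<le> 1 / (1 - l)" using assms by (intro digit_sum_le) (auto simp: words_def)
  then have "contracted_pos l w \<le> (1 - l) * (1 / (1 - l))" using assms by (intro mult_left_mono) auto
  then show "contracted_pos l w \<le> 1" using assms by simp
qed

lemma strip_density_measurable [measurable]:
  assumes [measurable]: "h \<in> borel_measurable borel"
  shows "strip_density b l h n \<in> borel_measurable borel"
  unfolding strip_density_def borel_prod[symmetric] by measurable

lemma strip_density_bounds:
  assumes b: "1 < b" and h: "\<And>y. 0 \<le> h y" "\<And>y. h y \<le> H"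
  shows "0 \<le> strip_density b l h n p" "\<bar>strip_density b l h n p\<bar> \<le> b ^ n * (2 ^ n * H)"
proof -
  obtain x y where p: "p = (x, y)" by fastforce
  show "0 \<le> strip_density b l h n p"
    unfolding p strip_density_def using b h branch_weight_nonneg[of b] by (auto intro!: mult_nonneg_nonneg sum_nonneg)
  have "\<bar>\<Sum>w\<in>words n. branch_weight b w y * (h (branch_point b w y) * indicator {contracted_pos l w..<contracted_pos l w + (1 / b) ^ n} x)\<bar> \<le> 2 ^ n * H"
    using h order_trans[OF h] by (intro sum_branch_weight_bound[OF b]) (auto simp: indicator_def)
  then show "\<bar>strip_density b l h n p\<bar> \<le> b ^ n * (2 ^ n * H)"
    unfolding p strip_density_def using b by (auto simp: abs_mult intro!: mult_left_mono)
qed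

lemma integral_strip_density:
  fixes F :: "real \<times> real \<Rightarrow> real"
  assumes b: "1 < b" "b < 2" and l: "0 < l" "l < 1" and n: "n > 0"
    and h: "h \<in> borel_measurable borel" "\<And>y. 0 \<le> h y" "\<And>y. h y \<le> H"
    and F: "F \<in> borel_measurable borel" "\<And>p. \<bar>F p\<bar> \<le> B"
  shows "(\<integral>p. F p * strip_density b l h n p \<partial>strip_measure)
    = (\<integral>y. (\<Sum>w\<in>words n. branch_weight b w y * (h (branch_point b w y) * (\<integral>u. F (contracted_pos l w + (1 / b) ^ n * u, y) \<partial>U01))) \<partial>U01)"
proof -
  note [measurable] = h(1) F(1)
  define r where "r = (1 / b) ^ n"
  have r: "0 < r" "r \<le> 1" "b ^ n * r = 1" using b power_le_one[of "1 / b" n] by (auto simp: r_def power_one_over)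
  let ?A = "\<lambda>w. {contracted_pos l w..<contracted_pos l w + r}"
  have [measurable]: "F \<in> borel_measurable (borel \<Otimes>\<^sub>M borel)" unfolding borel_prod by fact
  have B0: "0 \<le> B" using F(2)[of undefined] by (rule order_trans[OF abs_ge_zero])
  have bound: "\<bar>F p * strip_density b l h n p\<bar> \<le> B * (b ^ n * (2 ^ n * H))" for p
    unfolding abs_mult using F(2)[of p] strip_density_bounds(2)[where h = h and H = H and b = b] b h B0 by (intro mult_mono) auto
  have "(\<integral>p. F p * strip_density b l h n p \<partial>strip_measure)
      = (\<integral>y. (\<integral>x. indicator {0..<2} x * (F (x, y) * strip_density b l h n (x, y)) \<partial>lborel) \<partial>U01)"
    by (rule integral_strip_measure[OF _ bound]) measurable
  also have "\<dots> = (\<integral>y. (\<Sum>w\<in>words n. branch_weight b w y * (h (branch_point b w y) * (\<integral>u. F (contracted_pos l w + r * u, y) \<partial>U01))) \<partial>U01)"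
  proof (rule Bochner_Integration.integral_cong[OF refl])
    fix y
    have i: "integrable lborel (\<lambda>x. indicator (?A w) x * F (x, y))" for w
    proof (rule Bochner_Integration.integrable_bound)
      show "integrable lborel (\<lambda>x. B * indicator (?A w) x)" using r by simp
      show "AE x in lborel. norm (indicator (?A w) x * F (x, y)) \<le> norm (B * indicator (?A w) x)"
        using F(2) B0 by (auto simp: indicator_def)
    qed simp
    have "indicator {0..<2} x * (F (x, y) * strip_density b l h n (x, y))
        = (\<Sum>w\<in>words n. b ^ n * (branch_weight b w y * (h (branch_point b w y) * (indicator (?A w) x * F (x, y)))))" for x
    proof -
      have "indicator {0..<2} x * indicator (?A w) x = (indicator (?A w) x :: real)" if "w \<in> words n" for w
        using contracted_pos_bounds[OF l that] r by (auto simp: indicator_def)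
      then show ?thesis
        unfolding strip_density_def r_def[symmetric] by (auto simp: sum_distrib_left mult_ac intro!: sum.cong)
    qed
    then have "(\<integral>x. indicator {0..<2} x * (F (x, y) * strip_density b l h n (x, y)) \<partial>lborel)
        = (\<Sum>w\<in>words n. b ^ n * (branch_weight b w y * (h (branch_point b w y) * (\<integral>x. indicator (?A w) x * F (x, y) \<partial>lborel))))"
      using i by (simp add: Bochner_Integration.integral_sum)
    also have "\<dots> = (\<Sum>w\<in>words n. branch_weight b w y * (h (branch_point b w y) * (\<integral>u. F (contracted_pos l w + r * u, y) \<partial>U01)))"
    proof (rule sum.cong[OF refl])
      fix w
      have "(\<integral>x. indicator (?A w) x * F (x, y) \<partial>lborel)
        = r * (\<integral>u. indicator (?A w) (contracted_pos l w + r * u) * F (contracted_pos l w + r * u, y) \<partial>lborel)"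
        using r by (subst lborel_integral_real_affine[where c = r and t = "contracted_pos l w"]) auto
      also have "(\<integral>u. indicator (?A w) (contracted_pos l w + r * u) * F (contracted_pos l w + r * u, y) \<partial>lborel)
        = (\<integral>u. F (contracted_pos l w + r * u, y) \<partial>U01)"
        using r by (subst integral_U01) (auto intro!: Bochner_Integration.integral_cong simp: indicator_def zero_le_mult_iff)
      finally have "b ^ n * (\<integral>x. indicator (?A w) x * F (x, y) \<partial>lborel) = (b ^ n * r) * (\<integral>u. F (contracted_pos l w + r * u, y) \<partial>U01)"
        by simp
      then show "b ^ n * (branch_weight b w y * (h (branch_point b w y) * (\<integral>x. indicator (?A w) x * F (x, y) \<partial>lborel)))
        = branch_weight b w y * (h (branch_point b w y) * (\<integral>u. F (contracted_pos l w + r * u, y) \<partial>U01))"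
        unfolding r(3) by (simp add: mult_ac)
    qed
    finally show "(\<integral>x. indicator {0..<2} x * (F (x, y) * strip_density b l h n (x, y)) \<partial>lborel)
        = (\<Sum>w\<in>words n. branch_weight b w y * (h (branch_point b w y) * (\<integral>u. F (contracted_pos l w + r * u, y) \<partial>U01)))" .
  qed
  finally show ?thesis by (simp add: r_def)
qed

lemma sum_branch_weight_mult_le:
  assumes b: "1 < b" "b < 2" and y: "0 \<le> y" "y < 1" and G: "\<And>w. w \<in> words n \<Longrightarrow> branch_weight b w y \<noteq> 0 \<Longrightarrow> G w \<le> K" and "0 \<le> K"
  shows "(\<Sum>w\<in>words n. branch_weight b w y * G w) \<le> b / (b - 1) * K"
proof -
  have "(\<Sum>w\<in>words n. branch_weight b w y * G w) \<le> (\<Sum>w\<in>words n. branch_weight b w y * K)"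
  proof (rule sum_mono)
    fix w assume w: "w \<in> words n"
    show "branch_weight b w y * G w \<le> branch_weight b w y * K"
    proof (cases "branch_weight b w y = 0")
      case False
      then show ?thesis using G[OF w] branch_weight_nonneg[of b w y] b by (intro mult_left_mono) auto
    qed simp
  qed
  also have "\<dots> = (\<Sum>w\<in>words n. branch_weight b w y) * K" by (simp add: sum_distrib_right)
  also have "\<dots> \<le> b / (b - 1) * K" using sum_branch_weight_le[OF b y] \<open>0 \<le> K\<close> by (intro mult_right_mono) auto
  finally show ?thesis .
qed

text \<open>Overlap of two pasts: the mass with which both lead to a common, uniformly distributed
  y. Such products appear on squaring \<open>strip_density\<close>.\<close>

definition pair_coeff :: "real \<Rightarrow> nat list \<Rightarrow> nat list \<Rightarrow> real" where
  "pair_coeff b w w' = (\<integral>y. branch_weight b w y * branch_weight b w' y \<partial>U01)"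

lemma integrable_branch_weight_pair: "1 < b \<Longrightarrow> integrable U01 (\<lambda>y. branch_weight b w y * branch_weight b w' y)"
  by (rule integrable_U01[of _ 1])
    (auto simp: abs_mult branch_weight_nonneg branch_weight_le_1 intro!: mult_le_one)

text \<open>One factor of the square is treated as a test function in
  \<open>integral_strip_density\<close>. The interval attached to w meets that of w', of equal
  length, only if the left endpoints are closer than this length.\<close>

lemma strip_density_square_integral_le:
  assumes b: "1 < b" "b < 2" and l: "0 < l" "l < 1" and n: "n > 0"
    and h: "h \<in> borel_measurable borel" "\<And>y. 0 \<le> h y" "\<And>y. h y \<le> H"
  shows "(\<integral>p. (strip_density b l h n p)\<^sup>2 \<partial>strip_measure)
    \<le> H\<^sup>2 * b ^ n * (\<Sum>w\<in>words n. \<Sum>w'\<in>words n. pair_coeff b w w' * (if \<bar>contracted_pos l w - contracted_pos l w'\<bar> < (1 / b) ^ n then 1 else 0))"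
proof -
  note [measurable] = h(1)
  define r where "r = (1 / b) ^ n"
  have r: "0 < r" using b by (auto simp: r_def)
  let ?I = "\<lambda>w w'. if \<bar>contracted_pos l w - contracted_pos l w'\<bar> < r then 1 else (0::real)"
  define S where "S w y = (\<Sum>w'\<in>words n. branch_weight b w' y * ?I w w')" for w y
  have S0: "0 \<le> S w y" for w y unfolding S_def using b branch_weight_nonneg[of b] by (intro sum_nonneg) auto
  have S1: "S w y \<le> 2 ^ n" for w y
    using sum_branch_weight_bound[OF b(1), where G = "\<lambda>w'. ?I w w'" and B = 1 and n = n and y = y] S0[of w y] by (simp add: S_def)
  have Sm [measurable]: "S w \<in> borel_measurable borel" for w unfolding S_def by measurable
  have H0: "0 \<le> H" using h(2)[of 0] h(3)[of 0] by linarith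
  have inner: "(\<integral>u. strip_density b l h n (contracted_pos l w + r * u, y) \<partial>U01) \<le> b ^ n * (H * S w y)" for w y
  proof -
    have le: "strip_density b l h n (contracted_pos l w + r * u, y) \<le> b ^ n * (H * S w y)" if "0 \<le> u" "u < 1" for u
    proof -
      define t where "t = r * u"
      have t: "0 \<le> t" "t < r" using that r by (auto simp: t_def)
      have "indicator {contracted_pos l w'..<contracted_pos l w' + r} (contracted_pos l w + t) \<le> ?I w w'" for w'
        using t by (auto simp: indicator_def)
      then have "branch_weight b w' y * (h (branch_point b w' y) * indicator {contracted_pos l w'..<contracted_pos l w' + r} (contracted_pos l w + t))
          \<le> H * (branch_weight b w' y * ?I w w')" for w'
        unfolding mult.left_commute[of H] using h H0 b branch_weight_nonneg[of b w' y]
        by (intro mult_left_mono mult_mono) auto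
      then have "(\<Sum>w'\<in>words n. branch_weight b w' y * (h (branch_point b w' y) * indicator {contracted_pos l w'..<contracted_pos l w' + r} (contracted_pos l w + t)))
          \<le> H * S w y"
        unfolding S_def sum_distrib_left by (intro sum_mono)
      then show ?thesis
        unfolding strip_density_def r_def[symmetric] t_def[symmetric] using b by (auto intro!: mult_left_mono)
    qed
    have dm: "(\<lambda>u. strip_density b l h n (contracted_pos l w + r * u, y)) \<in> borel_measurable borel" by measurable
    have "(\<integral>u. strip_density b l h n (contracted_pos l w + r * u, y) \<partial>U01) \<le> (\<integral>u. b ^ n * (H * S w y) \<partial>U01)"
    proof (rule integral_mono_AE)
      show "integrable U01 (\<lambda>u. strip_density b l h n (contracted_pos l w + r * u, y))"
        by (rule integrable_U01[OF dm strip_density_bounds(2)[OF b(1) h(2,3)]])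
      show "integrable U01 (\<lambda>u. b ^ n * (H * S w y))" by (rule integrable_U01[of _ "\<bar>b ^ n * (H * S w y)\<bar>"]) auto
      show "AE u in U01. strip_density b l h n (contracted_pos l w + r * u, y) \<le> b ^ n * (H * S w y)"
        using AE_U01 by (rule eventually_mono) (use le in auto)
    qed
    then show ?thesis by simp
  qed
  have inner0: "0 \<le> (\<integral>u. strip_density b l h n (contracted_pos l w + r * u, y) \<partial>U01)" for w y
    using strip_density_bounds(1)[OF b(1) h(2,3)] by (intro Bochner_Integration.integral_nonneg) auto
  have HS: "\<bar>H * (b ^ n * (H * S w y))\<bar> \<le> H * (b ^ n * (H * 2 ^ n))" for w y
    using H0 b S0 S1 by (auto simp: abs_mult intro!: mult_left_mono)
  have "(\<integral>p. (strip_density b l h n p)\<^sup>2 \<partial>strip_measure) = (\<integral>p. strip_density b l h n p * strip_density b l h n p \<partial>strip_measure)"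
    by (simp add: power2_eq_square)
  also have "\<dots> = (\<integral>y. (\<Sum>w\<in>words n. branch_weight b w y * (h (branch_point b w y) * (\<integral>u. strip_density b l h n (contracted_pos l w + r * u, y) \<partial>U01))) \<partial>U01)"
    unfolding r_def by (rule integral_strip_density[OF b l n h _ strip_density_bounds(2)[OF b(1) h(2,3)]]) measurable
  also have "\<dots> \<le> (\<integral>y. (\<Sum>w\<in>words n. branch_weight b w y * (H * (b ^ n * (H * S w y)))) \<partial>U01)"
  proof (rule integral_mono)
    show "integrable U01 (\<lambda>y. \<Sum>w\<in>words n. branch_weight b w y * (H * (b ^ n * (H * S w y))))"
      by (rule integrable_U01[OF _ sum_branch_weight_bound[OF b(1) HS]]) measurable
    have le: "h (branch_point b w y) * (\<integral>u. strip_density b l h n (contracted_pos l w + r * u, y) \<partial>U01) \<le> H * (b ^ n * (H * S w y))" for w y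
      using h inner inner0 H0 by (intro mult_mono) auto
    have "(\<lambda>y. \<integral>u. strip_density b l h n (contracted_pos l w + r * u, y) \<partial>U01) \<in> borel_measurable borel" for w
      by (rule integral_U01_affine_measurable) measurable
    then have m [measurable]: "(\<lambda>y. h (branch_point b w y) * (\<integral>u. strip_density b l h n (contracted_pos l w + r * u, y) \<partial>U01)) \<in> borel_measurable borel" for w
      by measurable
    have hb: "\<bar>h (branch_point b w y) * (\<integral>u. strip_density b l h n (contracted_pos l w + r * u, y) \<partial>U01)\<bar> \<le> H * (b ^ n * (H * 2 ^ n))" for w y
      using le[of w y] HS[of w y] inner0[of w y] h(2)[of "branch_point b w y"] by (auto simp: abs_of_nonneg)
    show "integrable U01 (\<lambda>y. \<Sum>w\<in>words n. branch_weight b w y * (h (branch_point b w y) * (\<integral>u. strip_density b l h n (contracted_pos l w + r * u, y) \<partial>U01)))"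
      by (rule integrable_U01[OF _ sum_branch_weight_bound[OF b(1) hb]]) measurable
    show "(\<Sum>w\<in>words n. branch_weight b w y * (h (branch_point b w y) * (\<integral>u. strip_density b l h n (contracted_pos l w + r * u, y) \<partial>U01)))
      \<le> (\<Sum>w\<in>words n. branch_weight b w y * (H * (b ^ n * (H * S w y))))" for y
      using le b branch_weight_nonneg[of b] by (intro sum_mono mult_left_mono) auto
  qed
  also have "\<dots> = (\<integral>y. (\<Sum>w\<in>words n. \<Sum>w'\<in>words n. (H\<^sup>2 * b ^ n * ?I w w') * (branch_weight b w y * branch_weight b w' y)) \<partial>U01)"
    unfolding S_def sum_distrib_left
    by (intro Bochner_Integration.integral_cong refl sum.cong) (simp add: power2_eq_square)
  also have "\<dots> = (\<Sum>w\<in>words n. \<Sum>w'\<in>words n. (H\<^sup>2 * b ^ n * ?I w w') * pair_coeff b w w')"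
  proof -
    have i: "integrable U01 (\<lambda>y. (H\<^sup>2 * b ^ n * ?I w w') * (branch_weight b w y * branch_weight b w' y))" for w w'
      using integrable_branch_weight_pair[OF b(1)] by (rule integrable_mult_right)
    show ?thesis
      unfolding pair_coeff_def
      by (subst Bochner_Integration.integral_sum, rule Bochner_Integration.integrable_sum, rule i)
        (subst Bochner_Integration.integral_sum, rule i, simp)
  qed
  also have "\<dots> = H\<^sup>2 * b ^ n * (\<Sum>w\<in>words n. \<Sum>w'\<in>words n. pair_coeff b w w' * ?I w w')"
    by (simp add: sum_distrib_left mult_ac)
  finally show ?thesis unfolding r_def .
qed

text \<open>Smoothing moves points horizontally by less than b^-n, so by uniform continuity the
  smoothed and unsmoothed integrals become equal in the limit, the mass over each y being at most
  \<open>C\<close>. The index is \<open>Suc n\<close> because the integral formula is stated for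
  positive n.\<close>

lemma integral_strip_density_limit:
  fixes f :: "real \<times> real \<Rightarrow> real"
  assumes b: "1 < b" "b < 2" and l: "0 < l" "l < 1"
    and h: "h \<in> borel_measurable borel" "\<And>y. 0 \<le> h y" "\<And>y. h y \<le> H"
    and f: "continuous_on UNIV f" "\<And>p. \<bar>f p\<bar> \<le> F"
    and L: "(\<lambda>m. \<integral>z. h z * f ((Tmap b l ^^ m) (0, z)) \<partial>U01) \<longlonglongrightarrow> L"
  shows "(\<lambda>n. \<integral>p. f p * strip_density b l h (Suc n) p \<partial>strip_measure) \<longlonglongrightarrow> L"
proof -
  note [measurable] = h(1)
  have fm [measurable]: "f \<in> borel_measurable borel" by (rule borel_measurable_continuous_onI[OF f(1)])
  have H0: "0 \<le> H" using h(2)[of 0] h(3)[of 0] by linarith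
  have F0: "0 \<le> F" using f(2)[of undefined] by (rule order_trans[OF abs_ge_zero])
  define C where "C = b / (b - 1) * H"
  have C0: "0 \<le> C" using b H0 by (simp add: C_def)
  have *: "\<exists>N. \<forall>n\<ge>N. \<bar>(\<integral>p. f p * strip_density b l h n p \<partial>strip_measure) - (\<integral>z. h z * f ((Tmap b l ^^ n) (0, z)) \<partial>U01)\<bar> \<le> C * e"
    if e: "0 < e" for e
  proof -
    from continuous_strip_modulus[OF f(1) e] obtain d where d: "d > 0"
      "\<And>x x' y. 0 \<le> x \<Longrightarrow> x \<le> 2 \<Longrightarrow> 0 \<le> x' \<Longrightarrow> x' \<le> 2 \<Longrightarrow> 0 \<le> y \<Longrightarrow> y \<le> 1 \<Longrightarrow> \<bar>x - x'\<bar> < d \<Longrightarrow>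
        \<bar>f (x, y) - f (x', y)\<bar> \<le> e" by metis
    have "(\<lambda>n. (1 / b) ^ n) \<longlonglongrightarrow> 0" using b by (intro LIMSEQ_power_zero) auto
    then have "\<forall>\<^sub>F n in sequentially. (1 / b) ^ n < d" using d(1) by (intro order_tendstoD)
    then obtain N where N: "\<And>n. n \<ge> N \<Longrightarrow> (1 / b) ^ n < d" by (auto simp: eventually_sequentially)
    show ?thesis
    proof (intro exI[of _ "Suc N"] allI impI)
      fix n assume n: "n \<ge> Suc N"
      define r where "r = (1 / b) ^ n"
      have r: "0 < r" "r \<le> 1" "r < d" using b power_le_one[of "1 / b" n] N[of n] n by (auto simp: r_def)
      let ?J = "\<lambda>w y. \<integral>u. f (contracted_pos l w + r * u, y) \<partial>U01"
      have Jm: "(\<lambda>y. ?J w y) \<in> borel_measurable borel" for w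
        by (rule integral_U01_affine_measurable[OF fm])
      note [measurable] = Jm
      have JB: "\<bar>?J w y\<bar> \<le> F" for w y by (rule integral_U01_bound) (use f(2) in auto)
      have hF: "\<bar>h z * t\<bar> \<le> H * F" if "\<bar>t\<bar> \<le> F" for z t
        unfolding abs_mult using that h(2)[of z] h(3)[of z] H0 by (intro mult_mono) auto
      have 1: "(\<integral>p. f p * strip_density b l h n p \<partial>strip_measure)
          = (\<integral>y. (\<Sum>w\<in>words n. branch_weight b w y * (h (branch_point b w y) * ?J w y)) \<partial>U01)"
        unfolding r_def by (rule integral_strip_density[OF b l _ h fm f(2)]) (use n in auto)
      have 2: "(\<integral>z. h z * f ((Tmap b l ^^ n) (0, z)) \<partial>U01)
          = (\<integral>y. (\<Sum>w\<in>words n. branch_weight b w y * (h (branch_point b w y) * f (l ^ n * 0 + contracted_pos l w, y))) \<partial>U01)"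
        by (rule integral_Tmap_funpow[OF b fm f(2) h(1), of H]) (use h in auto)
      show "\<bar>(\<integral>p. f p * strip_density b l h n p \<partial>strip_measure) - (\<integral>z. h z * f ((Tmap b l ^^ n) (0, z)) \<partial>U01)\<bar> \<le> C * e"
        unfolding 1 2
      proof (rule integral_U01_dist_le)
        show "\<bar>\<Sum>w\<in>words n. branch_weight b w y * (h (branch_point b w y) * ?J w y)\<bar> \<le> 2 ^ n * (H * F)" for y
          by (rule sum_branch_weight_bound[OF b(1) hF[OF JB]])
        show "\<bar>\<Sum>w\<in>words n. branch_weight b w y * (h (branch_point b w y) * f (l ^ n * 0 + contracted_pos l w, y))\<bar> \<le> 2 ^ n * (H * F)" for y
          by (rule sum_branch_weight_bound[OF b(1) hF[OF f(2)]])
        fix y :: real assume y: "0 \<le> y" "y < 1"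
        have J: "\<bar>?J w y - f (contracted_pos l w, y)\<bar> \<le> e" if w: "w \<in> words n" for w
        proof -
          have "\<bar>?J w y - (\<integral>u. f (contracted_pos l w, y) \<partial>U01)\<bar> \<le> e"
          proof (rule integral_U01_dist_le)
            fix u :: real assume u: "0 \<le> u" "u < 1"
            then have ru: "0 \<le> r * u" "r * u < r" using r by auto
            show "\<bar>f (contracted_pos l w + r * u, y) - f (contracted_pos l w, y)\<bar> \<le> e"
            proof (rule d(2))
              show "\<bar>contracted_pos l w + r * u - contracted_pos l w\<bar> < d"
                unfolding add_diff_cancel_left' abs_of_nonneg[OF ru(1)] using ru r by linarith
            qed (use ru r contracted_pos_bounds[OF l w] y in linarith)+
          qed (use f(2) in auto)
          then show ?thesis by simp
        qed
        have "\<bar>(\<Sum>w\<in>words n. branch_weight b w y * (h (branch_point b w y) * ?J w y)) - (\<Sum>w\<in>words n. branch_weight b w y * (h (branch_point b w y) * f (l ^ n * 0 + contracted_pos l w, y)))\<bar>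
          = \<bar>\<Sum>w\<in>words n. branch_weight b w y * (h (branch_point b w y) * (?J w y - f (contracted_pos l w, y)))\<bar>"
          by (simp add: sum_subtractf[symmetric] right_diff_distrib)
        also have "\<dots> \<le> (\<Sum>w\<in>words n. \<bar>branch_weight b w y * (h (branch_point b w y) * (?J w y - f (contracted_pos l w, y)))\<bar>)" by (rule sum_abs)
        also have "\<dots> = (\<Sum>w\<in>words n. branch_weight b w y * \<bar>h (branch_point b w y) * (?J w y - f (contracted_pos l w, y))\<bar>)"
          using b branch_weight_nonneg[of b _ y] by (simp add: abs_mult)
        also have "\<dots> \<le> b / (b - 1) * (H * e)"
        proof (rule sum_branch_weight_mult_le[OF b y])
          show "\<bar>h (branch_point b w y) * (?J w y - f (contracted_pos l w, y))\<bar> \<le> H * e" if "w \<in> words n" for w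
            unfolding abs_mult using J[OF that] h(2)[of "branch_point b w y"] h(3)[of "branch_point b w y"] H0 by (intro mult_mono) auto
        qed (use H0 e in auto)
        finally show "\<bar>(\<Sum>w\<in>words n. branch_weight b w y * (h (branch_point b w y) * ?J w y)) - (\<Sum>w\<in>words n. branch_weight b w y * (h (branch_point b w y) * f (l ^ n * 0 + contracted_pos l w, y)))\<bar> \<le> C * e"
          by (simp add: C_def mult_ac)
      qed measurable
    qed
  qed
  have "(\<lambda>n. (\<integral>p. f p * strip_density b l h n p \<partial>strip_measure) - (\<integral>z. h z * f ((Tmap b l ^^ n) (0, z)) \<partial>U01)) \<longlonglongrightarrow> 0"
  proof (rule LIMSEQ_I)
    fix e :: real assume e: "0 < e"
    have "0 < e / (C + 1)" using e C0 by simp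
    from *[OF this] obtain N where N: "\<And>n. n \<ge> N \<Longrightarrow>
      \<bar>(\<integral>p. f p * strip_density b l h n p \<partial>strip_measure) - (\<integral>z. h z * f ((Tmap b l ^^ n) (0, z)) \<partial>U01)\<bar> \<le> C * (e / (C + 1))"
      by blast
    have "C * (e / (C + 1)) < e" using e C0 by (simp add: field_simps)
    then show "\<exists>no. \<forall>n\<ge>no. norm ((\<integral>p. f p * strip_density b l h n p \<partial>strip_measure) - (\<integral>z. h z * f ((Tmap b l ^^ n) (0, z)) \<partial>U01) - 0) < e"
      using N by (intro exI[of _ N]) (auto intro: le_less_trans)
  qed
  from tendsto_add[OF this L] have "(\<lambda>n. \<integral>p. f p * strip_density b l h n p \<partial>strip_measure) \<longlonglongrightarrow> L" by simp
  then show ?thesis by (rule LIMSEQ_Suc)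
qed

section \<open>Averaging over the contraction rate\<close>

lemma digit_sum_measurable [measurable]: "(\<lambda>l. digit_sum l w) \<in> borel_measurable borel"
  by (induction w) simp_all

fun common_prefix :: "nat list \<Rightarrow> nat list \<Rightarrow> nat" where
  "common_prefix (d # w) (d' # w') = (if d = d' then Suc (common_prefix w w') else 0)"
| "common_prefix _ _ = 0"

text \<open>A common head digit cancels and leaves l times the difference of the tails, so removing
  it replaces \<open>s\<close> by \<open>s / l0\<close>. At the first disagreement the difference
  has the form treated by \<open>trans\<close>; the tails are still admissible over a preimage of y,
  which bounds their values in base \<open>g\<close>.\<close>

lemma digit_sum_diff_transversal:
  assumes S: "g \<in> Sset" and b: "1 < b" "b < 2" "b \<le> g"
    and C: "0 \<le> C"
    and trans: "\<And>u u' l l' s. set u \<subseteq> {0, 1} \<Longrightarrow> set u' \<subseteq> {0, 1} \<Longrightarrow> 1 / g * digit_sum (1 / g) u' \<le> 1 \<Longrightarrow>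
        1 / g \<le> l \<Longrightarrow> l \<le> l' \<Longrightarrow> l' \<le> 1 / g + e \<Longrightarrow>
        \<bar>1 + l * digit_sum l u - l * digit_sum l u'\<bar> \<le> s \<Longrightarrow> \<bar>1 + l' * digit_sum l' u - l' * digit_sum l' u'\<bar> \<le> s \<Longrightarrow>
        l' - l \<le> C * s"
    and l: "0 < l0" "1 / g \<le> l0" "l0 \<le> l" "l \<le> l'" "l' \<le> 1 / g + e"
  shows "w \<in> words n \<Longrightarrow> w' \<in> words n \<Longrightarrow> w \<noteq> w' \<Longrightarrow> branch_weight b w y \<noteq> 0 \<Longrightarrow> branch_weight b w' y \<noteq> 0 \<Longrightarrow> 0 \<le> y \<Longrightarrow> y < 1 \<Longrightarrow>
    \<bar>digit_sum l w - digit_sum l w'\<bar> \<le> s \<Longrightarrow> \<bar>digit_sum l' w - digit_sum l' w'\<bar> \<le> s \<Longrightarrow> l' - l \<le> C * s * (1 / l0) ^ common_prefix w w'"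
proof (induction n arbitrary: w w' y s)
  case (Suc n)
  obtain d u d' u' where w: "w = d # u" "w' = d' # u'" and u: "u \<in> words n" "u' \<in> words n"
    and d: "d = 0 \<or> d = 1" "d' = 0 \<or> d' = 1"
    using Suc.prems(1,2) by (auto simp: words_Suc)
  define z where "z = (y + real d) / b"
  define z' where "z' = (y + real d') / b"
  have z: "0 \<le> z" "z < 1" "branch_weight b u z \<noteq> 0" "0 \<le> z'" "z' < 1" "branch_weight b u' z' \<noteq> 0"
    using Suc.prems b w by (auto simp: z_def z'_def split: if_splits)
  have su: "set u \<subseteq> {0, 1}" "set u' \<subseteq> {0, 1}" using u by (auto simp: words_def)
  have v: "1 / g * digit_sum (1 / g) u \<le> 1" "1 / g * digit_sum (1 / g) u' \<le> 1"
    using digit_sum_le_of_Sset[OF S b(1,3) z(3,1,2)] digit_sum_le_of_Sset[OF S b(1,3) z(6,4,5)] by auto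
  show ?case
  proof (cases "d = d'")
    case True
    have *: "\<bar>digit_sum x u - digit_sum x u'\<bar> \<le> s / l0" if x: "l0 \<le> x" "\<bar>digit_sum x w - digit_sum x w'\<bar> \<le> s" for x
    proof -
      have "l0 * \<bar>digit_sum x u - digit_sum x u'\<bar> \<le> x * \<bar>digit_sum x u - digit_sum x u'\<bar>" using x by (intro mult_right_mono) auto
      also have "\<dots> = \<bar>digit_sum x w - digit_sum x w'\<bar>"
        using w True x l by (simp add: right_diff_distrib[symmetric] abs_mult)
      finally show ?thesis using x l by (simp add: field_simps)
    qed
    have "l' - l \<le> C * (s / l0) * (1 / l0) ^ common_prefix u u'"
    proof (rule Suc.IH[OF u _ z(3) _ z(1,2)])
      show "u \<noteq> u'" using Suc.prems(3) w True by auto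
      show "branch_weight b u' z \<noteq> 0" using z True by (simp add: z_def z'_def)
      show "\<bar>digit_sum l u - digit_sum l u'\<bar> \<le> s / l0" using Suc.prems l by (intro *) auto
      show "\<bar>digit_sum l' u - digit_sum l' u'\<bar> \<le> s / l0" using Suc.prems l by (intro *) auto
    qed
    then show ?thesis using w True by simp
  next
    case False
    then consider "d = 1" "d' = 0" | "d = 0" "d' = 1" using d by auto
    then have "l' - l \<le> C * s"
    proof cases
      case 1
      show ?thesis
        by (rule trans[OF su v(2)]) (use l Suc.prems w 1 in auto)
    next
      \<comment> \<open>The tail after the digit 0 enters with the minus sign and is the one whose
        value must be bounded, so the tails exchange roles.\<close>
      case 2
      show ?thesis
        by (rule trans[OF su(2,1) v(1)]) (use l Suc.prems w 2 in \<open>auto simp: abs_le_iff\<close>)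
    qed
    then show ?thesis using w False by simp
  qed
qed simp

lemma emeasure_le_of_diameter:
  fixes A :: "real set"
  assumes "0 \<le> K" and A: "\<And>x x'. x \<in> A \<Longrightarrow> x' \<in> A \<Longrightarrow> x \<le> x' \<Longrightarrow> x' - x \<le> K"
  shows "emeasure lborel A \<le> ennreal (2 * K)"
proof (cases "A = {}")
  case False
  then obtain a where a: "a \<in> A" by auto
  have "A \<subseteq> {a - K..a + K}"
  proof
    fix x assume x: "x \<in> A"
    show "x \<in> {a - K..a + K}"
      using A[OF a x] A[OF x a] assms(1) by (cases "x \<le> a") auto
  qed
  then have "emeasure lborel A \<le> emeasure lborel {a - K..a + K}" by (intro emeasure_mono) auto
  also have "\<dots> = ennreal (2 * K)" using assms(1) by simp
  finally show ?thesis .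
qed simp

text \<open>The bound solves K = b / (b - 1) + (t / b) K: the first term is the total weight, and a
  matching first digit costs a factor 1/b but gains a factor t. With t = 1 / l0 the condition t < b
  reads l0 > 1 / b.\<close>

lemma sum_branch_weight_common_prefix_le:
  assumes b: "1 < b" "b < 2" and t: "0 < t" "t < b"
  shows "w \<in> words n \<Longrightarrow> 0 \<le> y \<Longrightarrow> y < 1 \<Longrightarrow>
    (\<Sum>w'\<in>words n. branch_weight b w' y * t ^ common_prefix w w') \<le> b / (b - 1) / (1 - t / b)"
proof (induction n arbitrary: w y)
  case 0
  have "1 \<le> c / d" if "1 \<le> c" "0 < d" "d \<le> 1" for c d :: real
    using that by (simp add: le_divide_eq)
  moreover have "1 - t / b \<le> 1" "0 < 1 - t / b" using b t by (auto simp: field_simps)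
  moreover have "1 \<le> b / (b - 1)" using b by (simp add: field_simps)
  ultimately have "1 \<le> b / (b - 1) / (1 - t / b)" by blast
  then show ?case using 0 by simp
next
  case (Suc n)
  define K where "K = b / (b - 1) / (1 - t / b)"
  have tb: "0 < 1 - t / b" using b t by (auto simp: field_simps)
  have K: "b / (b - 1) + t / b * K = K" "0 \<le> K"
  proof -
    have "1 - t / b \<noteq> 0" using tb by linarith
    then have "b / (b - 1) = K * (1 - t / b)" unfolding K_def by (metis nonzero_eq_divide_eq)
    then show "b / (b - 1) + t / b * K = K" by (simp add: algebra_simps)
    show "0 \<le> K" using b tb by (simp add: K_def)
  qed
  obtain d u where w: "w = d # u" "u \<in> words n" "d = 0 \<or> d = 1" using Suc.prems(1) by (auto simp: words_Suc)
  let ?G = "\<lambda>w'. case w' of [] \<Rightarrow> 0 | d' # u' \<Rightarrow> if d' = d then t * t ^ common_prefix u u' else 0"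
  have G: "t ^ common_prefix w w' \<le> 1 + ?G w'" for w'
    using w t by (cases w') auto
  have "(\<Sum>w'\<in>words (Suc n). branch_weight b w' y * t ^ common_prefix w w') \<le> (\<Sum>w'\<in>words (Suc n). branch_weight b w' y * (1 + ?G w'))"
    using G branch_weight_nonneg[of b] b by (intro sum_mono mult_left_mono) auto
  also have "\<dots> = (\<Sum>w'\<in>words (Suc n). branch_weight b w' y) + (\<Sum>w'\<in>words (Suc n). branch_weight b w' y * ?G w')"
    by (simp add: distrib_left sum.distrib)
  also have "(\<Sum>w'\<in>words (Suc n). branch_weight b w' y * ?G w')
    = (if (y + real d) / b < 1 then \<Sum>w'\<in>words n. branch_weight b w' ((y + real d) / b) * (t * t ^ common_prefix u w') else 0) / b"
    using sum_words_branch_weight_Suc[where b = b and n = n and y = y and G = "\<lambda>w' _. ?G w'"] w(3) b by auto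
  also have "\<dots> \<le> t * K / b"
  proof (cases "(y + real d) / b < 1")
    case True
    have "(\<Sum>w'\<in>words n. branch_weight b w' ((y + real d) / b) * (t * t ^ common_prefix u w'))
      = t * (\<Sum>w'\<in>words n. branch_weight b w' ((y + real d) / b) * t ^ common_prefix u w')"
      by (simp add: sum_distrib_left mult_ac)
    also have "\<dots> \<le> t * K"
      unfolding K_def using t True Suc.prems b by (intro mult_left_mono Suc.IH w) auto
    finally show ?thesis using True b by (simp add: divide_right_mono)
  qed (use t K b in simp)
  finally show ?case using sum_branch_weight_le[OF b Suc.prems(2,3), of "Suc n"] K unfolding K_def[symmetric] by simp
qed

lemma pair_coeff_nonneg: "0 < b \<Longrightarrow> 0 \<le> pair_coeff b w w'"
  unfolding pair_coeff_def by (intro Bochner_Integration.integral_nonneg) (simp add: branch_weight_nonneg)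

text \<open>Admissibility is a pointwise condition while \<open>pair_coeff\<close> is an integral;
  this extracts a common endpoint y.\<close>

lemma pair_coeff_witness:
  assumes "pair_coeff b w w' \<noteq> 0"
  obtains y where "0 \<le> y" "y < 1" "branch_weight b w y \<noteq> 0" "branch_weight b w' y \<noteq> 0"
proof -
  have "\<exists>y. 0 \<le> y \<and> y < 1 \<and> branch_weight b w y \<noteq> 0 \<and> branch_weight b w' y \<noteq> 0"
  proof (rule ccontr)
    assume "\<not> ?thesis"
    then have "pair_coeff b w w' = (\<integral>y. 0 \<partial>U01)"
      unfolding pair_coeff_def by (intro integral_U01_cong) auto
    then show False using assms by simp
  qed
  then show ?thesis using that by blast
qed

text \<open>The first summand is the off-diagonal bound, summable over w' for fixed w and y. On the
  diagonal, b^n is absorbed by one of the two equal branch weights.\<close>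

lemma sum_pair_coeff_le:
  assumes b: "1 < b" "b < 2" and t: "0 < t" "t < b" and K: "0 \<le> K1" "0 \<le> K2"
  shows "(\<Sum>w\<in>words n. \<Sum>w'\<in>words n. pair_coeff b w w' * (K1 * t ^ common_prefix w w' + (if w = w' then b ^ n * K2 else 0)))
    \<le> b / (b - 1) * (K1 * (b / (b - 1) / (1 - t / b)) + K2)"
proof -
  let ?G = "\<lambda>w w'. K1 * t ^ common_prefix w w' + (if w = w' then b ^ n * K2 else 0)"
  let ?K = "K1 * (b / (b - 1) / (1 - t / b)) + K2"
  have tb: "0 < 1 - t / b" using b t by (auto simp: field_simps)
  have K0: "0 \<le> ?K" using K b tb by (intro add_nonneg_nonneg mult_nonneg_nonneg divide_nonneg_nonneg) auto
  have i: "integrable U01 (\<lambda>y. (branch_weight b w y * branch_weight b w' y) * ?G w w')" for w w'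
    using integrable_branch_weight_pair[OF b(1)] by (rule integrable_mult_left)
  have "(\<Sum>w\<in>words n. \<Sum>w'\<in>words n. pair_coeff b w w' * ?G w w')
    = (\<integral>y. (\<Sum>w\<in>words n. \<Sum>w'\<in>words n. (branch_weight b w y * branch_weight b w' y) * ?G w w') \<partial>U01)"
    unfolding pair_coeff_def
    by (subst Bochner_Integration.integral_sum, rule Bochner_Integration.integrable_sum, rule i,
        subst Bochner_Integration.integral_sum, rule i, subst integral_mult_left_zero) simp
  also have "\<dots> \<le> (\<integral>y. b / (b - 1) * ?K \<partial>U01)"
  proof (rule integral_mono_AE)
    show "integrable U01 (\<lambda>y. \<Sum>w\<in>words n. \<Sum>w'\<in>words n. (branch_weight b w y * branch_weight b w' y) * ?G w w')"
      by (intro Bochner_Integration.integrable_sum i)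
    show "integrable U01 (\<lambda>y. b / (b - 1) * ?K)" by (rule integrable_U01[of _ "\<bar>b / (b - 1) * ?K\<bar>"]) auto
    have "(\<Sum>w\<in>words n. \<Sum>w'\<in>words n. (branch_weight b w y * branch_weight b w' y) * ?G w w') \<le> b / (b - 1) * ?K"
      if y: "0 \<le> y" "y < 1" for y
    proof -
      have "(\<Sum>w'\<in>words n. branch_weight b w' y * ?G w w') \<le> ?K" if w: "w \<in> words n" for w
      proof -
        have "branch_weight b w y * (b ^ n * K2) \<le> (1 / b) ^ n * (b ^ n * K2)"
          using branch_weight_le[of b w y] w K b by (intro mult_right_mono) (auto simp: words_def)
        also have "\<dots> = K2" using b by (simp add: power_one_over)
        finally have 1: "branch_weight b w y * (b ^ n * K2) \<le> K2" .
        have "(\<Sum>w'\<in>words n. branch_weight b w' y * ?G w w')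
          = K1 * (\<Sum>w'\<in>words n. branch_weight b w' y * t ^ common_prefix w w') + (\<Sum>w'\<in>words n. if w = w' then branch_weight b w' y * (b ^ n * K2) else 0)"
          by (simp add: sum_distrib_left distrib_left sum.distrib mult_ac if_distrib[of "\<lambda>x. _ * x"] cong: if_cong)
        also have "(\<Sum>w'\<in>words n. if w = w' then branch_weight b w' y * (b ^ n * K2) else 0) = branch_weight b w y * (b ^ n * K2)"
          using w by (simp add: sum.delta')
        finally show ?thesis
          using 1 mult_left_mono[OF sum_branch_weight_common_prefix_le[OF b t w y] K(1)] by linarith
      qed
      from sum_branch_weight_mult_le[OF b y this K0] show ?thesis by (simp add: sum_distrib_left mult.assoc)
    qed
    then show "AE y in U01. (\<Sum>w\<in>words n. \<Sum>w'\<in>words n. (branch_weight b w y * branch_weight b w' y) * ?G w w') \<le> b / (b - 1) * ?K"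
      by (intro eventually_mono[OF AE_U01]) blast
  qed
  finally show ?thesis by simp
qed

text \<open>Up to a constant, this bounds the squared \<open>L\<^sup>2\<close>-norm of \<open>strip_density b l h n\<close>.\<close>

definition energy :: "real \<Rightarrow> nat \<Rightarrow> real \<Rightarrow> real" where
  "energy b n l = b ^ n * (\<Sum>w\<in>words n. \<Sum>w'\<in>words n.
     pair_coeff b w w' * (if \<bar>contracted_pos l w - contracted_pos l w'\<bar> < (1 / b) ^ n then 1 else 0))"

lemma energy_nonneg: "0 < b \<Longrightarrow> 0 \<le> energy b n l"
  unfolding energy_def by (intro mult_nonneg_nonneg sum_nonneg) (auto simp: pair_coeff_nonneg)

lemma energy_measurable [measurable]: "energy b n \<in> borel_measurable borel"
  unfolding energy_def by measurable

text \<open>Integrating over l turns closeness of two pasts into the length of a set of parameters.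
  For distinct overlapping words, transversality bounds its diameter by a multiple of b^-n t^m, m
  being the length of the common prefix, and b^-n cancels the factor b^n of \<open>energy\<close>;
  for equal words it is the whole interval.\<close>

lemma energy_average_bound:
  assumes S: "g \<in> Sset" and b: "1 < b" "b < 2" "b \<le> g"
    and C: "0 \<le> C" and e: "1 / g + e < 1"
    and trans: "\<And>u u' l l' s. set u \<subseteq> {0, 1} \<Longrightarrow> set u' \<subseteq> {0, 1} \<Longrightarrow> 1 / g * digit_sum (1 / g) u' \<le> 1 \<Longrightarrow>
        1 / g \<le> l \<Longrightarrow> l \<le> l' \<Longrightarrow> l' \<le> 1 / g + e \<Longrightarrow>
        \<bar>1 + l * digit_sum l u - l * digit_sum l u'\<bar> \<le> s \<Longrightarrow> \<bar>1 + l' * digit_sum l' u - l' * digit_sum l' u'\<bar> \<le> s \<Longrightarrow>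
        l' - l \<le> C * s"
    and l0: "1 / b < l0"
  shows "\<exists>K. \<forall>n. (\<integral>\<^sup>+l. ennreal (indicator {l0..1 / g + e} l * energy b n l) \<partial>lborel) \<le> ennreal K"
proof -
  define I where "I = {l0..1 / g + e}"
  have "0 < 1 / b" using b by simp
  moreover have "1 / g \<le> 1 / b" using b by (intro frac_le) auto
  ultimately have l0': "0 < l0" "1 / g \<le> l0" using l0 by linarith+
  define t where "t = 1 / l0"
  have t: "0 < t" "t < b" using l0 l0' b by (auto simp: t_def field_simps)
  \<comment> \<open>On the interval 1 - l is at least \<open>k\<close>, so closeness of the
    normalised positions passes to \<open>digit_sum\<close> at the cost of 1 / k.\<close>
  define k where "k = 1 - (1 / g + e)"
  have k: "0 < k" using e by (simp add: k_def)
  \<comment> \<open>2 from enclosing a set of given diameter in an interval, \<open>C\<close> from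
    transversality, 1 / k from removing the normalisation.\<close>
  define K1 where "K1 = 2 * (C * (1 / k))"
  have K1: "0 \<le> K1" using C k by (simp add: K1_def)
  define K2 where "K2 = measure lborel I"
  define K where "K = b / (b - 1) * (K1 * (b / (b - 1) / (1 - t / b)) + K2)"
  show ?thesis
  proof (intro exI[of _ K] allI)
    fix n
    define r where "r = (1 / b) ^ n"
    have r: "0 < r" "b ^ n * r = 1" using b by (auto simp: r_def power_one_over)
    define A where "A w w' = {l \<in> I. \<bar>contracted_pos l w - contracted_pos l w'\<bar> < r}" for w w'
    have Am [measurable]: "A w w' \<in> sets borel" for w w' unfolding A_def I_def by measurable
    have Afin: "emeasure lborel (A w w') < \<infinity>" for w w'
    proof -
      have "emeasure lborel (A w w') \<le> emeasure lborel I" by (intro emeasure_mono) (auto simp: A_def I_def)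
      also have "\<dots> < \<infinity>" by (simp add: I_def emeasure_lborel_Icc_eq)
      finally show ?thesis .
    qed
    have A_le: "pair_coeff b w w' * measure lborel (A w w') \<le> pair_coeff b w w' * (r * (K1 * t ^ common_prefix w w' + (if w = w' then b ^ n * K2 else 0)))"
      if w: "w \<in> words n" "w' \<in> words n" for w w'
    proof (cases "pair_coeff b w w' = 0 \<or> w = w'")
      case True
      then consider "pair_coeff b w w' = 0" | "w = w'" by blast
      then show ?thesis
      proof cases
        case 2
        have "measure lborel (A w w') \<le> K2"
          unfolding K2_def I_def by (intro measure_mono_fmeasurable) (auto simp: A_def I_def fmeasurable_def emeasure_lborel_Icc_eq Am[unfolded A_def I_def])
        \<comment> \<open>The diagonal bound has no small factor \<open>r\<close>; inserting b^n r =
          1 brings it to the off-diagonal form.\<close>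
        also have "K2 = (b ^ n * r) * K2" unfolding r(2) by simp
        also have "\<dots> = r * (b ^ n * K2)" by (simp only: mult_ac)
        also have "\<dots> \<le> r * (K1 * t ^ common_prefix w w' + (if w = w' then b ^ n * K2 else 0))"
          using 2 r K1 t by (intro mult_left_mono) auto
        finally show ?thesis using pair_coeff_nonneg[of b w w'] b by (intro mult_left_mono) auto
      qed simp
    next
      case False
      then obtain y where y: "0 \<le> y" "y < 1" "branch_weight b w y \<noteq> 0" "branch_weight b w' y \<noteq> 0" using pair_coeff_witness by blast
      have vd: "\<bar>digit_sum l w - digit_sum l w'\<bar> \<le> r / k" if "l \<in> A w w'" for l
      proof -
        have l: "l \<in> I" "\<bar>contracted_pos l w - contracted_pos l w'\<bar> < r" using that by (auto simp: A_def)
        then have "k \<le> 1 - l" by (auto simp: k_def I_def)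
        then have "k * \<bar>digit_sum l w - digit_sum l w'\<bar> \<le> (1 - l) * \<bar>digit_sum l w - digit_sum l w'\<bar>" by (intro mult_right_mono) auto
        also have "\<dots> = \<bar>contracted_pos l w - contracted_pos l w'\<bar>"
          using \<open>k \<le> 1 - l\<close> k by (simp add: right_diff_distrib[symmetric] abs_mult)
        finally show ?thesis using l k by (simp add: field_simps)
      qed
      have "emeasure lborel (A w w') \<le> ennreal (2 * (C * (r / k) * t ^ common_prefix w w'))"
      proof (rule emeasure_le_of_diameter)
        show "0 \<le> C * (r / k) * t ^ common_prefix w w'" using C r k t by simp
        fix l l' assume ll: "l \<in> A w w'" "l' \<in> A w w'" "l \<le> l'"
        then have "l0 \<le> l" "l' \<le> 1 / g + e" by (auto simp: A_def I_def)
        then show "l' - l \<le> C * (r / k) * t ^ common_prefix w w'"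
          unfolding t_def
          using False y ll vd[OF ll(1)] vd[OF ll(2)] l0' w
          by (intro digit_sum_diff_transversal[OF S b C trans, where n = n and y = y]) auto
      qed
      then have "measure lborel (A w w') \<le> 2 * (C * (r / k) * t ^ common_prefix w w')"
        using C r k t by (simp add: measure_def enn2real_leI)
      also have "\<dots> = r * (K1 * t ^ common_prefix w w' + (if w = w' then b ^ n * K2 else 0))"
        using False by (simp add: K1_def)
      finally show ?thesis using pair_coeff_nonneg[of b w w'] b by (intro mult_left_mono) auto
    qed
    have eq: "indicator I l * energy b n l = b ^ n * (\<Sum>w\<in>words n. \<Sum>w'\<in>words n. pair_coeff b w w' * indicator (A w w') l)" for l
    proof -
      have "indicator I l * (if \<bar>contracted_pos l w - contracted_pos l w'\<bar> < r then 1 else 0) = (indicator (A w w') l :: real)" for w w'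
        by (auto simp: A_def indicator_def)
      then show ?thesis
        unfolding energy_def r_def[symmetric] sum_distrib_left mult.left_commute[of "indicator I l"] by simp
    qed
    have i: "integrable lborel (\<lambda>l. pair_coeff b w w' * indicator (A w w') l)" for w w'
      using Afin by (intro integrable_mult_right) (simp add: less_top)
    have int: "integrable lborel (\<lambda>l. indicator I l * energy b n l)"
      unfolding eq by (intro integrable_mult_right Bochner_Integration.integrable_sum i)
    have "(\<integral>l. indicator I l * energy b n l \<partial>lborel)
      = b ^ n * (\<Sum>w\<in>words n. \<Sum>w'\<in>words n. pair_coeff b w w' * measure lborel (A w w'))"
    proof -
      have j: "(\<integral>l. pair_coeff b w w' * indicator (A w w') l \<partial>lborel) = pair_coeff b w w' * measure lborel (A w w')" for w w'
        by simp
      show ?thesis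
        unfolding eq
        by (subst integral_mult_right_zero, subst Bochner_Integration.integral_sum,
            rule Bochner_Integration.integrable_sum, rule i,
            subst Bochner_Integration.integral_sum, rule i) (simp only: j)
    qed
    also have "\<dots> \<le> b ^ n * (\<Sum>w\<in>words n. \<Sum>w'\<in>words n. pair_coeff b w w' * (r * (K1 * t ^ common_prefix w w' + (if w = w' then b ^ n * K2 else 0))))"
      using b by (intro mult_left_mono sum_mono A_le) auto
    also have "\<dots> = (b ^ n * r) * (\<Sum>w\<in>words n. \<Sum>w'\<in>words n. pair_coeff b w w' * (K1 * t ^ common_prefix w w' + (if w = w' then b ^ n * K2 else 0)))"
      unfolding mult.left_commute[of _ r] sum_distrib_left[symmetric] by simp
    also have "\<dots> \<le> K"
      unfolding r(2) mult_1 K_def by (rule sum_pair_coeff_le[OF b(1,2) t K1]) (simp add: K2_def)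
    finally have "(\<integral>l. indicator I l * energy b n l \<partial>lborel) \<le> K" .
    moreover have "(\<integral>\<^sup>+l. ennreal (indicator I l * energy b n l) \<partial>lborel) = ennreal (\<integral>l. indicator I l * energy b n l \<partial>lborel)"
      using energy_nonneg[of b n] b by (intro nn_integral_eq_integral int) auto
    ultimately show "(\<integral>\<^sup>+l. ennreal (indicator {l0..1 / g + e} l * energy b n l) \<partial>lborel) \<le> ennreal K"
      unfolding I_def[symmetric] by (simp add: ennreal_leI)
  qed
qed

text \<open>By Fatou's lemma the liminf has finite integral, hence is finite almost everywhere, and
  bounds above it recur infinitely often. Both the bound and the index set depend on x.\<close>

lemma AE_infinitely_often_bounded:
  fixes u :: "nat \<Rightarrow> 'a \<Rightarrow> real"
  assumes [measurable]: "\<And>n. u n \<in> borel_measurable M" and "\<And>n. (\<integral>\<^sup>+x. ennreal (u n x) \<partial>M) \<le> ennreal K"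
  shows "AE x in M. \<exists>B. infinite {n. u n x \<le> B}"
proof -
  have "(\<integral>\<^sup>+x. liminf (\<lambda>n. ennreal (u n x)) \<partial>M) \<le> liminf (\<lambda>n. \<integral>\<^sup>+x. ennreal (u n x) \<partial>M)"
    by (rule nn_integral_liminf) simp
  also have "\<dots> \<le> limsup (\<lambda>n. \<integral>\<^sup>+x. ennreal (u n x) \<partial>M)" by (rule Liminf_le_Limsup) simp
  also have "\<dots> \<le> ennreal K" by (intro Limsup_bounded always_eventually allI assms)
  finally have "(\<integral>\<^sup>+x. liminf (\<lambda>n. ennreal (u n x)) \<partial>M) \<noteq> \<infinity>" by (auto simp: top_unique)
  then have "AE x in M. liminf (\<lambda>n. ennreal (u n x)) \<noteq> \<infinity>" by (intro nn_integral_PInf_AE) simp_all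
  then show ?thesis
  proof eventually_elim
    case (elim x)
    show ?case
    proof (rule ccontr)
      assume "\<not> ?thesis"
      then have fin: "finite {n. u n x \<le> B}" for B by auto
      have "\<infinity> \<le> liminf (\<lambda>n. ennreal (u n x))"
        unfolding le_Liminf_iff
      proof (intro allI impI)
        fix y :: ennreal assume "y < \<infinity>"
        then obtain B where B: "y = ennreal B" "0 \<le> B" by (cases y) auto
        have "\<forall>\<^sub>F n in sequentially. \<not> u n x \<le> B"
          unfolding cofinite_eq_sequentially[symmetric] eventually_cofinite not_not by (rule fin)
        then show "\<forall>\<^sub>F n in sequentially. y < ennreal (u n x)"
          by eventually_elim (use B in \<open>auto simp: ennreal_less_iff\<close>)
      qed
      with elim show False by (simp add: top_unique)
    qed
  qed
qed

text \<open>Test integrals converge along the full sequence, and bounded squared norms along a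
  subsequence yield a density with the same limits. Any measure satisfying \<open>is_SRB\<close> has
  these limits as integrals, hence coincides with it.\<close>

lemma SRB_of_bounded_energy:
  assumes b: "1 < b" "b < 2" and l: "0 < l" "l < 1"
    and h: "h \<in> borel_measurable borel" "\<And>y. 0 \<le> h y" "\<And>y. h y \<le> (H :: real)"
    and cesaro: "\<And>g B. g \<in> borel_measurable borel \<Longrightarrow> (\<And>y. \<bar>g y\<bar> \<le> B) \<Longrightarrow>
      (\<lambda>n. 1 / real n * (\<Sum>k<n. \<integral>z. g ((beta_map b ^^ k) z) \<partial>U01)) \<longlonglongrightarrow> (\<integral>y. h y * g y \<partial>U01)"
    and inf: "infinite {n. energy b (Suc n) l \<le> B}"
  shows "(\<exists>\<mu>. is_SRB b l \<mu>) \<and> (\<forall>\<mu>. is_SRB b l \<mu> \<longrightarrow> absolutely_continuous lborel \<mu>)"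
proof -
  obtain s :: "nat \<Rightarrow> nat" where s: "strict_mono s" "\<And>j. energy b (Suc (s j)) l \<le> B"
    using infinite_enumerate[OF inf] by auto
  let ?F = "{f :: real \<times> real \<Rightarrow> real. continuous_on UNIV f \<and> bounded (range f)}"
  have bdd: "\<exists>K. \<forall>p. \<bar>f p\<bar> \<le> K" if "f \<in> ?F" for f
    using that by (auto simp: bounded_iff)
  have limits: "\<exists>L. (\<lambda>n. avg_push b l n f) \<longlonglongrightarrow> L \<and> (\<lambda>n. \<integral>p. f p * strip_density b l h (Suc n) p \<partial>strip_measure) \<longlonglongrightarrow> L"
    if f: "f \<in> ?F" for f
  proof -
    from f have fc: "continuous_on UNIV f" by simp
    from bdd[OF f] obtain K where K: "\<And>p. \<bar>f p\<bar> \<le> K" by auto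
    have "\<exists>L. (\<lambda>n. avg_push b l n f) \<longlonglongrightarrow> L \<and>
        (\<lambda>m. \<integral>z. h z * f ((Tmap b l ^^ m) (0, z)) \<partial>U01) \<longlonglongrightarrow> L"
      by (rule avg_push_limit[OF b l fc K], rule cesaro)
    then obtain L where
      L: "(\<lambda>n. avg_push b l n f) \<longlonglongrightarrow> L" "(\<lambda>m. \<integral>z. h z * f ((Tmap b l ^^ m) (0, z)) \<partial>U01) \<longlonglongrightarrow> L" by blast
    from integral_strip_density_limit[OF b l h fc K L(2)] L(1) show ?thesis by blast
  qed
  define L where "L f = lim (\<lambda>n. avg_push b l n f)" for f
  have L: "(\<lambda>n. avg_push b l n f) \<longlonglongrightarrow> L f" "(\<lambda>n. \<integral>p. f p * strip_density b l h (Suc n) p \<partial>strip_measure) \<longlonglongrightarrow> L f"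
    if f: "f \<in> ?F" for f
  proof -
    from limits[OF f] obtain M where M: "(\<lambda>n. avg_push b l n f) \<longlonglongrightarrow> M"
      "(\<lambda>n. \<integral>p. f p * strip_density b l h (Suc n) p \<partial>strip_measure) \<longlonglongrightarrow> M" by blast
    have "L f = M" unfolding L_def by (rule limI[OF M(1)])
    with M show "(\<lambda>n. avg_push b l n f) \<longlonglongrightarrow> L f" "(\<lambda>n. \<integral>p. f p * strip_density b l h (Suc n) p \<partial>strip_measure) \<longlonglongrightarrow> L f"
      by blast+
  qed
  interpret strip: finite_measure strip_measure by (rule finite_measure_strip)
  have dm: "strip_density b l h n \<in> borel_measurable borel" for n using h(1) by measurable
  obtain g where g: "g \<in> borel_measurable strip_measure" "\<And>x. 0 \<le> g x" "integrable strip_measure g"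
    "\<And>f. f \<in> ?F \<Longrightarrow> (\<integral>x. f x * g x \<partial>strip_measure) = L f"
  proof (rule strip.L2_bounded_weak_limit[of "\<lambda>j. strip_density b l h (Suc (s j))" "H\<^sup>2 * B" ?F L])
    fix n
    show "strip_density b l h (Suc (s n)) \<in> borel_measurable strip_measure" using dm by simp
    show "0 \<le> strip_density b l h (Suc (s n)) x" for x by (rule strip_density_bounds(1)[OF b(1) h(2,3)])
    have "\<bar>(strip_density b l h (Suc (s n)) p)\<^sup>2\<bar> \<le> (b ^ Suc (s n) * (2 ^ Suc (s n) * H))\<^sup>2" for p
    proof -
      have "\<bar>strip_density b l h (Suc (s n)) p\<bar> \<le> b ^ Suc (s n) * (2 ^ Suc (s n) * H)"
        by (rule strip_density_bounds(2)[OF b(1) h(2,3)])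
      from power_mono[OF this abs_ge_zero, of 2] show ?thesis by (simp only: power2_abs abs_power2)
    qed
    then show "integrable strip_measure (\<lambda>x. (strip_density b l h (Suc (s n)) x)\<^sup>2)"
      using dm by (intro integrable_strip_measure) auto
    have "(\<integral>x. (strip_density b l h (Suc (s n)) x)\<^sup>2 \<partial>strip_measure) \<le> H\<^sup>2 * energy b (Suc (s n)) l"
      using strip_density_square_integral_le[OF b l _ h, of "Suc (s n)"] by (simp add: energy_def mult.assoc)
    also have "\<dots> \<le> H\<^sup>2 * B" using s(2) by (intro mult_left_mono) auto
    finally show "(\<integral>x. (strip_density b l h (Suc (s n)) x)\<^sup>2 \<partial>strip_measure) \<le> H\<^sup>2 * B" .
  next
    fix f assume f: "f \<in> ?F"
    then show "f \<in> borel_measurable strip_measure"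
      using borel_measurable_continuous_onI[of f] by simp
    show "\<exists>B. \<forall>x. \<bar>f x\<bar> \<le> B" by (rule bdd[OF f])
    show "(\<lambda>n. \<integral>x. f x * strip_density b l h (Suc (s n)) x \<partial>strip_measure) \<longlonglongrightarrow> L f"
      using LIMSEQ_subseq_LIMSEQ[OF L(2)[OF f] s(1)] by (simp add: o_def)
  qed blast
  define \<mu> where "\<mu> = density strip_measure (\<lambda>x. ennreal (g x))"
  have gm: "(\<lambda>x. ennreal (g x)) \<in> borel_measurable strip_measure" using g(1) by simp
  have fin: "finite_measure \<mu>"
  proof (rule finite_measureI)
    have "emeasure \<mu> (space \<mu>) = (\<integral>\<^sup>+x. ennreal (g x) \<partial>strip_measure)"
      unfolding \<mu>_def using gm by (simp add: emeasure_density)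
    also have "\<dots> = ennreal (\<integral>x. g x \<partial>strip_measure)" using g by (intro nn_integral_eq_integral) auto
    finally show "emeasure \<mu> (space \<mu>) \<noteq> \<infinity>" by simp
  qed
  have sets: "sets \<mu> = sets borel" by (simp add: \<mu>_def)
  have int: "integral\<^sup>L \<mu> f = L f" if f: "f \<in> ?F" for f
  proof -
    have "f \<in> borel_measurable strip_measure" using f borel_measurable_continuous_onI[of f] by simp
    then have "integral\<^sup>L \<mu> f = (\<integral>x. f x * g x \<partial>strip_measure)"
      unfolding \<mu>_def using g by (subst integral_density) (auto simp: mult.commute)
    then show ?thesis using g(4)[OF f] by (simp only:)
  qed
  have ac: "absolutely_continuous lborel \<mu>"
  proof -
    have "absolutely_continuous lborel strip_measure"
      unfolding strip_measure_def by (rule absolutely_continuousI_density) simp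
    moreover have "absolutely_continuous strip_measure \<mu>"
      unfolding \<mu>_def by (rule absolutely_continuousI_density[OF gm])
    ultimately show ?thesis unfolding absolutely_continuous_def by blast
  qed
  have "is_SRB b l \<mu>"
    unfolding is_SRB_def using fin sets int L(1) by simp
  moreover have "\<nu> = \<mu>" if \<nu>: "is_SRB b l \<nu>" for \<nu>
  proof (rule finite_borel_measure_eqI)
    show "finite_measure \<nu>" "sets \<nu> = sets borel" using \<nu> by (auto simp: is_SRB_def)
    fix f :: "real \<times> real \<Rightarrow> real" assume f: "continuous_on UNIV f" "bounded (range f)"
    then have "(\<lambda>n. avg_push b l n f) \<longlonglongrightarrow> integral\<^sup>L \<nu> f" using \<nu> by (auto simp: is_SRB_def)
    with f show "integral\<^sup>L \<nu> f = integral\<^sup>L \<mu> f"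
      by (subst int, simp) (rule LIMSEQ_unique[OF _ L(1)], assumption, simp)
  qed (fact fin sets)+
  ultimately show ?thesis using ac by blast
qed

theorem theorem4p2:
  assumes "\<gamma> \<in> Sset"
  shows "\<exists>\<epsilon>>0. \<forall>\<beta>::real. 1 < \<beta> \<and> \<beta> < 2 \<and> 1 / \<gamma> \<le> 1 / \<beta> \<and> 1 / \<beta> < 1 / \<gamma> + \<epsilon> \<longrightarrow>
           (AE lam in lborel. 1 / \<beta> < lam \<and> lam < 1 / \<gamma> + \<epsilon> \<and> 0 < lam \<and> lam < 1 \<longrightarrow>
              (\<exists>\<mu>. is_SRB \<beta> lam \<mu>) \<and>
              (\<forall>\<mu>. is_SRB \<beta> lam \<mu> \<longrightarrow> absolutely_continuous lborel \<mu>))"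
proof -
  have \<gamma>: "1 < \<gamma>" using assms by (simp add: Sset_def)
  have "0 < 1 / \<gamma>" "1 / \<gamma> < 1" using \<gamma> by auto
  then show ?thesis
  proof (rule transversality)
    fix \<epsilon> C :: real
    assume \<epsilon>: "\<epsilon> > 0" "C > 0" "1 / \<gamma> + \<epsilon> < 1"
      and trans: "\<And>u u' l l' s. set u \<subseteq> {0, 1} \<Longrightarrow> set u' \<subseteq> {0, 1} \<Longrightarrow> 1 / \<gamma> * digit_sum (1 / \<gamma>) u' \<le> 1 \<Longrightarrow>
        1 / \<gamma> \<le> l \<Longrightarrow> l \<le> l' \<Longrightarrow> l' \<le> 1 / \<gamma> + \<epsilon> \<Longrightarrow>
        \<bar>1 + l * digit_sum l u - l * digit_sum l u'\<bar> \<le> s \<Longrightarrow> \<bar>1 + l' * digit_sum l' u - l' * digit_sum l' u'\<bar> \<le> s \<Longrightarrow>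
        l' - l \<le> C * s"
    show ?thesis
    proof (intro exI[of _ \<epsilon>] conjI \<epsilon>(1) allI impI)
      fix \<beta> :: real
      assume "1 < \<beta> \<and> \<beta> < 2 \<and> 1 / \<gamma> \<le> 1 / \<beta> \<and> 1 / \<beta> < 1 / \<gamma> + \<epsilon>"
      then have \<beta>: "1 < \<beta>" "\<beta> < 2" and "1 / \<gamma> \<le> 1 / \<beta>" by auto
      then have \<beta>\<gamma>: "\<beta> \<le> \<gamma>" using \<gamma> by (simp add: field_simps)
      show "AE lam in lborel. 1 / \<beta> < lam \<and> lam < 1 / \<gamma> + \<epsilon> \<and> 0 < lam \<and> lam < 1 \<longrightarrow>
                (\<exists>\<mu>. is_SRB \<beta> lam \<mu>) \<and> (\<forall>\<mu>. is_SRB \<beta> lam \<mu> \<longrightarrow> absolutely_continuous lborel \<mu>)"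
      proof (rule beta_map_cesaro[OF \<beta>])
        fix h and H :: real
        assume h: "h \<in> borel_measurable borel" "\<And>y. 0 \<le> h y" "\<And>y. h y \<le> H"
          and cesaro: "\<And>g B. g \<in> borel_measurable borel \<Longrightarrow> (\<And>y. \<bar>g y\<bar> \<le> B) \<Longrightarrow>
            (\<lambda>n. 1 / real n * (\<Sum>k<n. \<integral>z. g ((beta_map \<beta> ^^ k) z) \<partial>U01)) \<longlonglongrightarrow> (\<integral>y. h y * g y \<partial>U01)"
        \<comment> \<open>The energy bound blows up as the lower end of the parameter interval tends
          to 1/\<beta>, so the parameters above 1/\<beta> are exhausted by countably many closed
          intervals.\<close>
        let ?a = "\<lambda>j. 1 / \<beta> + 1 / real (Suc j)"
        have "AE lam in lborel. \<forall>j. \<exists>B. infinite {n. indicator {?a j..1 / \<gamma> + \<epsilon>} lam * energy \<beta> (Suc n) lam \<le> B}"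
          unfolding AE_all_countable
        proof
          fix j
          have "\<exists>K. \<forall>n. (\<integral>\<^sup>+l. ennreal (indicator {?a j..1 / \<gamma> + \<epsilon>} l * energy \<beta> n l) \<partial>lborel) \<le> ennreal K"
            by (rule energy_average_bound[OF assms \<beta> \<beta>\<gamma> less_imp_le[OF \<epsilon>(2)] \<epsilon>(3)], (rule trans; assumption), simp)
          then obtain K where K: "\<forall>n. (\<integral>\<^sup>+l. ennreal (indicator {?a j..1 / \<gamma> + \<epsilon>} l * energy \<beta> n l) \<partial>lborel) \<le> ennreal K" ..
          show "AE lam in lborel. \<exists>B. infinite {n. indicator {?a j..1 / \<gamma> + \<epsilon>} lam * energy \<beta> (Suc n) lam \<le> B}"
            by (rule AE_infinitely_often_bounded[OF _ K[rule_format]]) measurable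
        qed
        then show ?thesis
        proof (eventually_elim, intro impI, elim conjE)
          fix lam
          assume B: "\<forall>j. \<exists>B. infinite {n. indicator {?a j..1 / \<gamma> + \<epsilon>} lam * energy \<beta> (Suc n) lam \<le> B}"
            and lam: "1 / \<beta> < lam" "lam < 1 / \<gamma> + \<epsilon>" "0 < lam" "lam < 1"
          obtain j where "1 / real (Suc j) < lam - 1 / \<beta>"
            using lam(1) reals_Archimedean[of "lam - 1 / \<beta>"] by (auto simp: inverse_eq_divide)
          then have "indicator {?a j..1 / \<gamma> + \<epsilon>} lam = (1 :: real)" using lam by simp
          with B[rule_format, of j] obtain B where "infinite {n. energy \<beta> (Suc n) lam \<le> B}" by auto
          then show "(\<exists>\<mu>. is_SRB \<beta> lam \<mu>) \<and> (\<forall>\<mu>. is_SRB \<beta> lam \<mu> \<longrightarrow> absolutely_continuous lborel \<mu>)"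
            by (intro SRB_of_bounded_energy[OF \<beta> lam(3,4) h]) (rule cesaro)
        qed
      qed
    qed
  qed
qed

end
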